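(* Let $N$ be a finitely generated nilpotent group of Hirsch length $h(N)=5$. Then $\beta_2(N)>\beta_1(N)$.
   Context: $\beta_i(N)=\dim_{\mathbb{Q}}H_i(N;\mathbb{Q})$ denotes the rational Betti number. The Hirsch length $h(N)$ of a finitely generated nilpotent group $N$ is the number of infinite cyclic factors in a finite composition (subnormal) series of $N$ with cyclic factors. *)

theory Defs
  imports
    "HOL-Algebra.Elementary_Groups"
    "HOL-Algebra.Generated_Groups"
    "HOL-Algebra.AbelCoset"
    "HOL-Library.Poly_Mapping"
    "Jordan_Normal_Form.VS_Connect"
begin

section \<open>Finitely generated nilpotent groups\<close>

definition finitely_generated_group :: "('a, 'b) monoid_scheme \<Rightarrow> bool"
  where "finitely_generated_group G \<longleftrightarrow>
    group G \<and> (\<exists>S. finite S \<and> S \<subseteq> carrier G \<and> generate G S = carrier G)"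

primrec lower_central :: "('a, 'b) monoid_scheme \<Rightarrow> nat \<Rightarrow> 'a set"
  where
    "lower_central G 0 = carrier G"
  | "lower_central G (Suc i) = generate G
      {x \<otimes>\<^bsub>G\<^esub> y \<otimes>\<^bsub>G\<^esub> inv\<^bsub>G\<^esub> x \<otimes>\<^bsub>G\<^esub> inv\<^bsub>G\<^esub> y | x y. x \<in> lower_central G i \<and> y \<in> carrier G}"

definition nilpotent_group :: "('a, 'b) monoid_scheme \<Rightarrow> bool"
  where "nilpotent_group G \<longleftrightarrow> group G \<and> (\<exists>c. lower_central G c = {\<one>\<^bsub>G\<^esub>})"


section \<open>Hirsch length\<close>

text \<open>A series is the list of its terms, from the trivial subgroup up to the whole group.\<close>

definition series_factor :: "('a, 'b) monoid_scheme \<Rightarrow> 'a set list \<Rightarrow> nat \<Rightarrow> 'a set monoid"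
  where "series_factor G Hs i = (G\<lparr>carrier := Hs ! Suc i\<rparr>) Mod (Hs ! i)"

definition subnormal_cyclic_series :: "('a, 'b) monoid_scheme \<Rightarrow> 'a set list \<Rightarrow> bool"
  where "subnormal_cyclic_series G Hs \<longleftrightarrow>
    Hs \<noteq> [] \<and> hd Hs = {\<one>\<^bsub>G\<^esub>} \<and> last Hs = carrier G \<and> (\<forall>H \<in> set Hs. subgroup H G) \<and>
    (\<forall>i. Suc i < length Hs \<longrightarrow>
       (Hs ! i) \<lhd> (G\<lparr>carrier := Hs ! Suc i\<rparr>) \<and> cyclic_group (series_factor G Hs i))"

definition num_infinite_factors :: "('a, 'b) monoid_scheme \<Rightarrow> 'a set list \<Rightarrow> nat"
  where "num_infinite_factors G Hs =
    card {i. Suc i < length Hs \<and> infinite (carrier (series_factor G Hs i))}"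

text \<open>The number does not depend on the chosen series (Schreier refinement). A series exists for
  every finitely generated nilpotent group; the value is unspecified for groups without one.\<close>

definition hirsch_length :: "('a, 'b) monoid_scheme \<Rightarrow> nat"
  where "hirsch_length G = num_infinite_factors G (SOME Hs. subnormal_cyclic_series G Hs)"


section \<open>Rational group homology\<close>

text \<open>The homology with trivial rational coefficients is that of the inhomogeneous bar complex:
  an \<open>n\<close>-chain is a finitely supported rational combination of the symbols
  \<open>[g\<^sub>1|\<dots>|g\<^sub>n]\<close>, written as lists.  All degrees live in one ambient space.\<close>

abbreviation scale_chain :: "rat \<Rightarrow> ('a \<Rightarrow>\<^sub>0 rat) \<Rightarrow> ('a \<Rightarrow>\<^sub>0 rat)"
  where "scale_chain q \<equiv> Poly_Mapping.map ((*) q)"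

definition chain_space :: "(rat, 'a list \<Rightarrow>\<^sub>0 rat) module"
  where "chain_space = \<lparr>carrier = UNIV, mult = undefined, one = undefined, zero = 0, add = (+),
    smult = scale_chain\<rparr>"

definition bar_chains :: "('a, 'b) monoid_scheme \<Rightarrow> nat \<Rightarrow> ('a list \<Rightarrow>\<^sub>0 rat) set"
  where "bar_chains G n = {c. Poly_Mapping.keys c \<subseteq> {gs. length gs = n \<and> set gs \<subseteq> carrier G}}"

text \<open>List positions start at 0, so the \<open>i\<close>-th face, for \<open>0 < i < n\<close>, multiplies the entries at
  positions \<open>i - 1\<close> and \<open>i\<close>.\<close>

definition bar_face :: "('a, 'b) monoid_scheme \<Rightarrow> nat \<Rightarrow> 'a list \<Rightarrow> 'a list"
  where "bar_face G i gs =
    (if i = 0 then tl gs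
     else if i = length gs then butlast gs
     else take (i - 1) gs @ [gs ! (i - 1) \<otimes>\<^bsub>G\<^esub> gs ! i] @ drop (i + 1) gs)"

definition bar_boundary_symbol :: "('a, 'b) monoid_scheme \<Rightarrow> 'a list \<Rightarrow> ('a list \<Rightarrow>\<^sub>0 rat)"
  where "bar_boundary_symbol G gs =
    (if gs = [] then 0
     else \<Sum>i\<le>length gs. Poly_Mapping.single (bar_face G i gs) ((- 1) ^ i))"

definition bar_boundary :: "('a, 'b) monoid_scheme \<Rightarrow> ('a list \<Rightarrow>\<^sub>0 rat) \<Rightarrow> ('a list \<Rightarrow>\<^sub>0 rat)"
  where "bar_boundary G c =
    (\<Sum>gs \<in> Poly_Mapping.keys c.
       scale_chain (Poly_Mapping.lookup c gs) (bar_boundary_symbol G gs))"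

definition bar_cycles :: "('a, 'b) monoid_scheme \<Rightarrow> nat \<Rightarrow> ('a list \<Rightarrow>\<^sub>0 rat) set"
  where "bar_cycles G n = {c \<in> bar_chains G n. bar_boundary G c = 0}"

definition bar_boundaries :: "('a, 'b) monoid_scheme \<Rightarrow> nat \<Rightarrow> ('a list \<Rightarrow>\<^sub>0 rat) set"
  where "bar_boundaries G n = bar_boundary G ` bar_chains G (Suc n)"

definition quotient_module :: "('r, 'v, 'm) module_scheme \<Rightarrow> 'v set \<Rightarrow> ('r, 'v set) module"
  where "quotient_module V W =
    \<lparr>carrier = a_rcosets\<^bsub>V\<^esub> W, mult = undefined, one = undefined, zero = W, add = set_add V,
     smult = (\<lambda>k X. \<Union>x\<in>X. W +>\<^bsub>V\<^esub> (k \<odot>\<^bsub>V\<^esub> x))\<rparr>"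

definition group_homology :: "('a, 'b) monoid_scheme \<Rightarrow> nat \<Rightarrow> (rat, ('a list \<Rightarrow>\<^sub>0 rat) set) module"
  where "group_homology G n =
    quotient_module (chain_space\<lparr>carrier := bar_cycles G n\<rparr>) (bar_boundaries G n)"

definition betti :: "('a, 'b) monoid_scheme \<Rightarrow> nat \<Rightarrow> nat"
  where "betti G n = vectorspace.dim (class_ring :: rat ring) (group_homology G n)"


section \<open>The homology is a vector space\<close>

text \<open>The locale constant \<open>vectorspace.dim\<close> is only determined for actual vector spaces, hence
  \<open>group_homology_vectorspace\<close> below.\<close>

lemma quotient_module_is_module:
  assumes M: "Module.module R V" and W: "submodule R W V"
  shows "Module.module R (quotient_module V W)"
proof -
  interpret M: Module.module R V by fact
  interpret W: submodule R W V by fact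
  have ag: "abelian_group V" by unfold_locales
  have neg: "\<ominus>\<^bsub>V\<^esub> w \<in> W" if w: "w \<in> W" for w
  proof -
    have "(\<ominus>\<^bsub>R\<^esub> \<one>\<^bsub>R\<^esub>) \<odot>\<^bsub>V\<^esub> w \<in> W" using w by simp
    moreover have "w \<in> carrier V" using w W.subset by blast
    ultimately show ?thesis by (simp add: M.smult_l_minus)
  qed
  have "subgroup W (add_monoid V)"
    by (rule group.subgroupI[OF M.a_group])
       (use W.subset W.zero_closed neg in \<open>auto simp: a_inv_def[symmetric] simp del: W.zero_closed\<close>)
  then interpret A: abelian_subgroup W V
    by (intro abelian_subgroupI3 ag additive_subgroup.intro)
  have grp: "comm_group (V A_Mod W)" by (rule A.a_factorgroup_is_comm_group)
  have eq: "carrier (quotient_module V W) = carrier (V A_Mod W)"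
    "add (quotient_module V W) = mult (V A_Mod W)"
    "zero (quotient_module V W) = one (V A_Mod W)"
    by (simp_all add: quotient_module_def A_FactGroup_def FactGroup_def A_RCOSETS_def set_add_def)
  have sm: "k \<odot>\<^bsub>quotient_module V W\<^esub> (W +>\<^bsub>V\<^esub> x) = W +>\<^bsub>V\<^esub> (k \<odot>\<^bsub>V\<^esub> x)"
    if k: "k \<in> carrier R" and x: "x \<in> carrier V" for k x
  proof -
    have *: "W +>\<^bsub>V\<^esub> (k \<odot>\<^bsub>V\<^esub> y) = W +>\<^bsub>V\<^esub> (k \<odot>\<^bsub>V\<^esub> x)" if "y \<in> W +>\<^bsub>V\<^esub> x" for y
    proof -
      from that obtain w where w: "w \<in> W" "y = w \<oplus>\<^bsub>V\<^esub> x"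
        unfolding a_r_coset_def' by auto
      have "k \<odot>\<^bsub>V\<^esub> y = (k \<odot>\<^bsub>V\<^esub> w) \<oplus>\<^bsub>V\<^esub> (k \<odot>\<^bsub>V\<^esub> x)"
        using w k x W.subset by (simp add: M.smult_r_distr subsetD)
      moreover have "k \<odot>\<^bsub>V\<^esub> w \<in> W" using w k by simp
      ultimately have "k \<odot>\<^bsub>V\<^esub> y \<in> W +>\<^bsub>V\<^esub> (k \<odot>\<^bsub>V\<^esub> x)"
        unfolding a_r_coset_def' by auto
      then show ?thesis using k x by (metis A.a_repr_independence' M.smult_closed)
    qed
    have "(\<Union>y\<in>W +>\<^bsub>V\<^esub> x. W +>\<^bsub>V\<^esub> (k \<odot>\<^bsub>V\<^esub> y)) = (\<Union>y\<in>W +>\<^bsub>V\<^esub> x. W +>\<^bsub>V\<^esub> (k \<odot>\<^bsub>V\<^esub> x))"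
      by (rule SUP_cong[OF refl]) (rule *)
    moreover have "x \<in> W +>\<^bsub>V\<^esub> x" using x by (rule A.a_rcos_self)
    then have "W +>\<^bsub>V\<^esub> x \<noteq> {}" by blast
    ultimately show ?thesis by (simp add: quotient_module_def)
  qed
  have add: "(W +>\<^bsub>V\<^esub> x) \<oplus>\<^bsub>quotient_module V W\<^esub> (W +>\<^bsub>V\<^esub> y) = W +>\<^bsub>V\<^esub> (x \<oplus>\<^bsub>V\<^esub> y)"
    if "x \<in> carrier V" "y \<in> carrier V" for x y
    using that by (simp add: quotient_module_def A.a_rcos_sum)
  have car: "X \<in> carrier (quotient_module V W) \<longleftrightarrow> (\<exists>x\<in>carrier V. X = W +>\<^bsub>V\<^esub> x)" for X
    by (auto simp: quotient_module_def A_RCOSETS_def')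
  have ab: "abelian_group (quotient_module V W)"
  proof -
    interpret F: comm_group "V A_Mod W" by fact
    show ?thesis
      by (rule abelian_groupI, unfold eq)
         (fact F.m_closed F.one_closed F.m_assoc F.m_comm F.l_one F.l_inv_ex)+
  qed
  have "Module.module_axioms R (quotient_module V W)"
    by (rule Module.module_axioms.intro)
       (auto simp: car sm add M.smult_l_distr M.smult_r_distr M.smult_assoc1)
  then show ?thesis
    by (intro Module.module.intro M.R.cring_axioms ab)
qed

lemma lookup_scale_chain [simp]: "Poly_Mapping.lookup (scale_chain q c) x = q * Poly_Mapping.lookup c x"
  by transfer (simp add: when_def)

lemma scale_chain_0 [simp]: "scale_chain q 0 = 0"
  by (rule poly_mapping_eqI) simp

lemma chain_space_module: "Module.module (class_ring :: rat ring) chain_space"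
proof -
  have cr: "cring (class_ring :: rat ring)"
    using class_field by (rule field.axioms(1)[THEN domain.axioms(1)])
  have "abelian_group (chain_space :: (rat, 'a list \<Rightarrow>\<^sub>0 rat) module)"
    by (rule abelian_groupI) (auto simp: chain_space_def algebra_simps intro: exI[of _ "- _"])
  moreover have "module_axioms class_ring (chain_space :: (rat, 'a list \<Rightarrow>\<^sub>0 rat) module)"
    by (rule module_axioms.intro)
      (auto simp: chain_space_def lookup_add algebra_simps intro!: poly_mapping_eqI)
  ultimately show ?thesis by (intro Module.module.intro cr)
qed

lemma lookup_bar_boundary:
  assumes "finite S" "Poly_Mapping.keys c \<subseteq> S"
  shows "Poly_Mapping.lookup (bar_boundary G c) y =
    (\<Sum>gs\<in>S. Poly_Mapping.lookup c gs * Poly_Mapping.lookup (bar_boundary_symbol G gs) y)"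
proof -
  have "Poly_Mapping.lookup (bar_boundary G c) y =
    (\<Sum>gs\<in>Poly_Mapping.keys c. Poly_Mapping.lookup c gs * Poly_Mapping.lookup (bar_boundary_symbol G gs) y)"
    by (simp add: bar_boundary_def lookup_sum)
  also have "\<dots> = (\<Sum>gs\<in>S. Poly_Mapping.lookup c gs * Poly_Mapping.lookup (bar_boundary_symbol G gs) y)"
    by (rule sum.mono_neutral_left) (use assms in \<open>auto simp: in_keys_iff\<close>)
  finally show ?thesis .
qed

lemma bar_boundary_add: "bar_boundary G (c + d) = bar_boundary G c + bar_boundary G d"
proof (rule poly_mapping_eqI)
  fix y
  let ?S = "Poly_Mapping.keys c \<union> Poly_Mapping.keys d"
  have "finite ?S" by simp
  note L = lookup_bar_boundary[OF this, of _ G y]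
  show "Poly_Mapping.lookup (bar_boundary G (c + d)) y = Poly_Mapping.lookup (bar_boundary G c + bar_boundary G d) y"
    using L[of "c + d"] L[of c] L[of d] Poly_Mapping.keys_add[of c d]
    by (simp add: lookup_add sum.distrib algebra_simps)
qed

lemma keys_scale_chain: "Poly_Mapping.keys (scale_chain q c) \<subseteq> Poly_Mapping.keys c"
  by (auto simp: in_keys_iff)

lemma bar_boundary_scale: "bar_boundary G (scale_chain q c) = scale_chain q (bar_boundary G c)"
proof (rule poly_mapping_eqI)
  fix y
  note L = lookup_bar_boundary[OF finite_keys[of c], of _ G y]
  show "Poly_Mapping.lookup (bar_boundary G (scale_chain q c)) y = Poly_Mapping.lookup (scale_chain q (bar_boundary G c)) y"
    using L[of "scale_chain q c"] L[of c] keys_scale_chain[of q c]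
    by (simp add: sum_distrib_left algebra_simps)
qed

lemma bar_boundary_0 [simp]: "bar_boundary G 0 = 0" by (simp add: bar_boundary_def)

lemma bar_boundary_sum: "bar_boundary G (sum f A) = (\<Sum>i\<in>A. bar_boundary G (f i))"
  by (induction A rule: infinite_finite_induct) (auto simp: bar_boundary_add)

lemma bar_boundary_single: "bar_boundary G (Poly_Mapping.single gs q) = scale_chain q (bar_boundary_symbol G gs)"
  by (cases "q = 0") (auto simp: bar_boundary_def intro!: poly_mapping_eqI)

lemma bar_face_0 [simp]: "bar_face G 0 gs = tl gs"
  by (simp add: bar_face_def)

lemma bar_face_Suc_single: "bar_face G (Suc 0) [x] = []"
  by (simp add: bar_face_def)

lemma bar_face_1: "bar_face G (Suc 0) (x # y # ys) = (x \<otimes>\<^bsub>G\<^esub> y) # ys"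
  by (simp add: bar_face_def)

lemma bar_face_SS: "i \<le> length ys \<Longrightarrow> bar_face G (Suc (Suc i)) (x # y # ys) = x # bar_face G (Suc i) (y # ys)"
  by (cases i) (auto simp: bar_face_def)

lemma length_bar_face: "gs \<noteq> [] \<Longrightarrow> i \<le> length gs \<Longrightarrow> length (bar_face G i gs) = length gs - 1"
  by (auto simp: bar_face_def)

lemma bar_face_closed:
  assumes "group G" "set gs \<subseteq> carrier G" "i \<le> length gs"
  shows "set (bar_face G i gs) \<subseteq> carrier G"
proof -
  interpret group G by fact
  have "gs ! j \<in> carrier G" if "j < length gs" for j using assms(2) that by (auto simp: subset_iff)
  then show ?thesis using assms
    by (auto simp: bar_face_def dest!: in_set_butlastD list.set_sel(2)[rotated] in_set_takeD in_set_dropD)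
qed

lemma bar_face_commute:
  assumes "group G" "set gs \<subseteq> carrier G" "i < j" "j \<le> length gs" "2 \<le> length gs"
  shows "bar_face G i (bar_face G j gs) = bar_face G (j - 1) (bar_face G i gs)"
  using assms(2-5)
proof (induction gs arbitrary: i j)
  case Nil then show ?case by simp
next
  case (Cons x gs)
  interpret group G by fact
  obtain y ys where gs: "gs = y # ys" using Cons.prems by (cases gs) auto
  show ?case
  proof (cases i)
    case 0
    show ?thesis
    proof (cases "j = 1")
      case True with 0 gs show ?thesis by (simp add: bar_face_1)
    next
      case False
      then obtain k where "j = Suc (Suc k)" using 0 Cons.prems(2) by (metis One_nat_def less_imp_Suc_add plus_1_eq_Suc add_0 not0_implies_Suc)
      with 0 gs Cons.prems show ?thesis by (simp add: bar_face_SS)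
    qed
  next
    case (Suc i')
    then obtain k where j: "j = Suc (Suc k)" using Cons.prems(2) by (metis less_imp_Suc_add add_Suc_right add_Suc)
    have k: "k \<le> length ys" using j gs Cons.prems by simp
    show ?thesis
    proof (cases ys)
      case Nil
      with j gs Suc Cons.prems k show ?thesis by (auto simp: bar_face_SS bar_face_1 bar_face_Suc_single)
    next
      case ys: (Cons z zs)
      show ?thesis
      proof (cases i')
        case 0
        show ?thesis
        proof (cases k)
          case 0
          with \<open>i' = 0\<close> Suc j gs ys Cons.prems show ?thesis
            by (simp add: bar_face_SS bar_face_1 m_assoc)
        next
          case (Suc k')
          with \<open>i' = 0\<close> \<open>i = Suc i'\<close> j gs ys k Cons.prems show ?thesis
            by (simp add: bar_face_SS bar_face_1)
        qed
      next
        case (Suc i'')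
        have ih: "bar_face G i' (bar_face G (Suc k) gs) = bar_face G k (bar_face G i' gs)"
          using Cons.IH[of i' "Suc k"] Cons.prems gs ys j \<open>i = Suc i'\<close> k by simp
        have k': "i'' < k" using Cons.prems \<open>i = Suc i'\<close> j Suc by simp
        then obtain m where m: "k = Suc m" by (cases k) auto
        have len: "length (bar_face G (Suc k) gs) = Suc (length zs)" "length (bar_face G i' gs) = Suc (length zs)"
          using gs ys k k' Suc by (auto simp: length_bar_face)
        then obtain a as b bs where ab: "bar_face G (Suc k) gs = a # as" "bar_face G i' gs = b # bs"
          "length as = length zs" "length bs = length zs"
          by (metis length_Suc_conv)
        have "bar_face G i (bar_face G j (x # gs)) = x # bar_face G i' (bar_face G (Suc k) gs)"
          using j \<open>i = Suc i'\<close> Suc gs ys k k' ab by (simp add: bar_face_SS)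
        moreover have "bar_face G (j - 1) (bar_face G i (x # gs)) = x # bar_face G k (bar_face G i' gs)"
          using j \<open>i = Suc i'\<close> Suc gs ys k k' ab m by (simp add: bar_face_SS)
        ultimately show ?thesis using ih by simp
      qed
    qed
  qed
qed

lemma bar_boundary_boundary_symbol:
  assumes "group G" "set gs \<subseteq> carrier G"
  shows "bar_boundary G (bar_boundary_symbol G gs) = 0"
proof (cases "length gs \<ge> 2")
  case False
  then consider "gs = []" | x where "gs = [x]" by (cases gs; cases "tl gs") auto
  then show ?thesis
    by cases (auto simp: bar_boundary_symbol_def bar_boundary_add bar_boundary_single bar_face_Suc_single intro!: poly_mapping_eqI)
next
  case True
  define n where "n = length gs"
  define t where "t = (\<lambda>j i. Poly_Mapping.single (bar_face G i (bar_face G j gs)) ((-1::rat) ^ (i + j)))"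
  have ne: "gs \<noteq> []" using True by auto
  have step: "bar_boundary G (Poly_Mapping.single (bar_face G j gs) ((-1) ^ j)) = (\<Sum>i<n. t j i)" if "j \<le> n" for j
  proof -
    have len: "length (bar_face G j gs) = n - 1" using that ne by (simp add: length_bar_face n_def)
    then have "bar_face G j gs \<noteq> []" using True n_def by auto
    moreover have "{..n - 1} = {..<n}" using True n_def by auto
    moreover have "scale_chain ((-1) ^ j) (\<Sum>i<n. Poly_Mapping.single (bar_face G i (bar_face G j gs)) ((-1) ^ i)) = (\<Sum>i<n. t j i)"
      by (rule poly_mapping_eqI)
         (auto simp: lookup_sum t_def sum_distrib_left power_add lookup_single when_def intro!: sum.cong)
    ultimately show ?thesis
      by (simp add: bar_boundary_single bar_boundary_symbol_def len)
  qed
  have "bar_boundary G (bar_boundary_symbol G gs) = (\<Sum>j\<le>n. \<Sum>i<n. t j i)"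
    using ne step by (simp add: bar_boundary_symbol_def bar_boundary_sum n_def)
  also have "\<dots> = (\<Sum>(j, i)\<in>{..n} \<times> {..<n}. t j i)"
    by (simp add: sum.cartesian_product)
  also have "{..n} \<times> {..<n} = {(j, i). i < j \<and> j \<le> n} \<union> {(j, i). j \<le> i \<and> i < n}"
    by auto
  also have "(\<Sum>(j, i)\<in>\<dots>. t j i) = (\<Sum>(j, i)\<in>{(j, i). i < j \<and> j \<le> n}. t j i) + (\<Sum>(j, i)\<in>{(j, i). j \<le> i \<and> i < n}. t j i)"
  proof (rule sum.union_disjoint)
    show "finite {(j, i). i < j \<and> j \<le> n}" by (rule finite_subset[of _ "{..n} \<times> {..n}"]) auto
    show "finite {(j, i). j \<le> i \<and> i < n}" by (rule finite_subset[of _ "{..n} \<times> {..n}"]) auto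
  qed auto
  also have "(\<Sum>(j, i)\<in>{(j, i). i < j \<and> j \<le> n}. t j i) = (\<Sum>(j, i)\<in>{(j, i). j \<le> i \<and> i < n}. - t j i)"
  proof (rule sum.reindex_bij_witness[where i = "\<lambda>(j, i). (Suc i, j)" and j = "\<lambda>(j, i). (i, j - 1)"])
    fix p assume "p \<in> {(j, i). i < j \<and> j \<le> n}"
    then obtain j i where p: "p = (j, i)" "i < j" "j \<le> n" by auto
    then have "bar_face G i (bar_face G j gs) = bar_face G (j - 1) (bar_face G i gs)"
      using bar_face_commute assms True n_def by blast
    moreover obtain k where "j = Suc k" using p by (cases j) auto
    ultimately show "(case case p of (j, i) \<Rightarrow> (i, j - 1) of (j, i) \<Rightarrow> - t j i) = (case p of (j, i) \<Rightarrow> t j i)"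
      using p by (simp add: t_def add.commute single_uminus)
  qed auto
  finally show ?thesis by (simp add: case_prod_beta' sum_negf)
qed

lemma bar_boundary_boundary:
  assumes "group G" "c \<in> bar_chains G n"
  shows "bar_boundary G (bar_boundary G c) = 0"
proof -
  have "bar_boundary G (bar_boundary_symbol G gs) = 0" if "gs \<in> Poly_Mapping.keys c" for gs
    using that assms bar_boundary_boundary_symbol by (fastforce simp: bar_chains_def)
  then show ?thesis
    by (simp add: bar_boundary_def[of _ c] bar_boundary_sum bar_boundary_scale)
qed

lemma bar_chains_add: "c \<in> bar_chains G n \<Longrightarrow> d \<in> bar_chains G n \<Longrightarrow> c + d \<in> bar_chains G n"
  using Poly_Mapping.keys_add[of c d] by (fastforce simp: bar_chains_def)

lemma bar_chains_scale: "c \<in> bar_chains G n \<Longrightarrow> scale_chain q c \<in> bar_chains G n"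
  using keys_scale_chain[of q c] by (auto simp: bar_chains_def)

lemma bar_chains_0: "0 \<in> bar_chains G n" by (simp add: bar_chains_def)

lemma bar_chains_sum: "(\<And>i. i \<in> A \<Longrightarrow> f i \<in> bar_chains G n) \<Longrightarrow> sum f A \<in> bar_chains G n"
  by (induction A rule: infinite_finite_induct) (auto simp: bar_chains_0 bar_chains_add)

lemma bar_boundary_closed:
  assumes "group G" "c \<in> bar_chains G (Suc n)"
  shows "bar_boundary G c \<in> bar_chains G n"
  unfolding bar_boundary_def
proof (intro bar_chains_sum bar_chains_scale)
  fix gs assume "gs \<in> Poly_Mapping.keys c"
  then have gs: "length gs = Suc n" "set gs \<subseteq> carrier G" using assms by (auto simp: bar_chains_def)
  then have "(\<Sum>i\<le>length gs. Poly_Mapping.single (bar_face G i gs) ((-1::rat) ^ i)) \<in> bar_chains G n"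
  proof (intro bar_chains_sum)
    fix i assume i: "i \<in> {..length gs}"
    have ne: "gs \<noteq> []" using gs by auto
    show "Poly_Mapping.single (bar_face G i gs) ((-1::rat) ^ i) \<in> bar_chains G n"
      using bar_face_closed[OF assms(1) gs(2), of i] length_bar_face[OF ne, of i G] i gs by (simp add: bar_chains_def)
  qed
  then show "bar_boundary_symbol G gs \<in> bar_chains G n" using gs by (auto simp: bar_boundary_symbol_def)
qed

lemma group_homology_vectorspace:
  assumes "group G"
  shows "vectorspace (class_ring :: rat ring) (group_homology G n)"
proof -
  let ?K = "class_ring :: rat ring"
  let ?Z = "chain_space\<lparr>carrier := bar_cycles G n\<rparr>"
  interpret C: Module.module ?K chain_space by (rule chain_space_module)
  have "submodule ?K (bar_cycles G n) chain_space"
    by (rule submodule.intro[OF chain_space_module])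
      (auto simp: chain_space_def bar_cycles_def bar_chains_add bar_chains_scale bar_chains_0
        bar_boundary_add bar_boundary_scale)
  then have Z: "Module.module ?K ?Z" by (rule C.submodule_is_module)
  have "submodule ?K (bar_boundaries G n) ?Z"
    by (rule submodule.intro[OF Z])
     (auto simp: chain_space_def bar_cycles_def bar_boundaries_def bar_boundary_closed[OF assms]
       bar_boundary_boundary[OF assms] bar_boundary_add[symmetric] bar_boundary_scale[symmetric]
       bar_chains_0 intro!: imageI bar_chains_add bar_chains_scale intro: image_eqI[of _ _ 0])
  then have "Module.module ?K (group_homology G n)"
    unfolding group_homology_def by (rule quotient_module_is_module[OF Z])
  then show ?thesis by (intro vectorspace.intro class_field)
qed

end

theory Submission
  imports
    Defs
    "HOL-Library.Function_Algebras"
    "HOL-Algebra.Multiplicative_Group"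
begin

text \<open>
  The rational cohomology of a subgroup \<open>K\<close> is computed by the \<open>K\<close>-invariant homogeneous cochains on
  the whole group.  All subgroups thus share one ambient complex: restriction is inclusion, and an
  element normalising \<open>K\<close> acts by translating the arguments.  The proof climbs a subnormal series
  with cyclic factors.

  Let \<open>M\<close> be generated by a normal subgroup \<open>L\<close> and an element \<open>t\<close>.  The cochains of \<open>M\<close> are the kernel of
  \<open>t - 1\<close> on those of \<open>L\<close>.  If \<open>M/L\<close> is infinite, then \<open>t - 1\<close> is onto (\<open>delta_onto\<close>), which yields the
  Wang sequence and
  \<open>dim H\<^sup>n(M) = dim ker (t - 1 | H\<^sup>n(L)) + dim coker (t - 1 | H\<^sup>n\<^sup>-\<^sup>1(L))\<close> (\<open>wang\<close>).  If \<open>M/L\<close> is finite,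
  averaging identifies \<open>H(M)\<close> with the classes of \<open>H(L)\<close> fixed by \<open>t\<close>.  Nilpotency enters through
  \<open>unipotent_on_central_chain\<close>: \<open>t\<close> acts unipotently on \<open>H(L)\<close>.  Hence finite steps leave the cohomology
  unchanged, and \<open>t\<close> fixes a one-dimensional top cohomology.  By induction, a term of the series with \<open>h\<close>
  infinite factors below it satisfies Poincare duality in dimension \<open>h\<close> (\<open>duality_M\<close>); when \<open>h = 2k\<close>
  is positive, \<open>H\<^sup>k\<close> has even dimension, because at the last infinite step the classes restricting to
  zero are their own annihilator.

  The inequality appears at the fifth infinite step, from \<open>L\<close> with \<open>h = 4\<close> to \<open>M\<close>.  There \<open>V = H\<^sup>2(L)\<close>
  has even dimension and carries the cup product, a nondegenerate symmetric form \<open>B\<close> for which \<open>t\<close>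
  is a unipotent isometry.  The form \<open>B(tx, y) - B(x, ty)\<close> is alternating and its radical is
  \<open>ker (t - 1)\<close>; alternating forms have even rank, so \<open>ker (t - 1)\<close> has even dimension
  (\<open>even_fixed_space_of_unipotent_isometry\<close>), and being nonzero it has dimension at least two.  With
  \<open>k = dim ker (t - 1 | H\<^sup>1(L))\<close>, which is also the dimension of the cokernel, the Wang sequence gives
  \<open>dim H\<^sup>2(M) \<ge> 2 + k > 1 + k \<ge> dim H\<^sup>1(M)\<close>.  The remaining steps are finite and change nothing.

  Finally, a cochain evaluates on the bar complex, and this pairing identifies the dimensions of
  cohomology and homology (\<open>betti_eq_qdim\<close>).
\<close>


section \<open>Dimensions of quotients of subspaces\<close>

lemma vector_space_field: "vector_space ((*) :: 'k::field \<Rightarrow> 'k \<Rightarrow> 'k)"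
  by unfold_locales (auto simp: algebra_simps)

locale subquotients = vector_space scale for scale :: "'k::field \<Rightarrow> 'v::ab_group_add \<Rightarrow> 'v"
begin

text \<open>The image of \<open>Z\<close> under a projection along \<open>B\<close> is a copy of \<open>Z/B\<close> inside the ambient space.
  Quotients are handled through these copies, so their dimensions are dimensions of subspaces.\<close>

lemma exists_projection_along:
  assumes B: "subspace B"
  shows "\<exists>p. Vector_Spaces.linear scale scale p \<and> (\<forall>v. p v = 0 \<longleftrightarrow> v \<in> B) \<and> (\<forall>v. v - p v \<in> B)"
proof -
  interpret vs: vector_space_pair scale scale by unfold_locales
  obtain b where b: "b \<subseteq> B" "independent b" "B \<subseteq> span b"
    using maximal_independent_subset[of B] by blast
  have spb: "span b = B" using b B by (metis span_minimal subset_antisym)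
  define e where "e = extend_basis b"
  have e: "b \<subseteq> e" "independent e" "span e = UNIV"
    using extend_basis_superset[OF b(2)] independent_extend_basis[OF b(2)] span_extend_basis[OF b(2)]
    by (auto simp: e_def)
  define q where "q = vs.construct e (\<lambda>x. if x \<in> b then x else 0)"
  have lq: "Vector_Spaces.linear scale scale q" unfolding q_def by (rule vs.linear_construct[OF e(2)])
  interpret q: Vector_Spaces.linear scale scale q by fact
  have qe: "q x = (if x \<in> b then x else 0)" if "x \<in> e" for x
    unfolding q_def by (rule vs.construct_basis[OF e(2) that])
  have qB: "q x = x" if "x \<in> B" for x
  proof (rule vs.linear_eq_on[OF lq linear_id[unfolded id_def]])
    show "x \<in> span b" using that b by auto
  qed (use qe e in auto)
  have "q x \<in> span b" for x
  proof -
    have "q x \<in> span ((\<lambda>x. if x \<in> b then x else 0) ` e)" unfolding q_def by (rule vs.construct_in_span[OF e(2)])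
    also have "\<dots> \<subseteq> span b" by (rule span_minimal) (auto intro: span_base span_zero)
    finally show ?thesis .
  qed
  then have qin: "q x \<in> B" for x using spb by auto
  have "Vector_Spaces.linear scale scale (\<lambda>x. x - q x)"
    by (rule vs.linear_compose_sub[OF linear_id[unfolded id_def] lq])
  moreover have "v - q v = 0 \<longleftrightarrow> v \<in> B" for v
    using qB qin[of v] by (metis eq_iff_diff_eq_0)
  ultimately show ?thesis using qin by (intro exI[of _ "\<lambda>x. x - q x"]) auto
qed

definition quot_proj :: "'v set \<Rightarrow> 'v \<Rightarrow> 'v"
  where "quot_proj B = (SOME p. Vector_Spaces.linear scale scale p \<and> (\<forall>v. p v = 0 \<longleftrightarrow> v \<in> B) \<and> (\<forall>v. v - p v \<in> B))"

lemma
  assumes "subspace B"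
  shows linear_quot_proj: "Vector_Spaces.linear scale scale (quot_proj B)"
    and quot_proj_eq_0_iff: "quot_proj B v = 0 \<longleftrightarrow> v \<in> B"
    and diff_quot_proj: "v - quot_proj B v \<in> B"
  using someI_ex[OF exists_projection_along[OF assms]] unfolding quot_proj_def[symmetric] by blast+

definition qdim :: "'v set \<Rightarrow> 'v set \<Rightarrow> nat"
  where "qdim B Z = dim (quot_proj B ` Z)"

definition qfin :: "'v set \<Rightarrow> 'v set \<Rightarrow> bool"
  where "qfin B Z \<longleftrightarrow> (\<exists>S. finite S \<and> Z \<subseteq> span (S \<union> B))"

lemma finite_dim_subspace_basis:
  assumes "finite F" "S \<subseteq> span F"
  obtains E where "finite E" "E \<subseteq> S" "independent E" "S \<subseteq> span E" "card E = dim S"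
proof -
  obtain E where E: "E \<subseteq> S" "independent E" "S \<subseteq> span E" "card E = dim S" by (rule basis_exists)
  then have "finite E" using independent_span_bound[OF assms(1) E(2)] assms(2) by blast
  with E that show ?thesis by blast
qed

text \<open>A basis of the kernel extends to one of \<open>S\<close>, and the map is injective on the span of the vectors
  that were added.\<close>

lemma rank_nullity:
  assumes S: "subspace S" and F: "finite F" "S \<subseteq> span F" and f: "Vector_Spaces.linear scale scale f"
  shows "dim S = dim (f ` S) + dim {x \<in> S. f x = 0}"
proof -
  interpret vs: vector_space_pair scale scale by unfold_locales
  interpret f: Vector_Spaces.linear scale scale f by fact
  let ?K = "{x \<in> S. f x = 0}"
  have "?K \<subseteq> span F" using F by auto
  then obtain E where E: "finite E" "E \<subseteq> ?K" "independent E" "?K \<subseteq> span E" "card E = dim ?K"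
    by (rule finite_dim_subspace_basis[OF F(1)])
  obtain D where D: "E \<subseteq> D" "D \<subseteq> S" "independent D" "S \<subseteq> span D"
    using maximal_independent_subset_extend[of E S] E by auto
  have finD: "finite D" using independent_span_bound[OF F(1) D(3)] D(2) F(2) by blast
  have spD: "span D = S" using D S by (metis span_minimal subset_antisym)
  have spE: "span E = ?K"
  proof -
    have "subspace ?K" using S by (auto simp: subspace_def f.add f.scale)
    then show ?thesis using E by (metis span_minimal subset_antisym)
  qed
  have inj: "inj_on f (span (D - E))"
  proof (rule f.inj_on_iff_eq_0[OF subspace_span, THEN iffD2], intro ballI impI)
    fix x assume x: "x \<in> span (D - E)" "f x = 0"
    have "x \<in> S" using x spD span_mono[of "D - E" D] by auto
    then have "x \<in> span E" using x spE by auto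
    moreover have "span E \<inter> span (D - E) = {0}"
    proof -
      \<comment> \<open>the projection of \<open>S\<close> onto the kernel that forgets the added basis vectors\<close>
      define q where "q = vs.construct D (\<lambda>x. if x \<in> E then x else 0)"
      have lq: "Vector_Spaces.linear scale scale q" unfolding q_def by (rule vs.linear_construct[OF D(3)])
      interpret q: Vector_Spaces.linear scale scale q by fact
      have qD: "q y = (if y \<in> E then y else 0)" if "y \<in> D" for y
        unfolding q_def by (rule vs.construct_basis[OF D(3) that])
      have "q y = y" if "y \<in> span E" for y
        by (rule vs.linear_eq_on[OF lq linear_id[unfolded id_def] that]) (use qD D in auto)
      moreover have "q y = 0" if "y \<in> span (D - E)" for y
        by (rule q.eq_0_on_span[OF _ that]) (use qD in auto)
      ultimately have "y = 0" if "y \<in> span E" "y \<in> span (D - E)" for y using that by metis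
      then show ?thesis by (auto simp: span_zero)
    qed
    ultimately show "x = 0" using x by blast
  qed
  have ind: "independent (D - E)" using D(3) independent_mono by blast
  have "independent (f ` (D - E))" by (rule f.independent_injective_image[OF ind inj])
  moreover have "f ` S \<subseteq> span (f ` (D - E))"
  proof -
    have "f ` S = span (f ` D)" using f.span_image[of D] spD by simp
    also have "\<dots> \<subseteq> span (f ` (D - E))"
    proof (rule span_minimal[OF _ subspace_span], rule image_subsetI)
      fix x assume "x \<in> D"
      show "f x \<in> span (f ` (D - E))"
      proof (cases "x \<in> E")
        case True
        then have "f x = 0" using E by auto
        then show ?thesis by (simp add: span_zero)
      qed (use \<open>x \<in> D\<close> in \<open>auto intro: span_base\<close>)
    qed
    finally show ?thesis .
  qed
  moreover have "f ` (D - E) \<subseteq> f ` S" using D by auto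
  ultimately have "dim (f ` S) = card (f ` (D - E))" by (metis dim_unique)
  also have "\<dots> = card (D - E)"
    by (rule card_image, rule inj_on_subset[OF inj]) (auto intro: span_base)
  also have "\<dots> = card D - card E" using D(1) finD by (simp add: card_Diff_subset finite_subset)
  finally have "dim (f ` S) = card D - card E" .
  moreover have "card E \<le> card D" using D(1) finD card_mono by blast
  moreover have "dim S = card D" using D by (metis dim_unique)
  ultimately show ?thesis using E by simp
qed

lemma qfin_iff_finite_image:
  assumes B: "subspace B"
  shows "qfin B Z \<longleftrightarrow> (\<exists>F. finite F \<and> quot_proj B ` Z \<subseteq> span F)"
proof
  interpret p: Vector_Spaces.linear scale scale "quot_proj B" by (rule linear_quot_proj[OF B])
  assume "qfin B Z"
  then obtain S where S: "finite S" "Z \<subseteq> span (S \<union> B)" unfolding qfin_def by blast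
  have "quot_proj B ` Z \<subseteq> span (quot_proj B ` (S \<union> B))" using S p.span_image[of "S \<union> B"] by auto
  also have "\<dots> \<subseteq> span (quot_proj B ` S)"
    by (rule span_minimal[OF _ subspace_span]) (auto intro: span_base simp: quot_proj_eq_0_iff[OF B, THEN iffD2] span_zero)
  finally show "\<exists>F. finite F \<and> quot_proj B ` Z \<subseteq> span F" using S by blast
next
  assume "\<exists>F. finite F \<and> quot_proj B ` Z \<subseteq> span F"
  then obtain F where F: "finite F" "quot_proj B ` Z \<subseteq> span F" by blast
  have "z \<in> span (F \<union> B)" if z: "z \<in> Z" for z
  proof -
    have "quot_proj B z \<in> span (F \<union> B)" using F z span_mono[of F "F \<union> B"] by blast
    moreover have "z - quot_proj B z \<in> span (F \<union> B)" using diff_quot_proj[OF B] by (auto intro: span_base)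
    ultimately have "quot_proj B z + (z - quot_proj B z) \<in> span (F \<union> B)" by (rule span_add)
    then show ?thesis by simp
  qed
  then show "qfin B Z" unfolding qfin_def using F by blast
qed

lemma quot_proj_image_finite:
  assumes "subspace B" "qfin B Z"
  obtains F where "finite F" "quot_proj B ` Z \<subseteq> span F"
  using assms qfin_iff_finite_image by blast

lemma quot_proj_idem:
  assumes B: "subspace B"
  shows "quot_proj B (quot_proj B z) = quot_proj B z"
proof -
  interpret p: Vector_Spaces.linear scale scale "quot_proj B" by (rule linear_quot_proj[OF B])
  have "quot_proj B (z - quot_proj B z) = 0" using diff_quot_proj[OF B] quot_proj_eq_0_iff[OF B] by blast
  then show ?thesis by (simp add: p.diff)
qed

lemma quot_proj_mem:
  assumes "subspace B" "subspace Z" "B \<subseteq> Z" "z \<in> Z"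
  shows "quot_proj B z \<in> Z"
  using subspace_diff[OF assms(2,4)] diff_quot_proj[OF assms(1)] assms(3) by (metis diff_diff_eq2 add_diff_cancel_left' subsetD)

lemma qfin_spanning_subset:
  assumes B: "subspace B" and Z: "subspace Z" and sub: "B \<subseteq> Z" and fin: "qfin B Z"
  obtains S where "finite S" "S \<subseteq> Z" "Z \<subseteq> span (S \<union> B)"
proof -
  obtain F where F: "finite F" "quot_proj B ` Z \<subseteq> span F" by (rule quot_proj_image_finite[OF B fin])
  obtain E where E: "finite E" "E \<subseteq> quot_proj B ` Z" "quot_proj B ` Z \<subseteq> span E"
    by (rule finite_dim_subspace_basis[OF F])
  have "z \<in> span (E \<union> B)" if z: "z \<in> Z" for z
  proof -
    have "quot_proj B z \<in> span (E \<union> B)" using E(3) z span_mono[of E "E \<union> B"] by blast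
    moreover have "z - quot_proj B z \<in> span (E \<union> B)" using diff_quot_proj[OF B] by (auto intro: span_base)
    ultimately have "quot_proj B z + (z - quot_proj B z) \<in> span (E \<union> B)" by (rule span_add)
    then show ?thesis by simp
  qed
  then show ?thesis using that[of E] E quot_proj_mem[OF B Z sub] by blast
qed

lemma qfin_subset: "qfin B Z \<Longrightarrow> W \<subseteq> Z \<Longrightarrow> qfin B W"
  unfolding qfin_def by blast

lemma qfin_mono_denominator: "qfin B Z \<Longrightarrow> B \<subseteq> W \<Longrightarrow> qfin W Z"
  unfolding qfin_def using span_mono[of "_ \<union> B" "_ \<union> W"] by (meson Un_mono dual_order.trans order_refl)

lemma qfin_trans:
  assumes "qfin B W" "qfin W Z"
  shows "qfin B Z"
proof -
  obtain S T where S: "finite S" "W \<subseteq> span (S \<union> B)" and T: "finite T" "Z \<subseteq> span (T \<union> W)"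
    using assms unfolding qfin_def by blast
  have "span (T \<union> W) \<subseteq> span ((S \<union> T) \<union> B)"
    using S span_mono[of "S \<union> B" "(S \<union> T) \<union> B"]
    by (intro span_minimal[OF _ subspace_span]) (auto intro: span_base)
  with S T show ?thesis unfolding qfin_def by (intro exI[of _ "S \<union> T"]) auto
qed

lemma qfin_self: "Z \<subseteq> B \<Longrightarrow> qfin B Z"
  unfolding qfin_def by (intro exI[of _ "{}"]) (auto intro: span_base)

lemma qdim_eq_0_iff:
  assumes B: "subspace B" and fin: "qfin B Z"
  shows "qdim B Z = 0 \<longleftrightarrow> Z \<subseteq> B"
proof
  obtain F where F: "finite F" "quot_proj B ` Z \<subseteq> span F" by (rule quot_proj_image_finite[OF B fin])
  obtain E where E: "finite E" "quot_proj B ` Z \<subseteq> span E" "card E = dim (quot_proj B ` Z)"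
    by (rule finite_dim_subspace_basis[OF F])
  assume "qdim B Z = 0"
  then have "E = {}" using E by (simp add: qdim_def)
  then show "Z \<subseteq> B" using E by (auto simp: quot_proj_eq_0_iff[OF B])
next
  assume "Z \<subseteq> B"
  then have "quot_proj B ` Z \<subseteq> span {}" by (auto simp: quot_proj_eq_0_iff[OF B])
  then show "qdim B Z = 0" unfolding qdim_def using dim_le_card[of _ "{}"] by fastforce
qed

lemma qdim_add:
  assumes B: "subspace B" and W: "subspace W" and Z: "subspace Z"
    and sub: "B \<subseteq> W" "W \<subseteq> Z" and fin: "qfin B Z"
  shows "qdim B Z = qdim W Z + qdim B W"
proof -
  interpret p: Vector_Spaces.linear scale scale "quot_proj B" by (rule linear_quot_proj[OF B])
  interpret r: Vector_Spaces.linear scale scale "quot_proj W" by (rule linear_quot_proj[OF W])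
  obtain F where F: "finite F" "quot_proj B ` Z \<subseteq> span F" by (rule quot_proj_image_finite[OF B fin])
  have rp: "quot_proj W (quot_proj B z) = quot_proj W z" for z
  proof -
    have "z - quot_proj B z \<in> W" using diff_quot_proj[OF B] sub by blast
    then show ?thesis by (metis quot_proj_eq_0_iff[OF W] r.diff right_minus_eq)
  qed
  have "dim (quot_proj B ` Z) = dim (quot_proj W ` quot_proj B ` Z) + dim {x \<in> quot_proj B ` Z. quot_proj W x = 0}"
    by (rule rank_nullity[OF p.subspace_image[OF Z] F linear_quot_proj[OF W]])
  moreover have "quot_proj W ` quot_proj B ` Z = quot_proj W ` Z" by (auto simp: rp image_iff)
  moreover have "{x \<in> quot_proj B ` Z. quot_proj W x = 0} = quot_proj B ` W"
  proof -
    have "quot_proj W (quot_proj B z) = 0 \<longleftrightarrow> z \<in> W" for z by (simp only: rp quot_proj_eq_0_iff[OF W])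
    then show ?thesis using sub by blast
  qed
  ultimately show ?thesis by (simp add: qdim_def)
qed

lemma dim_image_inj:
  assumes h: "Vector_Spaces.linear scale scale h" and S: "subspace S" and inj: "inj_on h S"
  shows "dim (h ` S) = dim S" "(\<exists>F. finite F \<and> h ` S \<subseteq> span F) \<longleftrightarrow> (\<exists>F. finite F \<and> S \<subseteq> span F)"
proof -
  interpret h: Vector_Spaces.linear scale scale h by fact
  obtain E where E: "E \<subseteq> S" "independent E" "S \<subseteq> span E" "card E = dim S" by (rule basis_exists)
  have spE: "span E = S" using E S by (metis span_minimal subset_antisym)
  have injE: "inj_on h E" using inj E(1) by (rule inj_on_subset)
  have ind: "independent (h ` E)" using h.independent_injective_image[OF E(2)] inj spE by simp
  have span: "h ` S = span (h ` E)" using h.span_image[of E] spE by simp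
  have "dim (h ` S) = card (h ` E)" unfolding span by (simp add: dim_eq_card_independent[OF ind])
  then show "dim (h ` S) = dim S" using E(4) card_image[OF injE] by simp
  show "(\<exists>F. finite F \<and> h ` S \<subseteq> span F) \<longleftrightarrow> (\<exists>F. finite F \<and> S \<subseteq> span F)"
  proof
    assume "\<exists>F. finite F \<and> h ` S \<subseteq> span F"
    then obtain F where F: "finite F" "h ` S \<subseteq> span F" by blast
    have "finite (h ` E)" using independent_span_bound[OF F(1) ind] E(1) F(2) by blast
    then have "finite E" using injE by (rule finite_imageD)
    then show "\<exists>F. finite F \<and> S \<subseteq> span F" using E(3) by blast
  next
    assume "\<exists>F. finite F \<and> S \<subseteq> span F"
    then obtain F where F: "finite F" "S \<subseteq> span F" by blast
    then have "h ` S \<subseteq> span (h ` F)" using h.span_image[of F] by blast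
    then show "\<exists>F. finite F \<and> h ` S \<subseteq> span F" using F(1) by blast
  qed
qed

text \<open>A linear map inducing a bijection of quotients is transported to the images of the projections,
  where it becomes an injective map between honest subspaces.\<close>

lemma quotient_iso:
  assumes B: "subspace B" and Z: "subspace Z" and B': "subspace B'"
    and sub: "B \<subseteq> Z"
    and f: "Vector_Spaces.linear scale scale f"
    and into: "\<And>z. z \<in> Z \<Longrightarrow> f z \<in> Z'"
    and onto: "\<And>y. y \<in> Z' \<Longrightarrow> \<exists>z\<in>Z. y - f z \<in> B'"
    and ker: "\<And>z. z \<in> Z \<Longrightarrow> f z \<in> B' \<longleftrightarrow> z \<in> B"
  shows "qfin B Z \<longleftrightarrow> qfin B' Z'" "qdim B Z = qdim B' Z'"
proof -
  interpret f: Vector_Spaces.linear scale scale f by fact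
  interpret p: Vector_Spaces.linear scale scale "quot_proj B" by (rule linear_quot_proj[OF B])
  interpret p': Vector_Spaces.linear scale scale "quot_proj B'" by (rule linear_quot_proj[OF B'])
  define h where "h z = quot_proj B' (f z)" for z
  have lh: "Vector_Spaces.linear scale scale h"
    using Vector_Spaces.linear_compose[OF f linear_quot_proj[OF B']] by (simp add: o_def h_def[abs_def])
  interpret h: Vector_Spaces.linear scale scale h by fact
  have h0: "h z = 0 \<longleftrightarrow> z \<in> B" if "z \<in> Z" for z
    using ker[OF that] quot_proj_eq_0_iff[OF B'] by (simp add: h_def)
  have mem: "quot_proj B z \<in> Z" if "z \<in> Z" for z by (rule quot_proj_mem[OF B Z sub that])
  have hp: "h (quot_proj B z) = h z" for z
    using h0[of "z - quot_proj B z"] diff_quot_proj[OF B, of z] sub by (auto simp: h.diff)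
  have image: "h ` (quot_proj B ` Z) = quot_proj B' ` Z'"
  proof
    show "h ` (quot_proj B ` Z) \<subseteq> quot_proj B' ` Z'" using into by (auto simp: hp) (auto simp: h_def)
    show "quot_proj B' ` Z' \<subseteq> h ` (quot_proj B ` Z)"
    proof (rule image_subsetI)
      fix y assume "y \<in> Z'"
      then obtain z where z: "z \<in> Z" "y - f z \<in> B'" using onto by blast
      then have "quot_proj B' (y - f z) = 0" using quot_proj_eq_0_iff[OF B'] by blast
      then have "quot_proj B' y = h (quot_proj B z)" unfolding hp by (simp add: p'.diff h_def)
      then show "quot_proj B' y \<in> h ` (quot_proj B ` Z)" using z(1) by blast
    qed
  qed
  have S: "subspace (quot_proj B ` Z)" by (rule p.subspace_image[OF Z])
  have inj: "inj_on h (quot_proj B ` Z)"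
  proof (rule h.inj_on_iff_eq_0[OF S, THEN iffD2], intro ballI impI)
    fix s assume s: "s \<in> quot_proj B ` Z" "h s = 0"
    then have "s \<in> B" using h0 mem by auto
    then have "quot_proj B s = 0" using quot_proj_eq_0_iff[OF B] by blast
    then show "s = 0" using s(1) quot_proj_idem[OF B] by auto
  qed
  show "qdim B Z = qdim B' Z'" using dim_image_inj(1)[OF lh S inj] by (simp add: qdim_def image)
  show "qfin B Z \<longleftrightarrow> qfin B' Z'"
    using dim_image_inj(2)[OF lh S inj] by (simp add: qfin_iff_finite_image[OF B] qfin_iff_finite_image[OF B'] image)
qed

lemma qdim_mono_denominator:
  assumes B: "subspace B" and W: "subspace W" and Z: "subspace Z"
    and sub: "B \<subseteq> W" "W \<subseteq> Z" and fin: "qfin B Z"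
  shows "qdim W Z \<le> qdim B Z"
  using qdim_add[OF assms] by auto

text \<open>Functionals that vanish on \<open>B\<close> see only classes modulo \<open>B\<close>; duality to the \<open>e i\<close> makes these classes
  independent, and the last assumption makes them span.\<close>

lemma qdim_eqI:
  fixes n :: nat
  assumes B: "subspace B" and Z: "subspace Z" and sub: "B \<subseteq> Z"
    and e: "\<And>i. i < n \<Longrightarrow> e i \<in> Z"
    and lin: "\<And>i. i < n \<Longrightarrow> Vector_Spaces.linear scale (*) (\<phi> i)"
    and kill: "\<And>i b. i < n \<Longrightarrow> b \<in> B \<Longrightarrow> \<phi> i b = 0"
    and dual: "\<And>i j. i < n \<Longrightarrow> j < n \<Longrightarrow> \<phi> i (e j) = (if i = j then 1 else 0)"
    and gen: "\<And>z. z \<in> Z \<Longrightarrow> z - (\<Sum>i<n. scale (\<phi> i z) (e i)) \<in> B"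
  shows "qfin B Z" "qdim B Z = n"
proof -
  interpret p: Vector_Spaces.linear scale scale "quot_proj B" by (rule linear_quot_proj[OF B])
  have phi_sum: "\<phi> i (sum f A) = (\<Sum>a\<in>A. \<phi> i (f a))" and phi_scale: "\<phi> i (scale c x) = c * \<phi> i x"
    and phi_diff: "\<phi> i (x - y) = \<phi> i x - \<phi> i y" if "i < n" for i f c x y and A :: "nat set"
  proof -
    interpret l: Vector_Spaces.linear scale "(*)" "\<phi> i" by (rule lin[OF that])
    show "\<phi> i (sum f A) = (\<Sum>a\<in>A. \<phi> i (f a))" "\<phi> i (scale c x) = c * \<phi> i x" "\<phi> i (x - y) = \<phi> i x - \<phi> i y"
      by (simp_all add: l.sum l.scale l.diff)
  qed
  have phip: "\<phi> i (quot_proj B z) = \<phi> i z" if "i < n" for i z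
    using kill[OF that diff_quot_proj[OF B, of z]] that by (simp add: phi_diff)
  show fin: "qfin B Z"
  proof -
    have "z \<in> span (e ` {..<n} \<union> B)" if "z \<in> Z" for z
    proof -
      have "(\<Sum>i<n. scale (\<phi> i z) (e i)) + (z - (\<Sum>i<n. scale (\<phi> i z) (e i))) \<in> span (e ` {..<n} \<union> B)"
        using gen[OF that] by (intro span_add span_sum span_scale) (auto intro: span_base)
      then show ?thesis by simp
    qed
    then show ?thesis unfolding qfin_def by (intro exI[of _ "e ` {..<n}"]) auto
  qed
  define E where "E = (\<lambda>i. quot_proj B (e i)) ` {..<n}"
  have inj: "inj_on (\<lambda>i. quot_proj B (e i)) {..<n}"
  proof (rule inj_onI)
    fix i j assume ij: "i \<in> {..<n}" "j \<in> {..<n}" "quot_proj B (e i) = quot_proj B (e j)"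
    then have "\<phi> i (e i) = \<phi> i (e j)" using phip[of i "e i"] phip[of i "e j"] by simp
    then show "i = j" using ij dual[of i i] dual[of i j] by (auto split: if_splits)
  qed
  have "independent E"
  proof (rule independent_if_scalars_zero)
    fix f x assume 0: "(\<Sum>x\<in>E. scale (f x) x) = 0" and x: "x \<in> E"
    obtain i where i: "i < n" "x = quot_proj B (e i)" using x by (auto simp: E_def)
    have "(\<Sum>j<n. scale (f (quot_proj B (e j))) (quot_proj B (e j))) = 0"
      using 0 unfolding E_def by (simp add: sum.reindex[OF inj])
    then have "\<phi> i (\<Sum>j<n. scale (f (quot_proj B (e j))) (quot_proj B (e j))) = \<phi> i (scale 0 0)" by simp
    then have "(\<Sum>j<n. f (quot_proj B (e j)) * \<phi> i (quot_proj B (e j))) = 0"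
      using i by (simp only: phi_sum phi_scale) simp
    moreover have "f (quot_proj B (e j)) * \<phi> i (quot_proj B (e j)) = (if j = i then f x else 0)" if "j < n" for j
      using i that by (simp add: phip dual)
    ultimately show "f x = 0" using i by simp
  qed (simp add: E_def)
  moreover have "quot_proj B ` Z \<subseteq> span E"
  proof (rule image_subsetI)
    fix z assume "z \<in> Z"
    then have "quot_proj B (z - (\<Sum>i<n. scale (\<phi> i z) (e i))) = 0" using gen by (simp add: quot_proj_eq_0_iff[OF B])
    then have "quot_proj B z = (\<Sum>i<n. scale (\<phi> i z) (quot_proj B (e i)))" by (simp add: p.diff p.sum p.scale)
    also have "\<dots> \<in> span E" by (intro span_sum span_scale span_base) (auto simp: E_def)
    finally show "quot_proj B z \<in> span E" .
  qed
  moreover have "E \<subseteq> quot_proj B ` Z" using e by (auto simp: E_def)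
  moreover have "card E = n" unfolding E_def by (simp add: card_image[OF inj])
  ultimately show "qdim B Z = n" unfolding qdim_def by (intro dim_unique)
qed

lemma exists_functional_separating:
  assumes B: "subspace B" and v: "v \<notin> B"
  obtains \<phi> where "Vector_Spaces.linear scale (*) \<phi>" "\<forall>b\<in>B. \<phi> b = 0" "\<phi> v = 1"
proof -
  interpret k: vector_space "(*) :: 'k \<Rightarrow> 'k \<Rightarrow> 'k" by (rule vector_space_field)
  interpret vk: vector_space_pair scale "(*) :: 'k \<Rightarrow> 'k \<Rightarrow> 'k" by unfold_locales
  interpret p: Vector_Spaces.linear scale scale "quot_proj B" by (rule linear_quot_proj[OF B])
  have "quot_proj B v \<noteq> 0" using v quot_proj_eq_0_iff[OF B] by blast
  then have "independent {quot_proj B v}" by simp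
  then obtain g where g: "Vector_Spaces.linear scale (*) g" "g (quot_proj B v) = (1::'k)"
    using vk.linear_independent_extend[of "{quot_proj B v}" "\<lambda>_. 1"] by auto
  interpret g: Vector_Spaces.linear scale "(*)" g by fact
  show ?thesis
  proof (rule that)
    show "Vector_Spaces.linear scale (*) (\<lambda>x. g (quot_proj B x))"
      using Vector_Spaces.linear_compose[OF linear_quot_proj[OF B] g(1)] by (simp add: o_def)
    show "\<forall>b\<in>B. g (quot_proj B b) = 0" by (simp add: quot_proj_eq_0_iff[OF B, THEN iffD2] g.zero)
  qed (fact g)
qed

text \<open>For top-dimensional cocycles modulo coboundaries, \<open>\<omega>\<close> is integration over the fundamental class.\<close>

lemma qdim_1_functional:
  assumes B: "subspace B" and Z: "subspace Z" and sub: "B \<subseteq> Z" and fin: "qfin B Z" and one: "qdim B Z = 1"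
  obtains \<omega> where "Vector_Spaces.linear scale (*) \<omega>" "\<forall>z\<in>Z. \<omega> z = 0 \<longleftrightarrow> z \<in> B"
proof -
  have "\<not> Z \<subseteq> B" using qdim_eq_0_iff[OF B fin] one by simp
  then obtain v where v: "v \<in> Z" "v \<notin> B" by blast
  obtain \<phi> where phi: "Vector_Spaces.linear scale (*) \<phi>" "\<forall>b\<in>B. \<phi> b = 0" "\<phi> v = 1"
    by (rule exists_functional_separating[OF B v(2)])
  interpret l: Vector_Spaces.linear scale "(*)" \<phi> by fact
  define K where "K = {z \<in> Z. \<phi> z = 0}"
  have K: "subspace K" "B \<subseteq> K" "K \<subseteq> Z" "v \<notin> K"
    using Z sub phi by (auto simp: K_def subspace_def l.add l.scale l.zero)
  have "qfin K Z" using fin K(2) by (rule qfin_mono_denominator)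
  then have "qdim K Z \<noteq> 0" using qdim_eq_0_iff[OF K(1)] K(4) v by blast
  then have "qdim B K = 0" using qdim_add[OF B K(1) Z K(2,3) fin] one by simp
  then have "K \<subseteq> B" using qdim_eq_0_iff[OF B qfin_subset[OF fin K(3)]] by simp
  then show ?thesis using that[OF phi(1)] phi(2) by (auto simp: K_def)
qed

end

section \<open>Pairings and dual systems\<close>

locale pairing = s1: subquotients scale1 + s2: subquotients scale2
  for scale1 :: "'k::field \<Rightarrow> 'v::ab_group_add \<Rightarrow> 'v"
    and scale2 :: "'k \<Rightarrow> 'w::ab_group_add \<Rightarrow> 'w" +
  fixes \<beta> :: "'v \<Rightarrow> 'w \<Rightarrow> 'k"
  assumes linear_left: "Vector_Spaces.linear scale1 (*) (\<lambda>x. \<beta> x y)"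
    and linear_right: "Vector_Spaces.linear scale2 (*) (\<beta> x)"
begin

lemma
  shows add_left: "\<beta> (x + x') y = \<beta> x y + \<beta> x' y" and diff_left: "\<beta> (x - x') y = \<beta> x y - \<beta> x' y"
    and scale_left: "\<beta> (scale1 c x) y = c * \<beta> x y" and zero_left: "\<beta> 0 y = 0"
    and sum_left: "\<beta> (sum f A) y = (\<Sum>a\<in>A. \<beta> (f a) y)"
proof -
  interpret l: Vector_Spaces.linear scale1 "(*)" "\<lambda>x. \<beta> x y" by (rule linear_left)
  show "\<beta> (x + x') y = \<beta> x y + \<beta> x' y" "\<beta> (x - x') y = \<beta> x y - \<beta> x' y" "\<beta> (scale1 c x) y = c * \<beta> x y"
    "\<beta> 0 y = 0" "\<beta> (sum f A) y = (\<Sum>a\<in>A. \<beta> (f a) y)"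
    by (simp_all add: l.add l.diff l.scale l.zero l.sum)
qed

lemma
  shows add_right: "\<beta> x (y + y') = \<beta> x y + \<beta> x y'" and diff_right: "\<beta> x (y - y') = \<beta> x y - \<beta> x y'"
    and scale_right: "\<beta> x (scale2 c y) = c * \<beta> x y" and zero_right: "\<beta> x 0 = 0"
    and sum_right: "\<beta> x (sum g A) = (\<Sum>a\<in>A. \<beta> x (g a))"
proof -
  interpret l: Vector_Spaces.linear scale2 "(*)" "\<beta> x" by (rule linear_right)
  show "\<beta> x (y + y') = \<beta> x y + \<beta> x y'" "\<beta> x (y - y') = \<beta> x y - \<beta> x y'" "\<beta> x (scale2 c y) = c * \<beta> x y"
    "\<beta> x 0 = 0" "\<beta> x (sum g A) = (\<Sum>a\<in>A. \<beta> x (g a))"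
    by (simp_all add: l.add l.diff l.scale l.zero l.sum)
qed

text \<open>Gram--Schmidt for a pairing.  A new vector is made orthogonal to the \<open>f i\<close> found so far; unless it lies
  in \<open>B\<close>, some \<open>y\<close> detects it, and \<open>y\<close> is made orthogonal to the earlier \<open>e i\<close> and normalised.\<close>

lemma dual_system_finite:
  assumes Z: "s1.subspace Z" and Z': "s2.subspace Z'" and B: "s1.subspace B"
    and kill: "\<And>b y. b \<in> B \<Longrightarrow> y \<in> Z' \<Longrightarrow> \<beta> b y = 0"
    and nondeg: "\<And>x. x \<in> Z \<Longrightarrow> (\<And>y. y \<in> Z' \<Longrightarrow> \<beta> x y = 0) \<Longrightarrow> x \<in> B"
    and S: "finite S" "S \<subseteq> Z"
  shows "\<exists>(n::nat) e f. (\<forall>i<n. e i \<in> Z \<and> f i \<in> Z') \<and> (\<forall>i<n. \<forall>j<n. \<beta> (e i) (f j) = (if i = j then 1 else 0)) \<and>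
    (\<forall>x\<in>S. x - (\<Sum>i<n. scale1 (\<beta> x (f i)) (e i)) \<in> B)"
  using S
proof (induction S rule: finite_induct)
  case empty
  show ?case by (rule exI[of _ 0]) simp
next
  case (insert x S)
  then obtain n :: nat and e f where ef0: "\<forall>i<n. e i \<in> Z \<and> f i \<in> Z'"
    "\<forall>i<n. \<forall>j<n. \<beta> (e i) (f j) = (if i = j then 1 else 0)"
    "\<forall>x\<in>S. x - (\<Sum>i<n. scale1 (\<beta> x (f i)) (e i)) \<in> B" by blast
  have ef: "\<And>i. i < n \<Longrightarrow> e i \<in> Z" "\<And>i. i < n \<Longrightarrow> f i \<in> Z'"
    "\<And>i j. i < n \<Longrightarrow> j < n \<Longrightarrow> \<beta> (e i) (f j) = (if i = j then 1 else 0)"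
    "\<And>x. x \<in> S \<Longrightarrow> x - (\<Sum>i<n. scale1 (\<beta> x (f i)) (e i)) \<in> B"
    using ef0 by blast+
  define x' where "x' = x - (\<Sum>i<n. scale1 (\<beta> x (f i)) (e i))"
  have x'Z: "x' \<in> Z" unfolding x'_def using ef(1) insert.prems Z
    by (intro s1.subspace_diff s1.subspace_sum s1.subspace_scale) auto
  have x'f: "\<beta> x' (f j) = 0" if "j < n" for j
  proof -
    have "(\<Sum>i<n. \<beta> x (f i) * \<beta> (e i) (f j)) = (\<Sum>i<n. if i = j then \<beta> x (f j) else 0)"
      using that by (intro sum.cong) (auto simp: ef(3))
    then show ?thesis using that by (simp add: x'_def diff_left sum_left scale_left)
  qed
  show ?case
  proof (cases "x' \<in> B")
    case True
    then show ?thesis using ef by (intro exI[of _ n] exI[of _ e] exI[of _ f]) (auto simp: x'_def)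
  next
    case False
    then obtain y0 where y0: "y0 \<in> Z'" "\<beta> x' y0 \<noteq> 0" using nondeg[OF x'Z] by blast
    define y1 where "y1 = y0 - (\<Sum>i<n. scale2 (\<beta> (e i) y0) (f i))"
    have y1Z: "y1 \<in> Z'" unfolding y1_def using ef(2) y0 Z'
      by (intro s2.subspace_diff s2.subspace_sum s2.subspace_scale) auto
    have ey1: "\<beta> (e j) y1 = 0" if "j < n" for j
    proof -
      have "(\<Sum>i<n. \<beta> (e i) y0 * \<beta> (e j) (f i)) = (\<Sum>i<n. if i = j then \<beta> (e j) y0 else 0)"
        using that by (intro sum.cong) (auto simp: ef(3))
      then show ?thesis using that by (simp add: y1_def diff_right sum_right scale_right)
    qed
    have x'y1: "\<beta> x' y1 = \<beta> x' y0" by (simp add: y1_def diff_right sum_right scale_right x'f)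
    define y where "y = scale2 (inverse (\<beta> x' y0)) y1"
    have yZ: "y \<in> Z'" unfolding y_def using y1Z Z' by (rule s2.subspace_scale[rotated])
    have ey: "\<beta> (e j) y = 0" if "j < n" for j using ey1[OF that] by (simp add: y_def scale_right)
    have x'y: "\<beta> x' y = 1" using y0 x'y1 by (simp add: y_def scale_right)
    have xy: "\<beta> x y = 1"
    proof -
      have "x = x' + (\<Sum>i<n. scale1 (\<beta> x (f i)) (e i))" by (simp add: x'_def)
      then have "\<beta> x y = \<beta> (x' + (\<Sum>i<n. scale1 (\<beta> x (f i)) (e i))) y" by (rule arg_cong)
      also have "\<dots> = \<beta> x' y + (\<Sum>i<n. \<beta> x (f i) * \<beta> (e i) y)" by (simp only: add_left sum_left scale_left)
      also have "(\<Sum>i<n. \<beta> x (f i) * \<beta> (e i) y) = 0" by (rule sum.neutral) (simp add: ey)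
      finally show ?thesis using x'y by simp
    qed
    have sy: "\<beta> s y = 0" if "s \<in> S" for s
    proof -
      have "0 = \<beta> (s - (\<Sum>i<n. scale1 (\<beta> s (f i)) (e i))) y" using kill[OF ef(4)[OF that] yZ] by simp
      also have "\<dots> = \<beta> s y" using ey by (simp add: diff_left sum_left scale_left)
      finally show ?thesis by simp
    qed
    let ?e = "e(n := x')" and ?f = "f(n := y)"
    have 1: "?e i \<in> Z \<and> ?f i \<in> Z'" if "i < Suc n" for i
      using that ef(1,2)[of i] x'Z yZ by (cases "i = n") auto
    have 2: "\<beta> (?e i) (?f j) = (if i = j then 1 else 0)" if "i < Suc n" "j < Suc n" for i j
      using that ef(3)[of i j] ey[of i] x'f[of j] x'y by (cases "i = n"; cases "j = n") auto
    have 3: "z - (\<Sum>i<Suc n. scale1 (\<beta> z (?f i)) (?e i)) \<in> B" if "z \<in> insert x S" for z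
    proof -
      have "(\<Sum>i<Suc n. scale1 (\<beta> z (?f i)) (?e i)) = (\<Sum>i<n. scale1 (\<beta> z (f i)) (e i)) + scale1 (\<beta> z y) x'"
        by simp
      moreover have "z - (\<Sum>i<n. scale1 (\<beta> z (f i)) (e i)) - scale1 (\<beta> z y) x' \<in> B"
      proof (cases "z = x")
        case True
        then show ?thesis using xy s1.subspace_0[OF B] by (simp add: x'_def)
      next
        case False
        then have "z \<in> S" using that by simp
        then show ?thesis using sy[of z] ef(4)[of z] by simp
      qed
      ultimately show ?thesis by (simp add: diff_diff_eq)
    qed
    show ?thesis using 1 2 3 by blast
  qed
qed

lemma dual_system:
  assumes Z: "s1.subspace Z" and Z': "s2.subspace Z'" and B: "s1.subspace B" and sub: "B \<subseteq> Z"
    and kill: "\<And>b y. b \<in> B \<Longrightarrow> y \<in> Z' \<Longrightarrow> \<beta> b y = 0"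
    and nondeg: "\<And>x. x \<in> Z \<Longrightarrow> (\<And>y. y \<in> Z' \<Longrightarrow> \<beta> x y = 0) \<Longrightarrow> x \<in> B"
    and fin: "s1.qfin B Z"
  obtains n :: nat and e f where "\<forall>i<n. e i \<in> Z" "\<forall>i<n. f i \<in> Z'"
    "\<forall>i<n. \<forall>j<n. \<beta> (e i) (f j) = (if i = j then 1 else 0)"
    "\<forall>x\<in>Z. x - (\<Sum>i<n. scale1 (\<beta> x (f i)) (e i)) \<in> B"
proof -
  obtain S where S: "finite S" "S \<subseteq> Z" "Z \<subseteq> s1.span (S \<union> B)" by (rule s1.qfin_spanning_subset[OF B Z sub fin])
  obtain n :: nat and e f where ef: "\<forall>i<n. e i \<in> Z \<and> f i \<in> Z'"
    "\<forall>i<n. \<forall>j<n. \<beta> (e i) (f j) = (if i = j then 1 else 0)"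
    "\<forall>x\<in>S. x - (\<Sum>i<n. scale1 (\<beta> x (f i)) (e i)) \<in> B"
    using dual_system_finite[OF Z Z' B kill nondeg S(1,2)] by blast
  define P where "P = {x. x - (\<Sum>i<n. scale1 (\<beta> x (f i)) (e i)) \<in> B}"
  have "s1.subspace P"
  proof (rule s1.subspaceI)
    show "0 \<in> P" using s1.subspace_0[OF B] by (simp add: P_def zero_left)
  next
    fix x y assume xy: "x \<in> P" "y \<in> P"
    have "x + y - (\<Sum>i<n. scale1 (\<beta> (x + y) (f i)) (e i)) =
      (x - (\<Sum>i<n. scale1 (\<beta> x (f i)) (e i))) + (y - (\<Sum>i<n. scale1 (\<beta> y (f i)) (e i)))"
      by (simp add: add_left s1.scale_left_distrib sum.distrib)
    moreover have "\<dots> \<in> B" using xy by (intro s1.subspace_add[OF B]) (simp_all add: P_def)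
    ultimately show "x + y \<in> P" by (simp only: P_def mem_Collect_eq)
  next
    fix c x assume x: "x \<in> P"
    have "scale1 c x - (\<Sum>i<n. scale1 (\<beta> (scale1 c x) (f i)) (e i)) =
      scale1 c (x - (\<Sum>i<n. scale1 (\<beta> x (f i)) (e i)))"
      by (simp add: scale_left s1.scale_right_diff_distrib s1.scale_sum_right)
    moreover have "\<dots> \<in> B" using x by (intro s1.subspace_scale[OF B]) (simp add: P_def)
    ultimately show "scale1 c x \<in> P" by (simp only: P_def mem_Collect_eq)
  qed
  moreover have "S \<union> B \<subseteq> P"
  proof -
    have "(\<Sum>i<n. scale1 (\<beta> b (f i)) (e i)) = 0" if "b \<in> B" for b
      using that kill ef(1) by (intro sum.neutral) auto
    then show ?thesis using ef by (auto simp: P_def)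
  qed
  ultimately have "Z \<subseteq> P" using S(3) by (meson order_trans s1.span_minimal)
  then show ?thesis using ef that[of n e f] by (auto simp: P_def)
qed

text \<open>In a dual system the functional is \<open>\<beta> x\<close> applied to the combination of the \<open>f i\<close> with coefficients
  \<open>\<phi> (e i)\<close>.\<close>

lemma represent_functional:
  assumes Z: "s1.subspace Z" and Z': "s2.subspace Z'" and B: "s1.subspace B" and sub: "B \<subseteq> Z"
    and kill: "\<And>b y. b \<in> B \<Longrightarrow> y \<in> Z' \<Longrightarrow> \<beta> b y = 0"
    and nondeg: "\<And>x. x \<in> Z \<Longrightarrow> (\<And>y. y \<in> Z' \<Longrightarrow> \<beta> x y = 0) \<Longrightarrow> x \<in> B"
    and fin: "s1.qfin B Z"
    and lin: "Vector_Spaces.linear scale1 (*) \<phi>" and phi: "\<And>b. b \<in> B \<Longrightarrow> \<phi> b = 0"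
  obtains y where "y \<in> Z'" "\<forall>x\<in>Z. \<phi> x = \<beta> x y"
proof -
  obtain n :: nat and e f where ef: "\<forall>i<n. e i \<in> Z" "\<forall>i<n. f i \<in> Z'"
    "\<forall>i<n. \<forall>j<n. \<beta> (e i) (f j) = (if i = j then 1 else 0)"
    "\<forall>x\<in>Z. x - (\<Sum>i<n. scale1 (\<beta> x (f i)) (e i)) \<in> B"
    by (rule dual_system[OF Z Z' B sub kill nondeg fin])
  interpret l: Vector_Spaces.linear scale1 "(*)" \<phi> by fact
  show ?thesis
  proof (rule that)
    show "(\<Sum>i<n. scale2 (\<phi> (e i)) (f i)) \<in> Z'"
      using ef(2) Z' by (intro s2.subspace_sum s2.subspace_scale) auto
    show "\<forall>x\<in>Z. \<phi> x = \<beta> x (\<Sum>i<n. scale2 (\<phi> (e i)) (f i))"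
    proof
      fix x assume "x \<in> Z"
      then have "\<phi> (x - (\<Sum>i<n. scale1 (\<beta> x (f i)) (e i))) = 0" using ef phi by blast
      then show "\<phi> x = \<beta> x (\<Sum>i<n. scale2 (\<phi> (e i)) (f i))"
        by (simp add: l.diff l.sum l.scale sum_right scale_right mult.commute)
    qed
  qed
qed

lemma perfect_dual_system:
  assumes Z: "s1.subspace Z" and Z': "s2.subspace Z'" and B: "s1.subspace B" and sub: "B \<subseteq> Z"
    and kill: "\<And>b y. b \<in> B \<Longrightarrow> y \<in> Z' \<Longrightarrow> \<beta> b y = 0"
    and nondeg: "\<And>x. x \<in> Z \<Longrightarrow> (\<And>y. y \<in> Z' \<Longrightarrow> \<beta> x y = 0) \<Longrightarrow> x \<in> B"
    and nondeg': "\<And>y. y \<in> Z' \<Longrightarrow> (\<And>x. x \<in> Z \<Longrightarrow> \<beta> x y = 0) \<Longrightarrow> y \<in> B'"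
    and fin: "s1.qfin B Z"
  obtains e f where "\<forall>i<s1.qdim B Z. e i \<in> Z" "\<forall>i<s1.qdim B Z. f i \<in> Z'"
    "\<forall>i<s1.qdim B Z. \<forall>j<s1.qdim B Z. \<beta> (e i) (f j) = (if i = j then 1 else 0)"
    "\<forall>y\<in>Z'. y - (\<Sum>i<s1.qdim B Z. scale2 (\<beta> (e i) y) (f i)) \<in> B'"
proof -
  obtain n :: nat and e f where ef0: "\<forall>i<n. e i \<in> Z" "\<forall>i<n. f i \<in> Z'"
    "\<forall>i<n. \<forall>j<n. \<beta> (e i) (f j) = (if i = j then 1 else 0)"
    "\<forall>x\<in>Z. x - (\<Sum>i<n. scale1 (\<beta> x (f i)) (e i)) \<in> B"
    by (rule dual_system[OF Z Z' B sub kill nondeg fin])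
  have ef: "\<And>i. i < n \<Longrightarrow> e i \<in> Z" "\<And>i. i < n \<Longrightarrow> f i \<in> Z'"
    "\<And>i j. i < n \<Longrightarrow> j < n \<Longrightarrow> \<beta> (e i) (f j) = (if i = j then 1 else 0)"
    "\<And>x. x \<in> Z \<Longrightarrow> x - (\<Sum>i<n. scale1 (\<beta> x (f i)) (e i)) \<in> B"
    using ef0 by blast+
  have n: "s1.qdim B Z = n"
    by (rule s1.qdim_eqI[where e = e and \<phi> = "\<lambda>i x. \<beta> x (f i)"])
       (use Z B sub ef kill linear_left in auto)
  have "y - (\<Sum>i<n. scale2 (\<beta> (e i) y) (f i)) \<in> B'" if y: "y \<in> Z'" for y
  proof (rule nondeg')
    show "y - (\<Sum>i<n. scale2 (\<beta> (e i) y) (f i)) \<in> Z'"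
      using ef(2) Z' y by (intro s2.subspace_diff s2.subspace_sum s2.subspace_scale) auto
    fix x assume "x \<in> Z"
    then have "\<beta> (x - (\<Sum>i<n. scale1 (\<beta> x (f i)) (e i))) y = 0" using ef(4) kill y by blast
    then show "\<beta> x (y - (\<Sum>i<n. scale2 (\<beta> (e i) y) (f i))) = 0"
      by (simp add: diff_left sum_left scale_left diff_right sum_right scale_right mult.commute)
  qed
  then show ?thesis using that[of e f] ef0 unfolding n by blast
qed

lemma qdim_perfect_pairing:
  assumes Z: "s1.subspace Z" and Z': "s2.subspace Z'" and B: "s1.subspace B" and B': "s2.subspace B'"
    and sub: "B \<subseteq> Z" "B' \<subseteq> Z'"
    and kill: "\<And>b y. b \<in> B \<Longrightarrow> y \<in> Z' \<Longrightarrow> \<beta> b y = 0"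
    and kill': "\<And>x b. x \<in> Z \<Longrightarrow> b \<in> B' \<Longrightarrow> \<beta> x b = 0"
    and nondeg: "\<And>x. x \<in> Z \<Longrightarrow> (\<And>y. y \<in> Z' \<Longrightarrow> \<beta> x y = 0) \<Longrightarrow> x \<in> B"
    and nondeg': "\<And>y. y \<in> Z' \<Longrightarrow> (\<And>x. x \<in> Z \<Longrightarrow> \<beta> x y = 0) \<Longrightarrow> y \<in> B'"
    and fin: "s1.qfin B Z"
  shows "s2.qdim B' Z' = s1.qdim B Z"
proof -
  let ?n = "s1.qdim B Z"
  obtain e f where ef: "\<forall>i<?n. e i \<in> Z" "\<forall>i<?n. f i \<in> Z'"
    "\<forall>i<?n. \<forall>j<?n. \<beta> (e i) (f j) = (if i = j then 1 else 0)"
    "\<forall>y\<in>Z'. y - (\<Sum>i<?n. scale2 (\<beta> (e i) y) (f i)) \<in> B'"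
    by (rule perfect_dual_system[OF Z Z' B sub(1) kill nondeg nondeg' fin])
  show ?thesis
    by (rule s2.qdim_eqI(2)[where e = f and \<phi> = "\<lambda>i. \<beta> (e i)", OF B' Z' sub(2)])
       (use ef kill' linear_right in auto)
qed

end

section \<open>Unipotent isometries\<close>

context subquotients
begin

definition bilinear_form :: "('v \<Rightarrow> 'v \<Rightarrow> 'k) \<Rightarrow> bool"
  where "bilinear_form c \<longleftrightarrow> (\<forall>y. Vector_Spaces.linear scale (*) (\<lambda>x. c x y)) \<and> (\<forall>x. Vector_Spaces.linear scale (*) (c x))"

lemma bilinear_form_pairing: "bilinear_form c \<Longrightarrow> pairing scale scale c"
  unfolding bilinear_form_def by (intro pairing.intro pairing_axioms.intro subquotients_axioms) auto

text \<open>Splitting off a hyperbolic plane, spanned by \<open>x\<close> and \<open>y\<close> with \<open>c x y = 1\<close>, lowers the rank by two and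
  keeps the radical.\<close>

lemma even_rank_alternating:
  assumes c: "bilinear_form c"
    and Z: "subspace Z" and W: "subspace W" and sub: "W \<subseteq> Z" and fin: "qfin W Z"
    and alt: "\<And>x. x \<in> Z \<Longrightarrow> c x x = 0"
    and kill: "\<And>w z. w \<in> W \<Longrightarrow> z \<in> Z \<Longrightarrow> c w z = 0"
    and rad: "\<And>x. x \<in> Z \<Longrightarrow> (\<And>y. y \<in> Z \<Longrightarrow> c x y = 0) \<Longrightarrow> x \<in> W"
  shows "even (qdim W Z)"
proof -
  interpret pairing scale scale c by (rule bilinear_form_pairing[OF c])
  show ?thesis using Z sub fin alt kill rad
  proof (induction "qdim W Z" arbitrary: Z rule: less_induct)
    case (less Z)
    note Z = \<open>subspace Z\<close>
    have skew: "c x y = - c y x" if "x \<in> Z" "y \<in> Z" for x y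
    proof -
      have "c (x + y) (x + y) = 0" "c x x = 0" "c y y = 0" using that less.prems(4) subspace_add[OF Z] by auto
      then show ?thesis by (simp add: add_left add_right eq_neg_iff_add_eq_0 add.commute)
    qed
    show ?case
    proof (cases "Z \<subseteq> W")
      case True
      then have "qdim W Z = 0" using qdim_eq_0_iff[OF W less.prems(3)] by blast
      then show ?thesis by simp
    next
      case False
      then obtain x where x: "x \<in> Z" "x \<notin> W" by blast
      then obtain y0 where y0: "y0 \<in> Z" "c x y0 \<noteq> 0" using less.prems(6) by blast
      define y where "y = scale (inverse (c x y0)) y0"
      have y: "y \<in> Z" "c x y = 1" using y0 subspace_scale[OF Z] by (auto simp: y_def scale_right)
      have yx: "c y x = -1" using skew[OF y(1) x(1)] y by simp
      note xx = less.prems(4)[OF x(1)] and yy = less.prems(4)[OF y(1)]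
      define Z' where "Z' = {z \<in> Z. c x z = 0 \<and> c y z = 0}"
      have Z': "subspace Z'" using Z by (auto simp: Z'_def subspace_def add_right scale_right zero_right)
      have sub': "W \<subseteq> Z'"
      proof
        fix w assume w: "w \<in> W"
        then have "w \<in> Z" using less.prems(2) by blast
        moreover have "c x w = - c w x" by (rule skew[OF x(1) \<open>w \<in> Z\<close>])
        moreover have "c y w = - c w y" by (rule skew[OF y(1) \<open>w \<in> Z\<close>])
        ultimately show "w \<in> Z'" using less.prems(5) w x y by (auto simp: Z'_def)
      qed
      have Z'Z: "Z' \<subseteq> Z" by (auto simp: Z'_def)
      define e where "e i = (if i = 0 then x else y)" for i :: nat
      define \<phi> where "\<phi> i z = (if i = 0 then c (scale (-1) y) z else c x z)" for i :: nat and z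
      have phi0: "\<phi> 0 z = - c y z" and phi1: "\<phi> (Suc 0) z = c x z" for z
        by (simp_all only: \<phi>_def scale_left) simp_all
      have lin: "Vector_Spaces.linear scale (*) (\<phi> i)" for i
        by (cases "i = 0") (auto simp: \<phi>_def[abs_def] linear_right)
      have sum2: "(\<Sum>i<2. scale (\<phi> i z) (e i)) = scale (- c y z) x + scale (c x z) y" for z
        by (simp only: numeral_2_eq_2 sum.lessThan_Suc phi0 phi1) (simp add: e_def)
      have split: "z - (\<Sum>i<2. scale (\<phi> i z) (e i)) \<in> Z'" if z: "z \<in> Z" for z
      proof -
        have "z - (scale (- c y z) x + scale (c x z) y) \<in> Z"
          by (intro subspace_diff[OF Z] subspace_add[OF Z] subspace_scale[OF Z] z x(1) y(1))
        moreover have "c x (z - (scale (- c y z) x + scale (c x z) y)) = 0"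
          by (simp only: diff_right add_right scale_right xx y(2)) simp
        moreover have "c y (z - (scale (- c y z) x + scale (c x z) y)) = 0"
          by (simp only: diff_right add_right scale_right yy yx) simp
        ultimately show ?thesis unfolding sum2 Z'_def by blast
      qed
      have two: "qdim Z' Z = 2"
      proof (rule qdim_eqI(2)[where e = e and \<phi> = \<phi>, OF Z' Z Z'Z _ lin _ _ split])
        show "e i \<in> Z" for i using x y by (simp add: e_def)
        show "\<phi> i b = 0" if "i < 2" "b \<in> Z'" for i b
          using that phi0 phi1 by (auto simp: less_2_cases_iff Z'_def)
        show "\<phi> i (e j) = (if i = j then 1 else 0)" if "i < 2" "j < 2" for i j
          using that phi0 phi1 xx yy y(2) yx by (auto simp: less_2_cases_iff e_def)
      qed
      have eq: "qdim W Z = qdim Z' Z + qdim W Z'" by (rule qdim_add[OF W Z' Z sub' Z'Z less.prems(3)])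
      have "even (qdim W Z')"
      proof (rule less.hyps)
        show "qdim W Z' < qdim W Z" using eq two by simp
        show "qfin W Z'" by (rule qfin_subset[OF less.prems(3) Z'Z])
        show "c w z = 0" if "w \<in> W" "z \<in> Z'" for w z using that less.prems(5) Z'Z by blast
        show "z \<in> W" if z: "z \<in> Z'" and 0: "\<And>y. y \<in> Z' \<Longrightarrow> c z y = 0" for z
        proof (rule less.prems(6))
          show "z \<in> Z" using z Z'Z by blast
          fix u assume u: "u \<in> Z"
          have zZ: "z \<in> Z" using z Z'Z by blast
          have zx: "c z x = 0" "c z y = 0" using skew[OF zZ x(1)] skew[OF zZ y(1)] z by (auto simp: Z'_def)
          have "c z (u - (\<Sum>i<2. scale (\<phi> i u) (e i))) = 0" by (rule 0[OF split[OF u]])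
          then show "c z u = 0" unfolding sum2 by (simp only: diff_right add_right scale_right zx) simp
        qed
        show "c z z = 0" if "z \<in> Z'" for z using that less.prems(4) Z'Z by blast
      qed (fact Z' sub')+
      then show ?thesis using eq two by simp
    qed
  qed
qed

text \<open>If \<open>S\<close> is onto modulo \<open>B\<close> then so are all its powers, one of which is zero.\<close>

lemma nilpotent_onto:
  assumes S: "Vector_Spaces.linear scale scale S" and B: "subspace B"
    and SZ: "\<And>z. z \<in> Z \<Longrightarrow> S z \<in> Z" and SB: "\<And>b. b \<in> B \<Longrightarrow> S b \<in> B"
    and nil: "\<And>z. z \<in> Z \<Longrightarrow> (S ^^ m) z \<in> B"
    and onto: "\<And>z. z \<in> Z \<Longrightarrow> \<exists>u\<in>Z. z - S u \<in> B"
  shows "Z \<subseteq> B"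
proof -
  interpret S: Vector_Spaces.linear scale scale S by fact
  have Sk: "(S ^^ k) (x + y) = (S ^^ k) x + (S ^^ k) y" "b \<in> B \<Longrightarrow> (S ^^ k) b \<in> B" for k x y b
    by (induction k) (auto simp: S.add SB)
  have "\<exists>u\<in>Z. z - (S ^^ k) u \<in> B" if "z \<in> Z" for k z
    using that
  proof (induction k arbitrary: z)
    case 0
    then show ?case using subspace_0[OF B] by (intro bexI[of _ z]) auto
  next
    case (Suc k)
    obtain u where u: "u \<in> Z" "z - (S ^^ k) u \<in> B" using Suc by blast
    obtain w where w: "w \<in> Z" "u - S w \<in> B" using onto[OF u(1)] by blast
    have "(S ^^ k) u = (S ^^ k) (S w) + (S ^^ k) (u - S w)" by (simp flip: Sk(1))
    then have "z - (S ^^ Suc k) w = (z - (S ^^ k) u) + (S ^^ k) (u - S w)" by (simp add: funpow_swap1)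
    then show ?case using u w Sk(2) subspace_add[OF B] by metis
  qed
  then show ?thesis using nil subspace_add[OF B] by (metis diff_add_cancel subsetI)
qed

lemma nilpotent_kernel:
  assumes SZ: "\<And>z. z \<in> Z \<Longrightarrow> S z \<in> Z" 
    and nil: "\<And>z. z \<in> Z \<Longrightarrow> (S ^^ m) z \<in> B"
    and ker: "\<And>z. z \<in> Z \<Longrightarrow> S z \<in> B \<Longrightarrow> z \<in> B"
  shows "Z \<subseteq> B"
proof
  fix z assume z: "z \<in> Z"
  have SkZ: "(S ^^ k) z \<in> Z" for k by (induction k) (auto simp: z SZ)
  have "(S ^^ k) z \<in> B \<Longrightarrow> z \<in> B" for k
    by (induction k) (use ker SkZ in auto)
  then show "z \<in> B" using nil[OF z] by blast
qed

text \<open>Both numbers are \<open>dim Z/B\<close> minus the rank of \<open>S\<close> on the quotient.\<close>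

lemma qdim_cokernel_eq_kernel:
  assumes S: "Vector_Spaces.linear scale scale S" and B: "subspace B" and Z: "subspace Z" and sub: "B \<subseteq> Z"
    and SZ: "\<And>z. z \<in> Z \<Longrightarrow> S z \<in> Z" and SB: "\<And>b. b \<in> B \<Longrightarrow> S b \<in> B" and fin: "qfin B Z"
  defines "U \<equiv> {S x + b | x b. x \<in> Z \<and> b \<in> B}" and "K \<equiv> {z \<in> Z. S z \<in> B}"
  shows "qdim U Z = qdim B K"
proof -
  interpret S: Vector_Spaces.linear scale scale S by fact
  have K: "subspace K" using Z B by (auto simp: K_def subspace_def S.add S.scale S.zero)
  have U: "subspace U"
    using subspace_sums[OF S.subspace_image[OF Z] B] unfolding U_def by (rule back_subst[of subspace]) blast
  have BU: "B \<subseteq> U" unfolding U_def using subspace_0[OF Z] S.zero by force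
  have UZ: "U \<subseteq> Z" unfolding U_def using SZ sub subspace_add[OF Z] by blast
  have BK: "B \<subseteq> K" and KZ: "K \<subseteq> Z" unfolding K_def using sub SB by auto
  have "qdim K Z = qdim B U"
  proof (rule quotient_iso(2)[OF K Z B KZ S])
    show "S z \<in> U" if "z \<in> Z" for z unfolding U_def using that subspace_0[OF B] by force
    show "\<exists>z\<in>Z. y - S z \<in> B" if "y \<in> U" for y using that unfolding U_def by force
    show "S z \<in> B \<longleftrightarrow> z \<in> K" if "z \<in> Z" for z using that by (simp add: K_def)
  qed
  then show ?thesis using qdim_add[OF B U Z BU UZ fin] qdim_add[OF B K Z BK KZ fin] by linarith
qed

text \<open>The form \<open>c (T x) y - c x (T y)\<close> is alternating because \<open>c\<close> is symmetric.  As \<open>T\<close> is an isometry, its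
  radical consists of the \<open>x\<close> with \<open>T\<^sup>2 x = x\<close>, and \<open>T + 1\<close> is injective because \<open>T\<close> is unipotent; so
  the radical is the fixed space of \<open>T\<close>, whose codimension is the rank and hence even.\<close>

lemma even_fixed_space_of_unipotent_isometry:
  assumes two: "(2::'k) \<noteq> 0"
    and T: "Vector_Spaces.linear scale scale T" and B: "subspace B" and Z: "subspace Z" and sub: "B \<subseteq> Z"
    and TZ: "\<And>z. z \<in> Z \<Longrightarrow> T z \<in> Z" and TB: "\<And>b. b \<in> B \<Longrightarrow> T b \<in> B" and fin: "qfin B Z"
    and onto: "\<And>z. z \<in> Z \<Longrightarrow> \<exists>u\<in>Z. T u = z"
    and nil: "\<And>z. z \<in> Z \<Longrightarrow> ((\<lambda>x. T x - x) ^^ m) z \<in> B"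
    and c: "bilinear_form c"
    and sym: "\<And>x y. x \<in> Z \<Longrightarrow> y \<in> Z \<Longrightarrow> c x y = c y x"
    and iso: "\<And>x y. x \<in> Z \<Longrightarrow> y \<in> Z \<Longrightarrow> c (T x) (T y) = c x y"
    and kill: "\<And>b z. b \<in> B \<Longrightarrow> z \<in> Z \<Longrightarrow> c b z = 0"
    and nondeg: "\<And>x. x \<in> Z \<Longrightarrow> (\<And>y. y \<in> Z \<Longrightarrow> c x y = 0) \<Longrightarrow> x \<in> B"
    and ev: "even (qdim B Z)"
  shows "even (qdim B {z \<in> Z. T z - z \<in> B})"
proof -
  interpret T: Vector_Spaces.linear scale scale T by fact
  interpret pairing scale scale c by (rule bilinear_form_pairing[OF c])
  interpret vs: vector_space_pair scale "(*) :: 'k \<Rightarrow> 'k \<Rightarrow> 'k"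
    by (intro vector_space_pair.intro vector_space_field vector_space_axioms)
  define W where "W = {z \<in> Z. T z - z \<in> B}"
  have W: "subspace W"
    unfolding W_def
  proof (rule subspaceI)
    show "0 \<in> {z \<in> Z. T z - z \<in> B}" using subspace_0[OF Z] subspace_0[OF B] by (simp add: T.zero)
  next
    fix x y assume xy: "x \<in> {z \<in> Z. T z - z \<in> B}" "y \<in> {z \<in> Z. T z - z \<in> B}"
    have "T (x + y) - (x + y) = (T x - x) + (T y - y)" by (simp add: T.add)
    then show "x + y \<in> {z \<in> Z. T z - z \<in> B}"
      using xy subspace_add[OF Z] subspace_add[OF B] by (metis (mono_tags, lifting) mem_Collect_eq)
  next
    fix a x assume x: "x \<in> {z \<in> Z. T z - z \<in> B}"
    have "T (scale a x) - scale a x = scale a (T x - x)" by (simp add: T.scale scale_right_diff_distrib)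
    then show "scale a x \<in> {z \<in> Z. T z - z \<in> B}"
      using x subspace_scale[OF Z] subspace_scale[OF B] by (metis (mono_tags, lifting) mem_Collect_eq)
  qed
  have BW: "B \<subseteq> W" unfolding W_def using sub TB subspace_diff[OF B] by blast
  have WZ: "W \<subseteq> Z" unfolding W_def by blast
  define d where "d x y = c (T x) y - c x (T y)" for x y
  have "bilinear_form d"
    unfolding bilinear_form_def d_def
  proof (intro conjI allI)
    fix y
    have "Vector_Spaces.linear scale (*) (\<lambda>x. c (T x) y)"
      using Vector_Spaces.linear_compose[OF T linear_left[of y]] by (simp add: o_def)
    then show "Vector_Spaces.linear scale (*) (\<lambda>x. c (T x) y - c x (T y))"
      by (rule vs.linear_compose_sub[OF _ linear_left])
  next
    fix x
    have "Vector_Spaces.linear scale (*) (\<lambda>y. c x (T y))"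
      using Vector_Spaces.linear_compose[OF T linear_right[of x]] by (simp add: o_def)
    then show "Vector_Spaces.linear scale (*) (\<lambda>y. c (T x) y - c x (T y))"
      by (rule vs.linear_compose_sub[OF linear_right])
  qed
  then have "even (qdim W Z)"
  proof (rule even_rank_alternating[OF _ Z W WZ qfin_mono_denominator[OF fin BW]])
    show "d x x = 0" if "x \<in> Z" for x using sym[OF that TZ[OF that]] by (simp add: d_def)
    show "d w z = 0" if w: "w \<in> W" and z: "z \<in> Z" for w z
    proof -
      have wZ: "w \<in> Z" and b: "T w - w \<in> B" using w by (auto simp: W_def)
      have "c (T w - w) (T z) = 0" "c (T w - w) z = 0" using kill[OF b] z TZ by auto
      then show ?thesis using iso[OF wZ z] by (simp add: d_def diff_left)
    qed
    show "x \<in> W" if x: "x \<in> Z" and 0: "\<And>y. y \<in> Z \<Longrightarrow> d x y = 0" for x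
    proof -
      define v where "v = T x - x"
      have vZ: "v \<in> Z" unfolding v_def using x TZ subspace_diff[OF Z] by blast
      have "T (T x) - x \<in> B"
      proof (rule nondeg)
        show "T (T x) - x \<in> Z" using x TZ subspace_diff[OF Z] by blast
        fix z assume "z \<in> Z"
        then obtain y where y: "y \<in> Z" "T y = z" using onto by blast
        have "c (T (T x)) (T y) = c (T x) y" using iso x TZ y by blast
        then show "c (T (T x) - x) z = 0" using 0[OF y(1)] y by (simp add: d_def diff_left)
      qed
      then have Tv: "T v + v \<in> B" by (simp add: v_def T.diff)
      \<comment> \<open>modulo \<open>B\<close>, \<open>v\<close> is an eigenvector of the nilpotent operator \<open>T - 1\<close> for the eigenvalue \<open>-2\<close>\<close>
      have "((\<lambda>x. T x - x) ^^ k) v - scale ((-2) ^ k) v \<in> B" for k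
      proof (induction k)
        case 0
        then show ?case using subspace_0[OF B] by simp
      next
        case (Suc k)
        define u where "u = ((\<lambda>x. T x - x) ^^ k) v"
        let ?a = "(-2::'k) ^ k"
        have "T (u - scale ?a v) - (u - scale ?a v) + scale ?a (T v + v) = T u - u - scale ((-2) * ?a) v"
        proof -
          have "scale ((-2) * ?a) v = - (scale ?a v + scale ?a v)"
            by (simp only: scale_left_distrib[symmetric] scale_minus_left[symmetric]) simp
          then show ?thesis by (simp add: T.diff T.scale scale_right_distrib)
        qed
        moreover have "T (u - scale ?a v) - (u - scale ?a v) + scale ?a (T v + v) \<in> B"
        proof -
          have "u - scale ?a v \<in> B" using Suc unfolding u_def .
          then show ?thesis
            by (intro subspace_add[OF B subspace_diff[OF B] subspace_scale[OF B Tv]] TB)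
        qed
        ultimately have "T u - u - scale ((-2) * ?a) v \<in> B" by (simp only:)
        then show ?case by (simp only: u_def funpow.simps o_apply power_Suc)
      qed
      from this[of m] have "((\<lambda>x. T x - x) ^^ m) v - (((\<lambda>x. T x - x) ^^ m) v - scale ((-2) ^ m) v) \<in> B"
        using nil[OF vZ] subspace_diff[OF B] by blast
      then have "scale ((-2) ^ m) v \<in> B" by simp
      then have "scale (inverse ((-2) ^ m)) (scale ((-2) ^ m) v) \<in> B" by (rule subspace_scale[OF B])
      then have "v \<in> B" using two by simp
      then show ?thesis using x by (simp add: W_def v_def)
    qed
  qed
  moreover have "qdim B Z = qdim W Z + qdim B W" by (rule qdim_add[OF B W Z BW WZ fin])
  ultimately show ?thesis using ev unfolding W_def by simp
qed

end

section \<open>Homogeneous cochains\<close>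

definition fscale :: "rat \<Rightarrow> ('x \<Rightarrow> rat) \<Rightarrow> 'x \<Rightarrow> rat"
  where "fscale q f = (\<lambda>x. q * f x)"

interpretation fn: subquotients fscale
  by unfold_locales (auto simp: fscale_def fun_eq_iff algebra_simps)

lemma linear_fscaleI:
  assumes "\<And>f g. T (f + g) = T f + T g" "\<And>q f. T (fscale q f) = fscale q (T f)"
  shows "Vector_Spaces.linear fscale fscale T"
  using assms by (simp add: Vector_Spaces.linear_iff fn.vector_space_axioms)

lemma linear_functionalI:
  assumes "\<And>f g. \<phi> (f + g) = \<phi> f + \<phi> g" "\<And>q f. \<phi> (fscale q f) = q * \<phi> f"
  shows "Vector_Spaces.linear fscale (*) \<phi>"
  using assms by (simp add: Vector_Spaces.linear_iff fn.vector_space_axioms vector_space_field)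

definition skip :: "nat \<Rightarrow> 'x list \<Rightarrow> 'x list"
  where "skip i xs = take i xs @ drop (Suc i) xs"

lemma length_skip: "i < length xs \<Longrightarrow> length (skip i xs) = length xs - 1"
  by (simp add: skip_def)

lemma nth_skip: "i < length xs \<Longrightarrow> k < length xs - 1 \<Longrightarrow> skip i xs ! k = (if k < i then xs ! k else xs ! Suc k)"
  by (auto simp: skip_def nth_append min_def)

lemma set_skip: "set (skip i xs) \<subseteq> set xs"
  by (auto simp: skip_def dest: in_set_takeD in_set_dropD)

lemma set_take_drop_overlap: "set xs = set (take p xs) \<union> set (drop (p - 1) xs)"
proof -
  have "set (drop p xs) \<subseteq> set (drop (p - 1) xs)" by (rule set_drop_subset_set_drop) simp
  moreover have "set xs = set (take p xs) \<union> set (drop p xs)" by (metis append_take_drop_id set_append)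
  moreover have "set (drop (p - 1) xs) \<subseteq> set xs" by (rule set_drop_subset)
  ultimately show ?thesis by blast
qed

lemma skip_map: "skip i (map h xs) = map h (skip i xs)"
  by (simp add: skip_def take_map drop_map)

lemma skip_skip:
  assumes "j < i" "i < length xs"
  shows "skip j (skip i xs) = skip (i - 1) (skip j xs)"
  using assms by (intro nth_equalityI) (auto simp: length_skip nth_skip)

lemma rev_skip: "i < length xs \<Longrightarrow> rev (skip i xs) = skip (length xs - Suc i) (rev xs)"
  by (intro nth_equalityI) (auto simp: length_skip nth_skip rev_nth Suc_diff_Suc intro!: arg_cong[of _ _ "nth xs"])

lemma sum_lessThan_add: "(\<Sum>i<m + n. t i) = (\<Sum>i<m. t i) + (\<Sum>j<n. t (m + j))" for m n :: nat and t :: "nat \<Rightarrow> rat"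
  by (induction n) (auto simp: add.assoc)

locale group_cochains = group G for G :: "('a, 'b) monoid_scheme" (structure)
begin

definition shift :: "'a \<Rightarrow> ('a list \<Rightarrow> rat) \<Rightarrow> 'a list \<Rightarrow> rat"
  where "shift g f = (\<lambda>xs. if set xs \<subseteq> carrier G then f (map ((\<otimes>) g) xs) else 0)"

text \<open>Tuples in the whole group form a free \<open>K\<close>-set, so their \<open>K\<close>-invariant functions compute the
  cohomology of \<open>K\<close>.  The index counts arguments and is one more than the degree; excluding the
  empty list makes the space with index \<open>0\<close> trivial, so degree \<open>-1\<close> needs no separate treatment.\<close>

definition cochains :: "'a set \<Rightarrow> nat \<Rightarrow> ('a list \<Rightarrow> rat) set"
  where "cochains K n = {f. (\<forall>xs. f xs \<noteq> 0 \<longrightarrow> xs \<noteq> [] \<and> length xs = n \<and> set xs \<subseteq> carrier G) \<and> (\<forall>k\<in>K. shift k f = f)}"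

definition cobd :: "('a list \<Rightarrow> rat) \<Rightarrow> 'a list \<Rightarrow> rat"
  where "cobd f = (\<lambda>xs. if set xs \<subseteq> carrier G then \<Sum>i<length xs. (-1) ^ i * f (skip i xs) else 0)"

definition cocycles :: "'a set \<Rightarrow> nat \<Rightarrow> ('a list \<Rightarrow> rat) set"
  where "cocycles K n = {f \<in> cochains K n. cobd f = 0}"

definition coboundaries :: "'a set \<Rightarrow> nat \<Rightarrow> ('a list \<Rightarrow> rat) set"
  where "coboundaries K n = (if n = 0 then {0} else cobd ` cochains K (n - 1))"

text \<open>The index \<open>p\<close> counts the arguments of the first factor; the last of them is also the first argument
  of the second factor.\<close>

definition cup :: "nat \<Rightarrow> ('a list \<Rightarrow> rat) \<Rightarrow> ('a list \<Rightarrow> rat) \<Rightarrow> 'a list \<Rightarrow> rat"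
  where "cup p f g = (\<lambda>xs. f (take p xs) * g (drop (p - 1) xs))"

text \<open>Reversal exchanges the factors of a cup product, which turns statements about left annihilators into
  statements about right annihilators.\<close>

definition reversal :: "('a list \<Rightarrow> rat) \<Rightarrow> 'a list \<Rightarrow> rat"
  where "reversal f = (\<lambda>xs. f (rev xs))"

lemma linear_shift: "Vector_Spaces.linear fscale fscale (shift g)"
  by (rule linear_fscaleI) (auto simp: shift_def fscale_def fun_eq_iff)

lemma linear_cobd: "Vector_Spaces.linear fscale fscale cobd"
  by (rule linear_fscaleI) (auto simp: cobd_def fscale_def fun_eq_iff algebra_simps sum.distrib sum_distrib_left)

lemma linear_reversal: "Vector_Spaces.linear fscale fscale reversal"
  by (rule linear_fscaleI) (auto simp: reversal_def fscale_def fun_eq_iff)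

sublocale sh: Vector_Spaces.linear fscale fscale "shift g" for g by (rule linear_shift)
sublocale cb: Vector_Spaces.linear fscale fscale cobd by (rule linear_cobd)
sublocale rv: Vector_Spaces.linear fscale fscale reversal by (rule linear_reversal)

lemma cup_add_left: "cup p (f + f') g = cup p f g + cup p f' g"
  and cup_add_right: "cup p f (g + g') = cup p f g + cup p f g'"
  and cup_diff_left: "cup p (f - f') g = cup p f g - cup p f' g"
  and cup_diff_right: "cup p f (g - g') = cup p f g - cup p f g'"
  and cup_scale_left: "cup p (fscale c f) g = fscale c (cup p f g)"
  and cup_scale_right: "cup p f (fscale c g) = fscale c (cup p f g)"
  and cup_zero_left [simp]: "cup p 0 g = 0" and cup_zero_right [simp]: "cup p f 0 = 0"
  by (auto simp: cup_def fun_eq_iff fscale_def algebra_simps)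

lemma cochainsI:
  "(\<And>xs. f xs \<noteq> 0 \<Longrightarrow> xs \<noteq> [] \<and> length xs = n \<and> set xs \<subseteq> carrier G) \<Longrightarrow> (\<And>k. k \<in> K \<Longrightarrow> shift k f = f) \<Longrightarrow> f \<in> cochains K n"
  by (auto simp: cochains_def)

lemma cochains_support: "f \<in> cochains K n \<Longrightarrow> xs = [] \<or> length xs \<noteq> n \<or> \<not> set xs \<subseteq> carrier G \<Longrightarrow> f xs = 0"
  by (auto simp: cochains_def)

lemma cochains_nonzero: "f \<in> cochains K n \<Longrightarrow> f xs \<noteq> 0 \<Longrightarrow> xs \<noteq> [] \<and> length xs = n \<and> set xs \<subseteq> carrier G"
  by (auto simp: cochains_def)

lemma cochains_shift: "f \<in> cochains K n \<Longrightarrow> k \<in> K \<Longrightarrow> shift k f = f"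
  by (auto simp: cochains_def)

lemma cochains_invariant:
  "f \<in> cochains K n \<Longrightarrow> k \<in> K \<Longrightarrow> set xs \<subseteq> carrier G \<Longrightarrow> f (map ((\<otimes>) k) xs) = f xs"
  using cochains_shift[of f K n k] by (auto simp: shift_def fun_eq_iff split: if_splits)

lemma subspace_cochains: "fn.subspace (cochains K n)"
proof (rule fn.subspaceI)
  show "0 \<in> cochains K n" by (rule cochainsI) (auto simp: sh.zero)
next
  fix f g assume fg: "f \<in> cochains K n" "g \<in> cochains K n"
  show "f + g \<in> cochains K n"
  proof (rule cochainsI)
    fix xs assume "(f + g) xs \<noteq> 0"
    then have "f xs \<noteq> 0 \<or> g xs \<noteq> 0" by auto
    then show "xs \<noteq> [] \<and> length xs = n \<and> set xs \<subseteq> carrier G" using cochains_nonzero fg by blast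
  qed (simp add: sh.add cochains_shift[OF fg(1)] cochains_shift[OF fg(2)])
next
  fix c f assume f: "f \<in> cochains K n"
  show "fscale c f \<in> cochains K n"
  proof (rule cochainsI)
    fix xs assume "fscale c f xs \<noteq> 0"
    then have "f xs \<noteq> 0" by (auto simp: fscale_def)
    then show "xs \<noteq> [] \<and> length xs = n \<and> set xs \<subseteq> carrier G" using cochains_nonzero f by blast
  qed (simp add: sh.scale cochains_shift[OF f])
qed

lemma cochains_0: "cochains K 0 = {0}"
proof -
  have "f = 0" if "f \<in> cochains K 0" for f
  proof
    fix xs show "f xs = (0 :: 'a list \<Rightarrow> rat) xs" using cochains_support[OF that, of xs] by auto
  qed
  then show ?thesis using fn.subspace_0[OF subspace_cochains[of K 0]] by blast
qed

lemma cochains_antimono: "K \<subseteq> L \<Longrightarrow> cochains L n \<subseteq> cochains K n"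
  by (auto simp: cochains_def)

lemma shift_shift: "g \<in> carrier G \<Longrightarrow> h \<in> carrier G \<Longrightarrow> shift g (shift h f) = shift (h \<otimes> g) f"
  by (auto simp: shift_def fun_eq_iff o_def m_assoc subset_iff intro!: arg_cong[of _ _ f])

lemma shift_one: "f \<in> cochains K n \<Longrightarrow> shift \<one> f = f"
proof
  fix xs assume f: "f \<in> cochains K n"
  have "set xs \<subseteq> carrier G \<Longrightarrow> map ((\<otimes>) \<one>) xs = xs" by (intro map_idI) auto
  then show "shift \<one> f xs = f xs" using cochains_support[OF f, of xs] by (auto simp: shift_def)
qed

lemma mem_carrier_of_mult: "g \<in> carrier G \<Longrightarrow> set xs \<subseteq> carrier G \<Longrightarrow> set (map ((\<otimes>) g) xs) \<subseteq> carrier G"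
  by auto

lemma shift_cochains:
  assumes f: "f \<in> cochains K n" and g: "g \<in> carrier G" and K: "K \<subseteq> carrier G"
    and norm: "\<And>k. k \<in> K \<Longrightarrow> g \<otimes> k \<otimes> inv g \<in> K"
  shows "shift g f \<in> cochains K n"
proof (rule cochainsI)
  fix xs assume "shift g f xs \<noteq> 0"
  then have "f (map ((\<otimes>) g) xs) \<noteq> 0" "set xs \<subseteq> carrier G" by (auto simp: shift_def split: if_splits)
  then show "xs \<noteq> [] \<and> length xs = n \<and> set xs \<subseteq> carrier G"
    using cochains_support[OF f, of "map ((\<otimes>) g) xs"] by auto
next
  fix k assume k: "k \<in> K"
  then have kc: "k \<in> carrier G" using K by blast
  let ?k = "g \<otimes> k \<otimes> inv g"
  have "shift k (shift g f) = shift (g \<otimes> k) f" by (rule shift_shift[OF kc g])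
  also have "g \<otimes> k = ?k \<otimes> g" using g kc by (simp add: m_assoc)
  also have "shift (?k \<otimes> g) f = shift g (shift ?k f)" using g kc by (intro shift_shift[symmetric]) auto
  also have "shift ?k f = f" by (rule cochains_shift[OF f norm[OF k]])
  finally show "shift k (shift g f) = shift g f" .
qed

lemma cobd_shift: "g \<in> carrier G \<Longrightarrow> cobd (shift g f) = shift g (cobd f)"
proof
  fix xs assume g: "g \<in> carrier G"
  have "set (skip i xs) \<subseteq> carrier G" if "set xs \<subseteq> carrier G" for i using that set_skip by fast
  then show "cobd (shift g f) xs = shift g (cobd f) xs"
    using mem_carrier_of_mult[OF g, of xs] by (auto simp: cobd_def shift_def skip_map intro!: sum.cong)
qed

lemma cobd_cochains: "f \<in> cochains K n \<Longrightarrow> K \<subseteq> carrier G \<Longrightarrow> cobd f \<in> cochains K (Suc n)"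
proof (rule cochainsI)
  fix xs assume f: "f \<in> cochains K n" and nz: "cobd f xs \<noteq> 0"
  then have xs: "set xs \<subseteq> carrier G" "(\<Sum>i<length xs. (-1) ^ i * f (skip i xs)) \<noteq> 0"
    by (auto simp: cobd_def split: if_splits)
  then obtain i where i: "i < length xs" "f (skip i xs) \<noteq> 0"
    by (metis (no_types, lifting) lessThan_iff mult_zero_right sum.neutral)
  then have "length (skip i xs) = n" using cochains_support[OF f] by blast
  then show "xs \<noteq> [] \<and> length xs = Suc n \<and> set xs \<subseteq> carrier G" using i xs by (auto simp: length_skip)
next
  fix k assume "f \<in> cochains K n" "K \<subseteq> carrier G" "k \<in> K"
  then show "shift k (cobd f) = cobd f" using cobd_shift[of k f] cochains_shift by (metis subsetD)
qed

lemma cobd_cobd: "cobd (cobd f) = 0"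
proof
  fix xs
  show "cobd (cobd f) xs = (0 :: 'a list \<Rightarrow> rat) xs"
  proof (cases "set xs \<subseteq> carrier G")
    case True
    define n where "n = length xs"
    define t where "t i j = (-1 :: rat) ^ (i + j) * f (skip j (skip i xs))" for i j
    have sub: "set (skip i xs) \<subseteq> carrier G" for i using set_skip True by fast
    have "cobd (cobd f) xs = (\<Sum>i<n. \<Sum>j<n - 1. t i j)"
      using True sub by (auto simp: cobd_def n_def t_def length_skip sum_distrib_left power_add mult.assoc intro!: sum.cong)
    also have "\<dots> = (\<Sum>(i, j)\<in>{..<n} \<times> {..<n - 1}. t i j)" by (simp add: sum.cartesian_product)
    also have "{..<n} \<times> {..<n - 1} = {(i, j). j < i \<and> i < n} \<union> {(i, j). i \<le> j \<and> j < n - 1}" by auto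
    also have "(\<Sum>(i, j)\<in>\<dots>. t i j) = (\<Sum>(i, j)\<in>{(i, j). j < i \<and> i < n}. t i j) + (\<Sum>(i, j)\<in>{(i, j). i \<le> j \<and> j < n - 1}. t i j)"
    proof (rule sum.union_disjoint)
      show "finite {(i, j). j < i \<and> i < n}" by (rule finite_subset[of _ "{..n} \<times> {..n}"]) auto
      show "finite {(i, j). i \<le> j \<and> j < n - 1}" by (rule finite_subset[of _ "{..n} \<times> {..n}"]) auto
    qed auto
    also have "(\<Sum>(i, j)\<in>{(i, j). j < i \<and> i < n}. t i j) = (\<Sum>(i, j)\<in>{(i, j). i \<le> j \<and> j < n - 1}. - t i j)"
    proof (rule sum.reindex_bij_witness[where i = "\<lambda>(i, j). (Suc j, i)" and j = "\<lambda>(i, j). (j, i - 1)"])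
      fix p assume "p \<in> {(i, j). j < i \<and> i < n}"
      then obtain i j where p: "p = (i, j)" "j < i" "i < n" by auto
      then have "skip j (skip i xs) = skip (i - 1) (skip j xs)" by (intro skip_skip) (auto simp: n_def)
      moreover obtain k where "i = Suc k" using p by (cases i) auto
      ultimately show "(case case p of (i, j) \<Rightarrow> (j, i - 1) of (i, j) \<Rightarrow> - t i j) = (case p of (i, j) \<Rightarrow> t i j)"
        using p by (simp add: t_def add.commute)
    qed auto
    finally show ?thesis by (simp add: case_prod_beta' sum_negf)
  qed (simp add: cobd_def)
qed

lemma cup_cochains:
  assumes f: "f \<in> cochains K p" and g: "g \<in> cochains K q" and K: "K \<subseteq> carrier G"
  shows "cup p f g \<in> cochains K (p + q - 1)"
proof (rule cochainsI)
  fix xs assume "cup p f g xs \<noteq> 0"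
  then have nz: "f (take p xs) \<noteq> 0" "g (drop (p - 1) xs) \<noteq> 0" by (auto simp: cup_def)
  then have 1: "take p xs \<noteq> []" "length (take p xs) = p" "set (take p xs) \<subseteq> carrier G"
    and 2: "length (drop (p - 1) xs) = q" "set (drop (p - 1) xs) \<subseteq> carrier G"
    using cochains_support[OF f] cochains_support[OF g] by blast+
  then have "set xs \<subseteq> carrier G" using set_take_drop_overlap[of xs p] by blast
  then show "xs \<noteq> [] \<and> length xs = p + q - 1 \<and> set xs \<subseteq> carrier G" using 1 2 by auto
next
  fix k assume k: "k \<in> K"
  show "shift k (cup p f g) = cup p f g"
  proof
    fix xs
    show "shift k (cup p f g) xs = cup p f g xs"
    proof (cases "set xs \<subseteq> carrier G")
      case True
      then have "set (take p xs) \<subseteq> carrier G" "set (drop (p - 1) xs) \<subseteq> carrier G"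
        by (auto dest: in_set_takeD in_set_dropD)
      then show ?thesis using True cochains_invariant[OF f k] cochains_invariant[OF g k]
        by (simp add: shift_def cup_def take_map drop_map)
    next
      case False
      then have "\<not> (set (take p xs) \<subseteq> carrier G \<and> set (drop (p - 1) xs) \<subseteq> carrier G)"
        using set_take_drop_overlap[of xs p] by blast
      then have "cup p f g xs = 0" using cochains_support[OF f] cochains_support[OF g] by (auto simp: cup_def)
      then show ?thesis using False by (simp add: shift_def)
    qed
  qed
qed

lemma shift_cup: "g \<in> carrier G \<Longrightarrow> shift g (cup p a b) = cup p (shift g a) (shift g b)"
proof
  fix xs assume g: "g \<in> carrier G"
  have "set xs \<subseteq> carrier G \<longleftrightarrow> set (take p xs) \<subseteq> carrier G \<and> set (drop (p - 1) xs) \<subseteq> carrier G"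
    using set_take_drop_overlap[of xs p] by blast
  then show "shift g (cup p a b) xs = cup p (shift g a) (shift g b) xs"
    by (auto simp: shift_def cup_def take_map drop_map)
qed

text \<open>Deleting one of the first \<open>p + 1\<close> arguments is a face of the first factor, deleting a later one a face of
  the second.  On the right there are two further terms, the last face of \<open>f\<close> and the first face of \<open>g\<close>;
  both equal \<open>f (x\<^sub>0, \<dots>, x\<^sub>p) g (x\<^sub>p\<^sub>+\<^sub>1, \<dots>)\<close>, and they cancel.\<close>

lemma cobd_cup:
  assumes f: "f \<in> cochains K (Suc p)" and g: "g \<in> cochains K (Suc q)" 
  shows "cobd (cup (Suc p) f g) = cup (Suc (Suc p)) (cobd f) g + fscale ((-1) ^ p) (cup (Suc p) f (cobd g))"
proof
  fix xs
  have seteq: "set xs \<subseteq> carrier G \<longleftrightarrow> set (take (Suc m) xs) \<subseteq> carrier G \<and> set (drop m xs) \<subseteq> carrier G" for m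
    using set_take_drop_overlap[of xs "Suc m"] by auto
  show "cobd (cup (Suc p) f g) xs = (cup (Suc (Suc p)) (cobd f) g + fscale ((-1) ^ p) (cup (Suc p) f (cobd g))) xs"
  proof (cases "set xs \<subseteq> carrier G")
    case False
    have "f (take (Suc p) xs) * cobd g (drop p xs) = 0"
      using False seteq[of p] cochains_support[OF f, of "take (Suc p) xs"] by (auto simp: cobd_def)
    moreover have "cobd f (take (Suc (Suc p)) xs) * g (drop (Suc p) xs) = 0"
      using False seteq[of "Suc p"] cochains_support[OF g, of "drop (Suc p) xs"] by (auto simp: cobd_def)
    moreover have "cobd (cup (Suc p) f g) xs = 0" using False by (simp add: cobd_def)
    ultimately show ?thesis by (simp add: fscale_def) (auto simp: cup_def)
  next
    case True
    then have sub: "set (take m xs) \<subseteq> carrier G" "set (drop m xs) \<subseteq> carrier G" for m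
      by (auto dest: in_set_takeD in_set_dropD)
    show ?thesis
    proof (cases "length xs = Suc (Suc (p + q))")
      case len: True
      let ?F = "f (take (Suc p) xs)" and ?G = "g (drop (Suc p) xs)"
      define t where "t i = (-1) ^ i * cup (Suc p) f g (skip i xs)" for i
      have "cobd (cup (Suc p) f g) xs = (\<Sum>i<Suc p + Suc q. t i)"
        using True len by (simp add: cobd_def t_def)
      also have "\<dots> = (\<Sum>i<Suc p. t i) + (\<Sum>j<Suc q. t (Suc p + j))"
        by (rule sum_lessThan_add)
      also have "(\<Sum>i<Suc p. t i) = (\<Sum>i<Suc p. (-1) ^ i * f (skip i (take (Suc (Suc p)) xs))) * ?G"
        unfolding sum_distrib_right
      proof (rule sum.cong[OF refl])
        fix i assume i: "i \<in> {..<Suc p}"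
        have "take (Suc p) (skip i xs) = skip i (take (Suc (Suc p)) xs)" "drop p (skip i xs) = drop (Suc p) xs"
          using i len by (auto simp: skip_def take_drop min_def)
        then show "t i = (-1) ^ i * f (skip i (take (Suc (Suc p)) xs)) * ?G" by (simp add: t_def cup_def)
      qed
      also have "\<dots> = cobd f (take (Suc (Suc p)) xs) * ?G - (-1) ^ Suc p * ?F * ?G"
      proof -
        have last: "skip (Suc p) (take (Suc (Suc p)) xs) = take (Suc p) xs" using len by (simp add: skip_def take_take)
        have L: "length (take (Suc (Suc p)) xs) = Suc (Suc p)" using len by simp
        have "cobd f (take (Suc (Suc p)) xs) =
          (\<Sum>i<Suc p. (-1) ^ i * f (skip i (take (Suc (Suc p)) xs))) + (-1) ^ Suc p * ?F"
          using sub(1)[of "Suc (Suc p)"] unfolding cobd_def L by (simp only: sum.lessThan_Suc last if_True)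
        then show ?thesis by (simp only: algebra_simps)
      qed
      also have "(\<Sum>j<Suc q. t (Suc p + j)) = (-1) ^ p * ?F * (\<Sum>j<Suc q. (-1) ^ Suc j * g (skip (Suc j) (drop p xs)))"
        unfolding sum_distrib_left
      proof (rule sum.cong[OF refl])
        fix j assume j: "j \<in> {..<Suc q}"
        have "take (Suc p) (skip (Suc p + j) xs) = take (Suc p) xs"
          "drop p (skip (Suc p + j) xs) = skip (Suc j) (drop p xs)"
          using j len by (auto simp: skip_def min_def take_drop add.commute)
        then show "t (Suc p + j) = (-1) ^ p * ?F * ((-1) ^ Suc j * g (skip (Suc j) (drop p xs)))"
          by (simp add: t_def cup_def power_add)
      qed
      also have "(\<Sum>j<Suc q. (-1) ^ Suc j * g (skip (Suc j) (drop p xs))) = cobd g (drop p xs) - ?G"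
      proof -
        have "skip 0 (drop p xs) = drop (Suc p) xs" by (simp add: skip_def)
        moreover have "cobd g (drop p xs) = (\<Sum>j<Suc (Suc q). (-1) ^ j * g (skip j (drop p xs)))"
          using sub len by (simp add: cobd_def)
        ultimately show ?thesis by (simp only: sum.lessThan_Suc_shift) simp
      qed
      finally show ?thesis by (simp add: cup_def fscale_def algebra_simps)
    next
      case len: False
      have "cobd (cup (Suc p) f g) xs = (\<Sum>i<length xs. (-1) ^ i * cup (Suc p) f g (skip i xs))"
        using True by (simp add: cobd_def)
      also have "\<dots> = 0"
      proof (rule sum.neutral, intro ballI)
        fix i assume "i \<in> {..<length xs}"
        then have "length (skip i xs) \<noteq> Suc (p + q)" using len by (auto simp: length_skip)
        then have "\<not> (length (take (Suc p) (skip i xs)) = Suc p \<and> length (drop p (skip i xs)) = Suc q)" by auto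
        then have "cup (Suc p) f g (skip i xs) = 0"
          using cochains_support[OF f, of "take (Suc p) (skip i xs)"] cochains_support[OF g, of "drop p (skip i xs)"]
          by (auto simp: cup_def)
        then show "(-1) ^ i * cup (Suc p) f g (skip i xs) = 0" by simp
      qed
      finally have "cobd (cup (Suc p) f g) xs = 0" .
      moreover have "f (take (Suc p) xs) * cobd g (drop p xs) = 0"
      proof (cases "length xs = p")
        case True then show ?thesis using cochains_support[OF f, of "take (Suc p) xs"] by simp
      next
        case False
        have "cobd g \<in> cochains {} (Suc (Suc q))" using cobd_cochains[of g "{}" "Suc q"] g cochains_antimono[of "{}" K] by auto
        from cochains_support[OF this, of "drop p xs"] cochains_support[OF f, of "take (Suc p) xs"] len
        show ?thesis by (cases "length xs \<ge> Suc p") auto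
      qed
      moreover have "cobd f (take (Suc (Suc p)) xs) * g (drop (Suc p) xs) = 0"
      proof -
        have "cobd f \<in> cochains {} (Suc (Suc p))" using cobd_cochains[of f "{}" "Suc p"] f cochains_antimono[of "{}" K] by auto
        from cochains_support[OF this, of "take (Suc (Suc p)) xs"] cochains_support[OF g, of "drop (Suc p) xs"] len
        show ?thesis by (cases "length xs \<ge> Suc (Suc p)") auto
      qed
      ultimately show ?thesis by (simp add: fscale_def) (auto simp: cup_def)
    qed
  qed
qed

lemma reversal_reversal [simp]: "reversal (reversal f) = f"
  by (simp add: reversal_def)

lemma reversal_cochains: "f \<in> cochains K n \<Longrightarrow> reversal f \<in> cochains K n"
proof (rule cochainsI)
  fix xs assume "f \<in> cochains K n" "reversal f xs \<noteq> 0"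
  then show "xs \<noteq> [] \<and> length xs = n \<and> set xs \<subseteq> carrier G"
    using cochains_support[of f K n "rev xs"] by (auto simp: reversal_def)
next
  fix k assume "f \<in> cochains K n" "k \<in> K"
  then have "shift k f (rev xs) = f (rev xs)" for xs by (simp add: cochains_shift)
  moreover have "shift k (reversal f) xs = shift k f (rev xs)" for xs by (simp add: shift_def reversal_def rev_map)
  ultimately show "shift k (reversal f) = reversal f" by (simp add: fun_eq_iff reversal_def)
qed

lemma cobd_reversal:
  assumes f: "f \<in> cochains K n" and K: "K \<subseteq> carrier G"
  shows "cobd (reversal f) = fscale ((-1) ^ n) (reversal (cobd f))"
proof
  fix xs
  show "cobd (reversal f) xs = fscale ((-1) ^ n) (reversal (cobd f)) xs"
  proof (cases "set xs \<subseteq> carrier G \<and> length xs = Suc n")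
    case True
    have "cobd (reversal f) xs = (\<Sum>i<Suc n. (-1) ^ i * f (skip (n - i) (rev xs)))"
      using True by (auto simp: cobd_def reversal_def rev_skip intro!: sum.cong)
    also have "\<dots> = (\<Sum>j<Suc n. (-1) ^ n * ((-1) ^ j * f (skip j (rev xs))))"
    proof (rule sum.reindex_bij_witness[of _ "\<lambda>j. n - j" "\<lambda>i. n - i"])
      fix i assume "i \<in> {..<Suc n}"
      then have "(-1 :: rat) ^ n * (-1) ^ (n - i) = (-1) ^ i"
        by (auto simp: minus_one_power_iff)
      then show "(-1) ^ n * ((-1) ^ (n - i) * f (skip (n - i) (rev xs))) = (-1) ^ i * f (skip (n - i) (rev xs))"
        by (simp flip: mult.assoc)
    qed auto
    also have "\<dots> = (-1) ^ n * cobd f (rev xs)" using True by (simp add: cobd_def sum_distrib_left del: sum.lessThan_Suc)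
    finally show ?thesis by (simp add: fscale_def reversal_def)
  next
    case False
    then have "cobd (reversal f) xs = 0" "cobd f (rev xs) = 0"
      using cochains_support[OF cobd_cochains[OF reversal_cochains[OF f] K], of xs]
        cochains_support[OF cobd_cochains[OF f K], of "rev xs"] by auto
    then show ?thesis by (simp add: fscale_def reversal_def)
  qed
qed

lemma reversal_cup:
  assumes f: "f \<in> cochains K (Suc p)" and g: "g \<in> cochains K (Suc q)" and K: "K \<subseteq> carrier G"
  shows "reversal (cup (Suc p) f g) = cup (Suc q) (reversal g) (reversal f)"
proof
  fix xs
  show "reversal (cup (Suc p) f g) xs = cup (Suc q) (reversal g) (reversal f) xs"
  proof (cases "length xs = Suc (p + q)")
    case True
    then show ?thesis by (simp add: reversal_def cup_def take_rev drop_rev)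
  next
    case False
    then have "cup (Suc p) f g (rev xs) = 0" "cup (Suc q) (reversal g) (reversal f) xs = 0"
      using cochains_support[OF cup_cochains[OF f g K], of "rev xs"]
        cochains_support[OF cup_cochains[OF reversal_cochains[OF g] reversal_cochains[OF f] K], of xs] by auto
    then show ?thesis by (simp add: reversal_def)
  qed
qed

end

section \<open>Cohomology and cup products\<close>

lemma minus_one_power_cases: "(-1 :: rat) ^ n = 1 \<or> (-1 :: rat) ^ n = -1"
  by (cases "even n") auto

context group_cochains
begin

lemma cocyclesD: "z \<in> cocycles K n \<Longrightarrow> z \<in> cochains K n" "z \<in> cocycles K n \<Longrightarrow> cobd z = 0"
  by (auto simp: cocycles_def)

lemma coboundaries_0: "coboundaries K 0 = {0}" and coboundaries_Suc: "coboundaries K (Suc n) = cobd ` cochains K n"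
  by (simp_all add: coboundaries_def)

lemma cocycles_0: "cocycles K 0 = {0}"
  by (auto simp: cocycles_def cochains_0 cb.zero)

lemma subspace_cocycles: "fn.subspace (cocycles K n)"
  using subspace_cochains[of K n] by (auto simp: cocycles_def fn.subspace_def cb.add cb.scale cb.zero)

lemma subspace_coboundaries: "fn.subspace (coboundaries K n)"
  using cb.subspace_image[OF subspace_cochains] by (simp add: coboundaries_def fn.subspace_single_0)

lemma coboundaries_subset: "K \<subseteq> carrier G \<Longrightarrow> coboundaries K n \<subseteq> cocycles K n"
  using fn.subspace_0[OF subspace_cocycles]
  by (cases n) (auto simp: coboundaries_0 coboundaries_Suc cocycles_def cobd_cochains cobd_cobd)

lemma coboundaries_antimono: "K \<subseteq> L \<Longrightarrow> coboundaries L n \<subseteq> coboundaries K n"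
  using cochains_antimono[of K L] by (auto simp: coboundaries_def)

lemma cocycles_antimono: "K \<subseteq> L \<Longrightarrow> cocycles L n \<subseteq> cocycles K n"
  using cochains_antimono[of K L] by (auto simp: cocycles_def)

lemmas cochains_add = fn.subspace_add[OF subspace_cochains]
  and cochains_diff = fn.subspace_diff[OF subspace_cochains]
  and cochains_scale = fn.subspace_scale[OF subspace_cochains]
  and cocycles_add = fn.subspace_add[OF subspace_cocycles]
  and cocycles_diff = fn.subspace_diff[OF subspace_cocycles]
  and cocycles_scale = fn.subspace_scale[OF subspace_cocycles]
  and coboundaries_add = fn.subspace_add[OF subspace_coboundaries]
  and coboundaries_diff = fn.subspace_diff[OF subspace_coboundaries]
  and coboundaries_scale = fn.subspace_scale[OF subspace_coboundaries]

lemma cup_cocycles: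
  assumes a: "a \<in> cocycles K (Suc p)" and b: "b \<in> cocycles K (Suc q)" and K: "K \<subseteq> carrier G"
  shows "cup (Suc p) a b \<in> cocycles K (Suc (p + q))"
  using cup_cochains[OF cocyclesD(1)[OF a] cocyclesD(1)[OF b] K]
    cobd_cup[OF cocyclesD(1)[OF a] cocyclesD(1)[OF b]] cocyclesD(2)[OF a] cocyclesD(2)[OF b]
  by (simp add: cocycles_def)

lemma cup_coboundary_right:
  assumes a: "a \<in> cocycles K (Suc p)" and b: "b \<in> coboundaries K (Suc q)" and K: "K \<subseteq> carrier G"
  shows "cup (Suc p) a b \<in> coboundaries K (Suc (p + q))"
proof -
  obtain c where c: "c \<in> cochains K q" "b = cobd c" using b by (auto simp: coboundaries_Suc)
  show ?thesis
  proof (cases q)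
    case 0
    then have "b = 0" using c by (simp add: cochains_0 cb.zero)
    then show ?thesis using fn.subspace_0[OF subspace_coboundaries] by simp
  next
    case (Suc q')
    let ?e = "fscale ((-1) ^ p) (cup (Suc p) a c)"
    have "cobd ?e = fscale ((-1) ^ p * (-1) ^ p) (cup (Suc p) a b)"
      using cobd_cup[OF cocyclesD(1)[OF a], of c q'] c Suc cocyclesD(2)[OF a] by (simp add: cb.scale)
    also have "\<dots> = cup (Suc p) a b" using minus_one_power_cases[of p] by auto
    finally have "cobd ?e = cup (Suc p) a b" .
    moreover have "?e \<in> cochains K (p + q)"
      using cup_cochains[OF cocyclesD(1)[OF a] c(1) K] by (intro cochains_scale) simp
    ultimately show ?thesis unfolding coboundaries_Suc by (metis imageI)
  qed
qed

lemma cup_coboundary_left: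
  assumes a: "a \<in> coboundaries K (Suc p)" and b: "b \<in> cocycles K (Suc q)" and K: "K \<subseteq> carrier G"
  shows "cup (Suc p) a b \<in> coboundaries K (Suc (p + q))"
proof -
  obtain c where c: "c \<in> cochains K p" "a = cobd c" using a by (auto simp: coboundaries_Suc)
  show ?thesis
  proof (cases p)
    case 0
    then have "a = 0" using c by (simp add: cochains_0 cb.zero)
    then show ?thesis using fn.subspace_0[OF subspace_coboundaries] by simp
  next
    case (Suc p')
    have "cobd (cup p c b) = cup (Suc p) a b"
      using cobd_cup[of c K p', OF _ cocyclesD(1)[OF b]] c Suc cocyclesD(2)[OF b] by simp
    moreover have "cup p c b \<in> cochains K (p + q)"
      using cup_cochains[OF c(1) cocyclesD(1)[OF b] K] by simp
    ultimately show ?thesis unfolding coboundaries_Suc by (metis imageI)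
  qed
qed

lemma reversal_cocycles: "z \<in> cocycles K n \<Longrightarrow> K \<subseteq> carrier G \<Longrightarrow> reversal z \<in> cocycles K n"
  using cobd_reversal[of z K n] by (simp add: cocycles_def reversal_cochains rv.zero)

lemma reversal_coboundaries:
  assumes "b \<in> coboundaries K n" and K: "K \<subseteq> carrier G"
  shows "reversal b \<in> coboundaries K n"
proof (cases n)
  case 0
  then show ?thesis using assms by (simp add: coboundaries_0 rv.zero)
next
  case (Suc m)
  then obtain c where c: "c \<in> cochains K m" "b = cobd c" using assms by (auto simp: coboundaries_Suc)
  let ?e = "fscale ((-1) ^ m) (reversal c)"
  have "cobd ?e = fscale ((-1) ^ m * (-1) ^ m) (reversal b)"
    using cobd_reversal[OF c(1) K] c by (simp add: cb.scale)
  also have "\<dots> = reversal b" using minus_one_power_cases[of m] by auto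
  finally have "cobd ?e = reversal b" .
  moreover have "?e \<in> cochains K m" using c by (intro cochains_scale reversal_cochains)
  ultimately show ?thesis unfolding Suc coboundaries_Suc by (metis imageI)
qed

lemma cobd_length_4:
  assumes "set [x0, x1, x2, x3] \<subseteq> carrier G"
  shows "cobd f [x0, x1, x2, x3] = f [x1, x2, x3] - f [x0, x2, x3] + f [x0, x1, x3] - f [x0, x1, x2]"
  using assms by (simp add: cobd_def skip_def)

lemma cobd_length_5:
  assumes "set [x0, x1, x2, x3, x4] \<subseteq> carrier G"
  shows "cobd f [x0, x1, x2, x3, x4] =
    f [x1, x2, x3, x4] - f [x0, x2, x3, x4] + f [x0, x1, x3, x4] - f [x0, x1, x2, x4] + f [x0, x1, x2, x3]"
  using assms by (simp add: cobd_def skip_def numeral_eq_Suc)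

text \<open>The index counts arguments: \<open>Suc n\<close> stands for degree \<open>n\<close>.\<close>

abbreviation H_dim :: "'a set \<Rightarrow> nat \<Rightarrow> nat"
  where "H_dim K n \<equiv> fn.qdim (coboundaries K n) (cocycles K n)"

abbreviation H_finite :: "'a set \<Rightarrow> nat \<Rightarrow> bool"
  where "H_finite K n \<equiv> fn.qfin (coboundaries K n) (cocycles K n)"

text \<open>Steenrod's cup-one product in degree two; its coboundary is the commutator of two cocycles.\<close>

definition cup1 :: "('a list \<Rightarrow> rat) \<Rightarrow> ('a list \<Rightarrow> rat) \<Rightarrow> 'a list \<Rightarrow> rat"
  where "cup1 a b = (\<lambda>xs. if length xs = 4 \<and> set xs \<subseteq> carrier G
    then a [xs ! 0, xs ! 1, xs ! 3] * b [xs ! 1, xs ! 2, xs ! 3] - a [xs ! 0, xs ! 2, xs ! 3] * b [xs ! 0, xs ! 1, xs ! 2]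
    else 0)"

lemma length_4_cases: "length xs = 4 \<Longrightarrow> \<exists>x0 x1 x2 x3. xs = [x0, x1, x2, x3]"
  by (auto simp: numeral_eq_Suc length_Suc_conv)

lemma length_5_cases: "length xs = 5 \<Longrightarrow> \<exists>x0 x1 x2 x3 x4. xs = [x0, x1, x2, x3, x4]"
  by (auto simp: numeral_eq_Suc length_Suc_conv)

lemma cup1_cochains:
  assumes a: "a \<in> cochains K 3" and b: "b \<in> cochains K 3" and K: "K \<subseteq> carrier G"
  shows "cup1 a b \<in> cochains K 4"
proof (rule cochainsI)
  fix xs assume "cup1 a b xs \<noteq> 0"
  then show "xs \<noteq> [] \<and> length xs = 4 \<and> set xs \<subseteq> carrier G" by (auto simp: cup1_def split: if_splits)
next
  fix k assume k: "k \<in> K"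
  then have kc: "k \<in> carrier G" using K by blast
  show "shift k (cup1 a b) = cup1 a b"
  proof
    fix xs
    show "shift k (cup1 a b) xs = cup1 a b xs"
    proof (cases "length xs = 4 \<and> set xs \<subseteq> carrier G")
      case True
      then obtain x0 x1 x2 x3 where xs: "xs = [x0, x1, x2, x3]" using length_4_cases by blast
      have inv: "f [k \<otimes> x, k \<otimes> y, k \<otimes> z] = f [x, y, z]"
        if "f \<in> cochains K 3" "{x, y, z} \<subseteq> carrier G" for f x y z
        using cochains_invariant[OF that(1) k, of "[x, y, z]"] that(2) by simp
      show ?thesis using True kc by (simp add: shift_def cup1_def xs numeral_eq_Suc inv[OF a, unfolded numeral_eq_Suc] inv[OF b, unfolded numeral_eq_Suc] inv[OF a] inv[OF b])
    qed (auto simp: shift_def cup1_def)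
  qed
qed

lemma cup_symmetric_degree_2:
  assumes a: "a \<in> cocycles K 3" and b: "b \<in> cocycles K 3" and K: "K \<subseteq> carrier G"
  shows "cup 3 a b - cup 3 b a \<in> coboundaries K 5"
proof -
  have C: "cup 3 a b - cup 3 b a \<in> cochains K 5"
    using cup_cochains[OF cocyclesD(1)[OF a] cocyclesD(1)[OF b] K] cup_cochains[OF cocyclesD(1)[OF b] cocyclesD(1)[OF a] K]
    by (intro cochains_diff) simp_all
  have h: "cup1 a b \<in> cochains K 4" using a b K by (intro cup1_cochains cocyclesD(1))
  have D: "cobd (cup1 a b) \<in> cochains K 5" using cobd_cochains[OF h K] by simp
  have "cobd (cup1 a b) xs = (cup 3 a b - cup 3 b a) xs" for xs
  proof (cases "length xs = 5 \<and> set xs \<subseteq> carrier G")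
    case True
    then obtain x0 x1 x2 x3 x4 where xs: "xs = [x0, x1, x2, x3, x4]" using length_5_cases by blast
    have car: "{x0, x1, x2, x3, x4} \<subseteq> carrier G" using True xs by auto
    have rel: "f [y1, y2, y3] = f [y0, y2, y3] - f [y0, y1, y3] + f [y0, y1, y2]"
      if "f \<in> cocycles K 3" "{y0, y1, y2, y3} \<subseteq> carrier G" for f y0 y1 y2 y3
      using cobd_length_4[of y0 y1 y2 y3 f] that by (simp add: cocyclesD(2))
    have h4: "cup1 a b [y0, y1, y2, y3] = a [y0, y1, y3] * b [y1, y2, y3] - a [y0, y2, y3] * b [y0, y1, y2]"
      if "{y0, y1, y2, y3} \<subseteq> carrier G" for y0 y1 y2 y3
      using that by (simp add: cup1_def numeral_eq_Suc)
    have cupxs: "cup 3 f g xs = f [x0, x1, x2] * g [x2, x3, x4]" for f g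
      by (simp add: cup_def xs numeral_eq_Suc)
    \<comment> \<open>all values are expressed through those on triples starting with \<open>x0\<close>\<close>
    have ra: "a [y1, y2, y3] = a [x0, y2, y3] - a [x0, y1, y3] + a [x0, y1, y2]"
      and rb: "b [y1, y2, y3] = b [x0, y2, y3] - b [x0, y1, y3] + b [x0, y1, y2]"
      if "{y1, y2, y3} \<subseteq> carrier G" for y1 y2 y3
      using rel[OF a, of x0 y1 y2 y3] rel[OF b, of x0 y1 y2 y3] that car by auto
    have *: "{x1,x2,x3} \<subseteq> carrier G" "{x1,x2,x4} \<subseteq> carrier G" "{x1,x3,x4} \<subseteq> carrier G" "{x2,x3,x4} \<subseteq> carrier G"
      using car by auto
    note r = ra[OF *(1)] ra[OF *(2)] ra[OF *(3)] ra[OF *(4)] rb[OF *(1)] rb[OF *(2)] rb[OF *(3)] rb[OF *(4)]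
    have "cobd (cup1 a b) xs = cup1 a b [x1, x2, x3, x4] - cup1 a b [x0, x2, x3, x4] + cup1 a b [x0, x1, x3, x4]
        - cup1 a b [x0, x1, x2, x4] + cup1 a b [x0, x1, x2, x3]"
      unfolding xs by (rule cobd_length_5) (use car in auto)
    also have "\<dots> = a [x0, x1, x2] * b [x2, x3, x4] - b [x0, x1, x2] * a [x2, x3, x4]"
      using car by (simp add: h4 r) (simp add: algebra_simps)
    finally show ?thesis by (simp add: cupxs)
  next
    case False
    then show ?thesis using cochains_support[OF C, of xs] cochains_support[OF D, of xs] by auto
  qed
  then have "cobd (cup1 a b) = cup 3 a b - cup 3 b a" by blast
  then show ?thesis using h coboundaries_Suc[of K 4] by (metis imageI eval_nat_numeral(3) numeral_eq_Suc pred_numeral_simps(3))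
qed

definition delta :: "'a \<Rightarrow> ('a list \<Rightarrow> rat) \<Rightarrow> 'a list \<Rightarrow> rat"
  where "delta g f = shift g f - f"

lemma linear_delta: "Vector_Spaces.linear fscale fscale (delta g)"
  by (rule linear_fscaleI) (simp_all add: delta_def sh.add sh.scale fn.scale_right_diff_distrib)

sublocale dl: Vector_Spaces.linear fscale fscale "delta g" for g by (rule linear_delta)

lemma cobd_delta: "g \<in> carrier G \<Longrightarrow> cobd (delta g f) = delta g (cobd f)"
  by (simp add: delta_def cb.diff cobd_shift)

definition normalises :: "'a \<Rightarrow> 'a set \<Rightarrow> bool"
  where "normalises g K \<longleftrightarrow> g \<in> carrier G \<and> (\<forall>k\<in>K. g \<otimes> k \<otimes> inv g \<in> K \<and> inv g \<otimes> k \<otimes> g \<in> K)"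

lemma normalises_carrier: "normalises g K \<Longrightarrow> g \<in> carrier G"
  by (simp add: normalises_def)

lemma normalises_inv: "normalises g K \<Longrightarrow> normalises (inv g) K"
  by (auto simp: normalises_def)

lemma shift_cochains_normalises: "normalises g K \<Longrightarrow> K \<subseteq> carrier G \<Longrightarrow> f \<in> cochains K n \<Longrightarrow> shift g f \<in> cochains K n"
  by (rule shift_cochains) (auto simp: normalises_def)

lemma shift_cocycles: "normalises g K \<Longrightarrow> K \<subseteq> carrier G \<Longrightarrow> f \<in> cocycles K n \<Longrightarrow> shift g f \<in> cocycles K n"
  by (auto simp: cocycles_def shift_cochains_normalises cobd_shift normalises_carrier sh.zero)

lemma shift_coboundaries: "normalises g K \<Longrightarrow> K \<subseteq> carrier G \<Longrightarrow> f \<in> coboundaries K n \<Longrightarrow> shift g f \<in> coboundaries K n"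
  by (cases n) (auto simp: coboundaries_0 coboundaries_Suc sh.zero shift_cochains_normalises normalises_carrier cobd_shift[symmetric])

lemma delta_cochains: "normalises g K \<Longrightarrow> K \<subseteq> carrier G \<Longrightarrow> f \<in> cochains K n \<Longrightarrow> delta g f \<in> cochains K n"
  unfolding delta_def by (intro cochains_diff shift_cochains_normalises)

lemma delta_cocycles: "normalises g K \<Longrightarrow> K \<subseteq> carrier G \<Longrightarrow> f \<in> cocycles K n \<Longrightarrow> delta g f \<in> cocycles K n"
  unfolding delta_def by (intro cocycles_diff shift_cocycles)

lemma delta_coboundaries: "normalises g K \<Longrightarrow> K \<subseteq> carrier G \<Longrightarrow> f \<in> coboundaries K n \<Longrightarrow> delta g f \<in> coboundaries K n"
  unfolding delta_def by (intro coboundaries_diff shift_coboundaries)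

lemma delta_pow_cochains: "normalises g K \<Longrightarrow> K \<subseteq> carrier G \<Longrightarrow> f \<in> cochains K n \<Longrightarrow> (delta g ^^ m) f \<in> cochains K n"
  by (induction m) (auto intro: delta_cochains)

lemma cobd_delta_pow: "g \<in> carrier G \<Longrightarrow> cobd ((delta g ^^ m) f) = (delta g ^^ m) (cobd f)"
  by (induction m) (auto simp: cobd_delta)

lemma delta_cup_right: "g \<in> carrier G \<Longrightarrow> shift g a = a \<Longrightarrow> delta g (cup p a b) = cup p a (delta g b)"
  by (simp add: delta_def shift_cup cup_diff_right)

lemma delta_cup_left: "g \<in> carrier G \<Longrightarrow> shift g b = b \<Longrightarrow> delta g (cup p a b) = cup p (delta g a) b"
  by (simp add: delta_def shift_cup cup_diff_left)

definition unipotent_on :: "'a set \<Rightarrow> 'a \<Rightarrow> bool"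
  where "unipotent_on K g \<longleftrightarrow> (\<forall>n. \<exists>m. \<forall>z\<in>cocycles K n. (delta g ^^ m) z \<in> coboundaries K n)"

text \<open>Coning off at the identity contracts the complex of all cochains.\<close>

lemma cocycles_trivial_group: 
  assumes n: "n > 0" 
  shows "cocycles {\<one>} (Suc n) \<subseteq> coboundaries {\<one>} (Suc n)"
proof
  fix f assume f: "f \<in> cocycles {\<one>} (Suc n)"
  define c where "c = (\<lambda>xs. if xs \<noteq> [] \<and> set xs \<subseteq> carrier G then f (\<one> # xs) else 0)"
  note fc = cocyclesD(1)[OF f]
  have cC: "c \<in> cochains {\<one>} n"
  proof (rule cochainsI)
    fix xs assume "c xs \<noteq> 0"
    then have "f (\<one> # xs) \<noteq> 0" "xs \<noteq> []" by (auto simp: c_def split: if_splits)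
    then show "xs \<noteq> [] \<and> length xs = n \<and> set xs \<subseteq> carrier G" using cochains_nonzero[OF fc, of "\<one> # xs"] by auto
  next
    fix k assume "k \<in> {\<one>}"
    moreover have "map ((\<otimes>) \<one>) xs = xs" if "set xs \<subseteq> carrier G" for xs using that by (intro map_idI) auto
    ultimately show "shift k c = c" by (auto simp: shift_def c_def fun_eq_iff)
  qed
  have "cobd c xs = f xs" for xs
  proof (cases "set xs \<subseteq> carrier G \<and> length xs = Suc n")
    case True
    have "0 = cobd f (\<one> # xs)" using cocyclesD(2)[OF f] by simp
    also have "\<dots> = (\<Sum>i<Suc (Suc n). (-1) ^ i * f (skip i (\<one> # xs)))" using True by (simp add: cobd_def)
    also have "\<dots> = f xs - (\<Sum>i<Suc n. (-1) ^ i * f (\<one> # skip i xs))"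
      by (subst sum.lessThan_Suc_shift) (simp add: skip_def sum_negf del: sum.lessThan_Suc)
    also have "(\<Sum>i<Suc n. (-1) ^ i * f (\<one> # skip i xs)) = cobd c xs"
    proof -
      have "f (\<one> # skip i xs) = c (skip i xs)" if "i < Suc n" for i
      proof -
        have "set (skip i xs) \<subseteq> carrier G" using set_skip True by fast
        moreover have "length (skip i xs) = n" using True that by (simp add: length_skip)
        ultimately show ?thesis using n by (auto simp: c_def)
      qed
      then show ?thesis using True by (simp add: cobd_def del: sum.lessThan_Suc)
    qed
    finally show ?thesis by simp
  next
    case False
    then have "f xs = 0" using cochains_support[OF fc, of xs] by blast
    moreover have "cobd c xs = 0" using False cochains_support[OF cobd_cochains[OF cC], of xs] by blast
    ultimately show ?thesis by simp
  qed
  then have "f = cobd c" by auto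
  then show "f \<in> coboundaries {\<one>} (Suc n)" using cC by (auto simp: coboundaries_Suc)
qed

lemma cocycles_1_constant:
  assumes f: "f \<in> cocycles K 1" and x: "x \<in> carrier G"
  shows "f [x] = f [\<one>]"
proof -
  have "cobd f [\<one>, x] = 0" using cocyclesD(2)[OF f] by simp
  then show ?thesis using x by (simp add: cobd_def skip_def)
qed

definition unit_cocycle :: "'a list \<Rightarrow> rat"
  where "unit_cocycle = (\<lambda>xs. if length xs = 1 \<and> set xs \<subseteq> carrier G then 1 else 0)"

lemma unit_cocycle: "K \<subseteq> carrier G \<Longrightarrow> unit_cocycle \<in> cocycles K 1"
proof -
  assume K: "K \<subseteq> carrier G"
  have C: "unit_cocycle \<in> cochains K 1"
    by (rule cochainsI) (use K in \<open>auto simp: unit_cocycle_def shift_def fun_eq_iff subset_iff split: if_splits\<close>)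
  have "cobd unit_cocycle xs = 0" for xs
  proof (cases "length xs = 2 \<and> set xs \<subseteq> carrier G")
    case True
    then obtain x y where "xs = [x, y]" by (auto simp: numeral_eq_Suc length_Suc_conv)
    then show ?thesis using True by (simp add: cobd_def skip_def unit_cocycle_def)
  next
    case False
    then show ?thesis using cochains_support[OF cobd_cochains[OF C K], of xs] by (auto simp: numeral_eq_Suc)
  qed
  then show ?thesis using C by (auto simp: cocycles_def fun_eq_iff)
qed

lemma cocycles_1_eq:
  assumes f: "f \<in> cocycles K 1"
  shows "f = fscale (f [\<one>]) unit_cocycle"
proof
  fix xs
  show "f xs = fscale (f [\<one>]) unit_cocycle xs"
  proof (cases "length xs = 1 \<and> set xs \<subseteq> carrier G")
    case True
    then obtain x where "xs = [x]" by (auto simp: length_Suc_conv)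
    then show ?thesis using True cocycles_1_constant[OF f, of x] by (simp add: fscale_def unit_cocycle_def)
  next
    case False
    then show ?thesis using cochains_support[OF cocyclesD(1)[OF f], of xs] by (auto simp: fscale_def unit_cocycle_def)
  qed
qed

lemma coboundaries_1: "coboundaries K (Suc 0) = {0}"
  by (simp add: coboundaries_Suc cochains_0 cb.zero)

lemma qdim_degree_0:
  assumes K: "K \<subseteq> carrier G"
  shows "H_finite K (Suc 0)" "H_dim K (Suc 0) = 1"
proof -
  have lin: "Vector_Spaces.linear fscale (*) (\<lambda>f. f [\<one>] :: rat)" by (rule linear_functionalI) (auto simp: fscale_def)
  have gen: "z - (\<Sum>i<1::nat. fscale (z [\<one>]) unit_cocycle) \<in> coboundaries K (Suc 0)" if "z \<in> cocycles K (Suc 0)" for z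
  proof -
    have "z = fscale (z [\<one>]) unit_cocycle" using cocycles_1_eq[of z K] that by simp
    then have "z - fscale (z [\<one>]) unit_cocycle = 0" by (metis cancel_comm_monoid_add_class.diff_cancel)
    then show ?thesis by (simp add: coboundaries_1)
  qed
  have u: "unit_cocycle \<in> cocycles K (Suc 0)" using unit_cocycle[OF K] by simp
  have one: "unit_cocycle [\<one>] = 1" by (simp add: unit_cocycle_def)
  have kill: "b [\<one>] = 0" if "b \<in> coboundaries K (Suc 0)" for b using that by (simp add: coboundaries_1)
  have dual: "unit_cocycle [\<one>] = (if i = j then 1 else 0)" if "i < 1" "j < 1" for i j :: nat using that one by simp
  note q = fn.qdim_eqI[where n = 1 and e = "\<lambda>_. unit_cocycle" and \<phi> = "\<lambda>_ f. f [\<one>]", OF subspace_coboundaries subspace_cocycles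
      coboundaries_subset[OF K]]
  show "H_finite K (Suc 0)"
    by (rule q(1)) (rule u lin | erule kill gen | erule (1) dual)+
  show "H_dim K (Suc 0) = 1"
    by (rule q(2)) (rule u lin | erule kill gen | erule (1) dual)+
qed

end

section \<open>Extensions with cyclic quotient\<close>

text \<open>The oriented sum of \<open>\<phi>\<close> over \<open>-1, \<dots>, -m\<close>; for negative \<open>m\<close> it runs over \<open>0, \<dots>, -m - 1\<close> with the
  opposite sign, so that one step formula covers all \<open>m\<close>.\<close>

definition integer_sum :: "(int \<Rightarrow> rat) \<Rightarrow> int \<Rightarrow> rat"
  where "integer_sum \<phi> m = (if m \<ge> 0 then \<Sum>i<nat m. \<phi> (- int i - 1) else - (\<Sum>i<nat (- m). \<phi> (int i)))"

lemma integer_sum_step: "integer_sum (\<lambda>j. \<phi> (j + 1)) (m + 1) = integer_sum \<phi> m + \<phi> 0"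
proof (cases "m \<ge> 0")
  case True
  then have "nat (m + 1) = Suc (nat m)" by simp
  then have "integer_sum (\<lambda>j. \<phi> (j + 1)) (m + 1) = (\<Sum>i<Suc (nat m). \<phi> (- int i))"
    using True by (simp add: integer_sum_def del: sum.lessThan_Suc)
  also have "\<dots> = \<phi> 0 + (\<Sum>i<nat m. \<phi> (- int i - 1))"
    by (simp only: sum.lessThan_Suc_shift) (auto intro!: sum.cong arg_cong[of _ _ \<phi>])
  finally show ?thesis using True by (simp add: integer_sum_def)
next
  case False
  define k where "k = nat (- m) - 1"
  have k: "nat (- m) = Suc k" "m = - int k - 1" using False by (auto simp: k_def)
  have "integer_sum \<phi> m = - (\<Sum>i<Suc k. \<phi> (int i))" using False k by (simp add: integer_sum_def del: sum.lessThan_Suc)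
  also have "\<dots> = - \<phi> 0 - (\<Sum>i<k. \<phi> (int i + 1))" by (subst sum.lessThan_Suc_shift) (simp add: add.commute)
  finally show ?thesis using k by (cases "k = 0") (auto simp: integer_sum_def)
qed

lemma sum_constant_fscale: "(\<Sum>i<n. f) = fscale (rat_of_nat n) f" for n :: nat
  by (induction n) (auto simp: fscale_def fun_eq_iff algebra_simps)

context group
begin

lemma inv_mult_cancel_left: "x \<in> carrier G \<Longrightarrow> y \<in> carrier G \<Longrightarrow> inv x \<otimes> (x \<otimes> y) = y"
  and mult_inv_cancel_left: "x \<in> carrier G \<Longrightarrow> y \<in> carrier G \<Longrightarrow> x \<otimes> (inv x \<otimes> y) = y"
  by (simp_all flip: m_assoc)

end

locale cyclic_extension = group_cochains G for G :: "('a, 'b) monoid_scheme" (structure) +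
  fixes L M :: "'a set" and t :: 'a
  assumes subgroup_L: "subgroup L G" and subgroup_M: "subgroup M G" and L_subset_M: "L \<subseteq> M" and t_in_M: "t \<in> M"
    and t_normalises: "normalises t L"
    and M_elements: "g \<in> M \<Longrightarrow> \<exists>l\<in>L. \<exists>k::int. g = l \<otimes> t [^] k"
begin

lemma L_carrier: "L \<subseteq> carrier G" and M_carrier: "M \<subseteq> carrier G" and t_carrier: "t \<in> carrier G"
  using subgroup.subset[OF subgroup_L] subgroup.subset[OF subgroup_M] t_in_M by auto

lemma shift_nat_pow_fixed:
  assumes "f \<in> cochains K n" "shift t f = f" shows "shift (t [^] (k::nat)) f = f"
proof (induction k)
  case 0
  then show ?case using shift_one[OF assms(1)] by simp
next
  case (Suc k)
  have "shift (t [^] Suc k) f = shift t (shift (t [^] k) f)" using t_carrier by (simp add: shift_shift)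
  then show ?case using Suc assms by simp
qed

lemma shift_int_pow_fixed:
  assumes "f \<in> cochains K n" "shift t f = f" shows "shift (t [^] (k::int)) f = f"
proof (cases k)
  case (nonneg n)
  then show ?thesis using shift_nat_pow_fixed[OF assms] by (simp add: int_pow_int)
next
  case (neg m)
  let ?g = "t [^] Suc m"
  have g: "?g \<in> carrier G" using t_carrier by (rule nat_pow_closed)
  have "shift (inv ?g) f = shift (inv ?g) (shift ?g f)" by (simp only: shift_nat_pow_fixed[OF assms])
  also have "\<dots> = shift (?g \<otimes> inv ?g) f" using g by (intro shift_shift) auto
  also have "\<dots> = f" using g shift_one[OF assms(1)] by (simp del: nat_pow_Suc)
  finally have "shift (inv ?g) f = f" .
  then show ?thesis using neg t_carrier by (simp add: int_pow_neg int_pow_int del: nat_pow_Suc of_nat_Suc)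
qed

lemma cochains_M_iff: "f \<in> cochains M n \<longleftrightarrow> f \<in> cochains L n \<and> shift t f = f"
proof
  assume "f \<in> cochains M n"
  then show "f \<in> cochains L n \<and> shift t f = f" using cochains_antimono[OF L_subset_M] cochains_shift t_in_M by blast
next
  assume f: "f \<in> cochains L n \<and> shift t f = f"
  show "f \<in> cochains M n"
  proof (rule cochainsI)
    fix g assume "g \<in> M"
    then obtain l k where lk: "l \<in> L" "g = l \<otimes> t [^] (k::int)" using M_elements by blast
    then have "shift g f = shift (t [^] k) (shift l f)"
      using L_carrier t_carrier by (subst shift_shift) auto
    also have "\<dots> = f" using f lk cochains_shift shift_int_pow_fixed by metis
    finally show "shift g f = f" .
  qed (use f cochains_nonzero in blast)
qed

lemma cochains_M_iff_delta: "f \<in> cochains M n \<longleftrightarrow> f \<in> cochains L n \<and> delta t f = 0"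
  by (simp add: cochains_M_iff delta_def)

lemma cocycles_M_iff_delta: "f \<in> cocycles M n \<longleftrightarrow> f \<in> cocycles L n \<and> delta t f = 0"
  by (auto simp: cocycles_def cochains_M_iff_delta)

lemma delta_M: "f \<in> cochains M n \<Longrightarrow> delta t f = 0"
  by (simp add: cochains_M_iff_delta)

lemma cocycles_M_L: "z \<in> cocycles M n \<Longrightarrow> z \<in> cocycles L n"
  and cochains_M_L: "z \<in> cochains M n \<Longrightarrow> z \<in> cochains L n"
  and coboundaries_M_L: "z \<in> coboundaries M n \<Longrightarrow> z \<in> coboundaries L n"
  using cocycles_antimono[OF L_subset_M] cochains_antimono[OF L_subset_M] coboundaries_antimono[OF L_subset_M] by blast+

lemmas sub_L = coboundaries_subset[OF L_carrier, THEN subsetD]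
  and sub_M = coboundaries_subset[OF M_carrier, THEN subsetD]
  and delta_C = delta_cochains[OF t_normalises L_carrier]
  and delta_Z = delta_cocycles[OF t_normalises L_carrier]
  and delta_B = delta_coboundaries[OF t_normalises L_carrier]

text \<open>The commutator of \<open>g\<close> and \<open>t\<close> lies in \<open>L\<close>, and \<open>L\<close> does not move its own invariant cochains.\<close>

lemma delta_pow_commute:
  assumes g: "normalises g L" and comm: "g \<otimes> t \<otimes> inv g \<otimes> inv t \<in> L" and f: "f \<in> cochains L n"
  shows "delta t ((delta g ^^ m) f) = (delta g ^^ m) (delta t f)"
proof -
  have gc: "g \<in> carrier G" using g by (rule normalises_carrier)
  have sw: "shift t (shift g f) = shift g (shift t f)" if f: "f \<in> cochains L n" for f
  proof -
    let ?c = "g \<otimes> t \<otimes> inv g \<otimes> inv t"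
    have cc: "?c \<in> carrier G" using gc t_carrier by simp
    have "shift t (shift g f) = shift (g \<otimes> t) f" by (rule shift_shift[OF t_carrier gc])
    also have "g \<otimes> t = ?c \<otimes> (t \<otimes> g)" using gc t_carrier by (simp add: m_assoc inv_mult_cancel_left)
    also have "shift \<dots> f = shift (t \<otimes> g) (shift ?c f)" using gc t_carrier cc by (intro shift_shift[symmetric]) auto
    also have "shift ?c f = f" by (rule cochains_shift[OF f comm])
    also have "shift (t \<otimes> g) f = shift g (shift t f)" by (rule shift_shift[symmetric, OF gc t_carrier])
    finally show ?thesis .
  qed
  show ?thesis
  proof (induction m)
    case (Suc m)
    have C: "(delta g ^^ m) f \<in> cochains L n" by (rule delta_pow_cochains[OF g L_carrier f])
    have "delta t (delta g ((delta g ^^ m) f)) = delta g (delta t ((delta g ^^ m) f))"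
      using sw[OF C] by (simp add: delta_def sh.diff)
    then show ?case using Suc by simp
  qed simp
qed

end

locale infinite_cyclic_extension = cyclic_extension +
  assumes infinite_order: "0 < k \<Longrightarrow> t [^] (k::nat) \<notin> L"
begin

lemma int_pow_in_L: "t [^] (k::int) \<in> L \<Longrightarrow> k = 0"
proof (rule ccontr)
  assume k: "t [^] k \<in> L" "k \<noteq> 0"
  interpret L: subgroup L G by (rule subgroup_L)
  have "t [^] nat \<bar>k\<bar> \<in> L"
  proof (cases "k \<ge> 0")
    case True
    then show ?thesis using k by (metis abs_of_nonneg int_pow_int nat_0_le)
  next
    case False
    then have "t [^] nat \<bar>k\<bar> = inv (t [^] k)" using t_carrier by (simp add: int_pow_neg[symmetric] int_pow_int[symmetric])
    then show ?thesis using k by simp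
  qed
  then show False using infinite_order[of "nat \<bar>k\<bar>"] k by simp
qed

text \<open>Right cosets \<open>M x\<close> are copies of \<open>M\<close>, so that the exponent of \<open>t\<close> is a well-defined
  \<open>L\<close>-invariant coordinate on them.\<close>

lemma exists_height:
  "\<exists>m :: 'a \<Rightarrow> int. \<forall>x\<in>carrier G. (\<forall>l\<in>L. m (l \<otimes> x) = m x) \<and> m (t \<otimes> x) = m x + 1"
proof -
  interpret L: subgroup L G by (rule subgroup_L)
  interpret M: subgroup M G by (rule subgroup_M)
  define r where "r x = (SOME r. r \<in> M #> x)" for x
  define P where "P x k \<longleftrightarrow> (\<exists>l\<in>L. x = l \<otimes> t [^] k \<otimes> r x)" for x and k :: int
  define m where "m x = (SOME k. P x k)" for x
  have rM: "r x \<in> M #> x" if "x \<in> carrier G" for x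
    unfolding r_def by (rule someI[of _ x]) (rule rcos_self[OF that subgroup_M])
  have rc: "r x \<in> carrier G" if "x \<in> carrier G" for x
    using rM[OF that] that M.subset by (auto simp: r_coset_def)
  have rinv: "r (g \<otimes> x) = r x" if "x \<in> carrier G" "g \<in> M" for g x
  proof -
    have "g \<otimes> x \<in> M #> x" using that by (auto simp: r_coset_def)
    then have "M #> x = M #> (g \<otimes> x)" by (rule repr_independence[OF _ that(1) subgroup_M])
    then show ?thesis by (simp add: r_def)
  qed
  have ex: "\<exists>k. P x k" if x: "x \<in> carrier G" for x
  proof -
    obtain g where g: "g \<in> M" "r x = g \<otimes> x" using rM[OF x] by (auto simp: r_coset_def)
    obtain l k where lk: "l \<in> L" "inv g = l \<otimes> t [^] (k::int)" using M_elements[of "inv g"] g by auto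
    have "x = inv g \<otimes> r x" using g x M.mem_carrier by (simp add: inv_mult_cancel_left)
    then show ?thesis unfolding P_def using lk by auto
  qed
  have mP: "P x (m x)" if "x \<in> carrier G" for x unfolding m_def by (rule someI_ex[OF ex[OF that]])
  have uniq: "k = j" if x: "x \<in> carrier G" and kj: "P x k" "P x j" for x k j
  proof -
    obtain l l' where l: "l \<in> L" "l' \<in> L" "x = l \<otimes> t [^] k \<otimes> r x" "x = l' \<otimes> t [^] j \<otimes> r x"
      using kj unfolding P_def by blast
    have "l \<otimes> t [^] k = l' \<otimes> t [^] j"
    proof -
      have "(l \<otimes> t [^] k) \<otimes> r x = (l' \<otimes> t [^] j) \<otimes> r x" using l by simp
      then show ?thesis using l(1,2) rc[OF x] t_carrier by (subst (asm) right_cancel) auto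
    qed
    then have "inv l' \<otimes> (l \<otimes> t [^] k) \<otimes> inv (t [^] k) = inv l' \<otimes> (l' \<otimes> t [^] j) \<otimes> inv (t [^] k)" by simp
    then have "inv l' \<otimes> l = t [^] j \<otimes> inv (t [^] k)"
      using l(1,2) t_carrier by (simp add: m_assoc inv_mult_cancel_left)
    also have "\<dots> = t [^] (j - k)" using t_carrier by (simp add: int_pow_diff)
    finally have "t [^] (j - k) \<in> L" using l(1,2) by (metis L.m_closed L.m_inv_closed)
    then show ?thesis using int_pow_in_L by fastforce
  qed
  have "m (l \<otimes> x) = m x" if x: "x \<in> carrier G" and l: "l \<in> L" for x l
  proof -
    obtain l' where l': "l' \<in> L" "x = l' \<otimes> t [^] m x \<otimes> r x" using mP[OF x] unfolding P_def by blast
    have "l \<otimes> x = l \<otimes> (l' \<otimes> t [^] m x \<otimes> r x)" using l' by simp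
    also have "\<dots> = (l \<otimes> l') \<otimes> t [^] m x \<otimes> r (l \<otimes> x)"
      using l l' rinv[OF x, of l] L_subset_M rc[OF x] t_carrier by (simp add: m_assoc subsetD[OF L_subset_M])
    finally have "P (l \<otimes> x) (m x)" unfolding P_def using l l' by blast
    then show ?thesis using uniq[of "l \<otimes> x"] mP[of "l \<otimes> x"] x l by simp
  qed
  moreover have "m (t \<otimes> x) = m x + 1" if x: "x \<in> carrier G" for x
  proof -
    obtain l' where l': "l' \<in> L" "x = l' \<otimes> t [^] m x \<otimes> r x" using mP[OF x] unfolding P_def by blast
    have l'c: "l' \<in> carrier G" using l' by simp
    have "t \<otimes> x = t \<otimes> (l' \<otimes> t [^] m x \<otimes> r x)" using l' by simp
    also have "\<dots> = (t \<otimes> l' \<otimes> inv t) \<otimes> (t \<otimes> t [^] m x) \<otimes> r x"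
    proof -
      have "(t \<otimes> l' \<otimes> inv t) \<otimes> (t \<otimes> t [^] m x) = t \<otimes> l' \<otimes> t [^] m x"
        using t_carrier l'c by (simp add: m_assoc inv_mult_cancel_left)
      then show ?thesis using t_carrier l'c rc[OF x] by (simp add: m_assoc)
    qed
    also have "t \<otimes> t [^] m x = t [^] (m x + 1)" using t_carrier int_pow_mult[of t 1 "m x"] by (simp add: add.commute)
    also have "r x = r (t \<otimes> x)" using rinv[OF x t_in_M] by simp
    finally have "P (t \<otimes> x) (m x + 1)" unfolding P_def using l' t_normalises by (auto simp: normalises_def)
    then show ?thesis using uniq[of "t \<otimes> x"] mP[of "t \<otimes> x"] x t_carrier by simp
  qed
  ultimately show ?thesis by blast
qed

lemma normalises_pow: "normalises (t [^] (k::int)) L"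
proof -
  have nat: "normalises (t [^] (k::nat)) L" for k
  proof (induction k)
    case 0
    then show ?case using L_carrier by (auto simp: normalises_def)
  next
    case (Suc k)
    let ?s = "t [^] k"
    have s: "?s \<in> carrier G" using t_carrier by simp
    have "(?s \<otimes> t) \<otimes> l \<otimes> inv (?s \<otimes> t) = ?s \<otimes> (t \<otimes> l \<otimes> inv t) \<otimes> inv ?s"
      "inv (?s \<otimes> t) \<otimes> l \<otimes> (?s \<otimes> t) = inv t \<otimes> (inv ?s \<otimes> l \<otimes> ?s) \<otimes> t" if "l \<in> L" for l
      using s t_carrier that L_carrier by (simp_all add: m_assoc inv_mult_group subsetD)
    then show ?case using Suc t_normalises s t_carrier by (simp add: normalises_def)
  qed
  show ?thesis
  proof (cases k)
    case (nonneg n)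
    then show ?thesis using nat by (simp add: int_pow_int)
  next
    case (neg m)
    then show ?thesis using normalises_inv[OF nat[of "Suc m"]] t_carrier
      by (simp add: int_pow_neg int_pow_int del: nat_pow_Suc of_nat_Suc)
  qed
qed

text \<open>Along the orbits of \<open>t\<close>, \<open>t - 1\<close> is the difference operator, and is inverted by summation.\<close>

lemma delta_onto:
  assumes f: "f \<in> cochains L n"
  shows "\<exists>F\<in>cochains L n. delta t F = f"
proof -
  obtain m :: "'a \<Rightarrow> int" where m: "\<And>x l. x \<in> carrier G \<Longrightarrow> l \<in> L \<Longrightarrow> m (l \<otimes> x) = m x"
    "\<And>x. x \<in> carrier G \<Longrightarrow> m (t \<otimes> x) = m x + 1" using exists_height by metis
  define \<phi> where "\<phi> xs j = shift (t [^] j) f xs" for xs and j :: int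
  have C: "shift (t [^] j) f \<in> cochains L n" for j :: int
    by (rule shift_cochains_normalises[OF normalises_pow L_carrier f])
  define F where "F xs = integer_sum (\<phi> xs) (m (hd xs))" for xs
  have FC: "F \<in> cochains L n"
  proof (rule cochainsI)
    fix xs assume "F xs \<noteq> 0"
    moreover have "integer_sum (\<phi> xs) k = 0" if "\<forall>j. \<phi> xs j = 0" for k using that by (simp add: integer_sum_def)
    ultimately obtain j where "\<phi> xs j \<noteq> 0" unfolding F_def by blast
    then show "xs \<noteq> [] \<and> length xs = n \<and> set xs \<subseteq> carrier G" unfolding \<phi>_def using cochains_nonzero[OF C] by blast
  next
    fix l assume l: "l \<in> L"
    show "shift l F = F"
    proof
      fix xs
      show "shift l F xs = F xs"
      proof (cases "xs \<noteq> [] \<and> set xs \<subseteq> carrier G")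
        case True
        then have "\<phi> (map ((\<otimes>) l) xs) = \<phi> xs" unfolding \<phi>_def using cochains_invariant[OF C l] by blast
        moreover have "m (hd (map ((\<otimes>) l) xs)) = m (hd xs)" using True l m(1)[of "hd xs" l] by (cases xs) auto
        ultimately show ?thesis using True by (simp add: shift_def F_def)
      next
        case False
        have z: "\<phi> xs j = 0" for j unfolding \<phi>_def using cochains_support[OF C] False by blast
        show ?thesis
        proof (cases "xs = []")
          case True then show ?thesis by (simp add: shift_def)
        next
          case False
          with \<open>\<not> (xs \<noteq> [] \<and> set xs \<subseteq> carrier G)\<close> z show ?thesis by (auto simp: shift_def F_def integer_sum_def)
        qed
      qed
    qed
  qed
  have "delta t F xs = f xs" for xs
  proof (cases "xs \<noteq> [] \<and> set xs \<subseteq> carrier G")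
    case True
    have "\<phi> (map ((\<otimes>) t) xs) j = \<phi> xs (j + 1)" for j
    proof -
      have "\<phi> (map ((\<otimes>) t) xs) j = shift t (shift (t [^] j) f) xs" using True by (simp add: \<phi>_def shift_def[of t])
      also have "shift t (shift (t [^] j) f) = shift (t [^] (j + 1)) f"
        using t_carrier shift_shift[of t "t [^] j" f] int_pow_mult[of t j 1] by simp
      finally show ?thesis by (simp add: \<phi>_def)
    qed
    then have "\<phi> (map ((\<otimes>) t) xs) = (\<lambda>j. \<phi> xs (j + 1))" by blast
    moreover have "m (hd (map ((\<otimes>) t) xs)) = m (hd xs) + 1" using True m(2)[of "hd xs"] by (cases xs) auto
    ultimately have "shift t F xs = F xs + \<phi> xs 0"
      using True integer_sum_step[of "\<phi> xs" "m (hd xs)"] by (simp add: shift_def[of t] F_def)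
    then show ?thesis using shift_one[OF f] by (simp add: delta_def \<phi>_def)
  next
    case False
    then show ?thesis using cochains_support[OF f, of xs] cochains_support[OF delta_C[OF FC], of xs] by metis
  qed
  then show ?thesis using FC by (intro bexI[of _ F]) auto
qed

lemma coboundary_delta_onto:
  assumes b: "b \<in> coboundaries L n"
  obtains e where "e \<in> coboundaries L n" "delta t e = b"
proof (cases n)
  case 0
  then show ?thesis using b that[of 0] by (simp add: coboundaries_0 dl.zero)
next
  case (Suc m)
  then obtain c where c: "c \<in> cochains L m" "b = cobd c" using b by (auto simp: coboundaries_Suc)
  obtain y where y: "y \<in> cochains L m" "delta t y = c" using delta_onto[OF c(1)] by blast
  show ?thesis using that[of "cobd y"] y c Suc cobd_delta[OF t_carrier, of y] by (simp add: coboundaries_Suc)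
qed

text \<open>After finitely many applications of \<open>g - 1\<close> a class of \<open>M\<close> vanishes on \<open>L\<close>.  It then comes, through the
  connecting map of the Wang sequence, from a class \<open>delta t c\<close> of \<open>L\<close> in one degree less, and further
  applications kill that class as well.\<close>

lemma unipotent_on_M:
  assumes g: "normalises g L" "normalises g M" and comm: "g \<otimes> t \<otimes> inv g \<otimes> inv t \<in> L" and unip: "unipotent_on L g"
  shows "unipotent_on M g"
  unfolding unipotent_on_def
proof
  fix n
  have gc: "g \<in> carrier G" using g(1) by (rule normalises_carrier)
  show "\<exists>m. \<forall>z\<in>cocycles M n. (delta g ^^ m) z \<in> coboundaries M n"
  proof (cases n)
    case 0
    then show ?thesis by (intro exI[of _ 0]) (simp add: cocycles_0 coboundaries_0)
  next
    case (Suc n')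
    obtain m1 where m1: "\<forall>z\<in>cocycles L (Suc n'). (delta g ^^ m1) z \<in> coboundaries L (Suc n')" using unip unipotent_on_def by blast
    obtain m2 where m2: "\<forall>z\<in>cocycles L n'. (delta g ^^ m2) z \<in> coboundaries L n'" using unip unipotent_on_def by blast
    have "(delta g ^^ (m2 + m1)) z \<in> coboundaries M (Suc n')" if z: "z \<in> cocycles M (Suc n')" for z
    proof -
      obtain c where c: "c \<in> cochains L n'" "(delta g ^^ m1) z = cobd c"
        using m1 cocycles_M_L[OF z] by (auto simp: coboundaries_Suc)
      have "(delta g ^^ m1) z \<in> cochains M (Suc n')" by (rule delta_pow_cochains[OF g(2) M_carrier cocyclesD(1)[OF z]])
      then have "cobd (delta t c) = 0" using delta_M c cobd_delta[OF t_carrier] by metis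
      then have w: "delta t c \<in> cocycles L n'" using delta_C[OF c(1)] by (simp add: cocycles_def)
      then obtain e where e: "e \<in> coboundaries L n'" "delta t e = (delta g ^^ m2) (delta t c)"
        using m2 coboundary_delta_onto by metis
      define c' where "c' = (delta g ^^ m2) c"
      have "c' \<in> cochains L n'" unfolding c'_def by (rule delta_pow_cochains[OF g(1) L_carrier c(1)])
      moreover have "e \<in> cochains L n'" using sub_L[OF e(1)] by (rule cocyclesD)
      moreover have "delta t c' = delta t e" using delta_pow_commute[OF g(1) comm c(1)] e by (simp add: c'_def)
      ultimately have "c' - e \<in> cochains M n'" by (simp add: cochains_M_iff_delta cochains_diff dl.diff)
      moreover have "cobd (c' - e) = (delta g ^^ (m2 + m1)) z"
        using cocyclesD(2)[OF sub_L[OF e(1)]] cobd_delta_pow[OF gc] c by (simp add: cb.diff c'_def funpow_add)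
      ultimately show ?thesis unfolding coboundaries_Suc by (metis imageI)
    qed
    then show ?thesis using Suc by blast
  qed
qed

end

locale finite_cyclic_extension = cyclic_extension +
  fixes N :: nat
  assumes N_pos: "0 < N" and pow_in_L: "t [^] N \<in> L"
begin

definition average :: "('a list \<Rightarrow> rat) \<Rightarrow> 'a list \<Rightarrow> rat"
  where "average f = fscale (1 / rat_of_nat N) (\<Sum>i<N. shift (t [^] i) f)"

lemma shift_pow_Suc: "shift t (shift (t [^] i) f) = shift (t [^] Suc i) f" for i :: nat
  using t_carrier by (simp add: shift_shift)

lemma shift_pow_C: "f \<in> cochains L n \<Longrightarrow> shift (t [^] (i::nat)) f \<in> cochains L n"
proof (induction i)
  case (Suc i)
  then show ?case using shift_cochains_normalises[OF t_normalises L_carrier] by (simp only: shift_pow_Suc[symmetric])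
qed (simp add: shift_one)

lemma average_M: "f \<in> cochains L n \<Longrightarrow> average f \<in> cochains M n"
proof -
  assume f: "f \<in> cochains L n"
  have "(\<Sum>i<N. shift (t [^] i) f) \<in> cochains L n" by (intro fn.subspace_sum[OF subspace_cochains] shift_pow_C f)
  moreover have "shift t (\<Sum>i<N. shift (t [^] i) f) = (\<Sum>i<N. shift (t [^] i) f)"
  proof -
    have "shift t (\<Sum>i<N. shift (t [^] i) f) = (\<Sum>i<N. shift (t [^] Suc i) f)"
      by (simp only: sh.sum shift_pow_Suc)
    also have "\<dots> = (\<Sum>i<Suc N. shift (t [^] i) f) - shift (t [^] (0::nat)) f"
      by (subst sum.lessThan_Suc_shift) simp
    also have "\<dots> = (\<Sum>i<N. shift (t [^] i) f) + (shift (t [^] N) f - shift \<one> f)" by simp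
    also have "shift (t [^] N) f = f" using cochains_shift[OF f pow_in_L] .
    also have "shift \<one> f = f" by (rule shift_one[OF f])
    finally show ?thesis by simp
  qed
  ultimately show ?thesis unfolding average_def cochains_M_iff by (simp add: cochains_scale sh.scale)
qed

lemma average_id: "f \<in> cochains M n \<Longrightarrow> average f = f"
proof -
  assume f: "f \<in> cochains M n"
  then have "shift (t [^] i) f = f" for i :: nat using shift_nat_pow_fixed[OF f] cochains_M_iff f by blast
  then have "average f = fscale (1 / rat_of_nat N) (\<Sum>i<N. f)" by (simp add: average_def)
  also have "(\<Sum>i<N. f) = fscale (rat_of_nat N) f" by (rule sum_constant_fscale)
  finally show ?thesis using N_pos by simp
qed

lemma cobd_average: "cobd (average f) = average (cobd f)"
  using t_carrier by (simp add: average_def cb.scale cb.sum cobd_shift)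

lemma unipotent_on_M:
  assumes g: "normalises g M" and unip: "unipotent_on L g"
  shows "unipotent_on M g"
  unfolding unipotent_on_def
proof
  fix n
  show "\<exists>m. \<forall>z\<in>cocycles M n. (delta g ^^ m) z \<in> coboundaries M n"
  proof (cases n)
    case 0
    then show ?thesis by (intro exI[of _ 0]) (simp add: cocycles_0 coboundaries_0)
  next
    case (Suc n')
    obtain m where m: "\<forall>z\<in>cocycles L (Suc n'). (delta g ^^ m) z \<in> coboundaries L (Suc n')" using unip unipotent_on_def by blast
    have "(delta g ^^ m) z \<in> coboundaries M (Suc n')" if z: "z \<in> cocycles M (Suc n')" for z
    proof -
      obtain c where c: "c \<in> cochains L n'" "(delta g ^^ m) z = cobd c"
        using m cocycles_M_L[OF z] by (auto simp: coboundaries_Suc)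
      have "(delta g ^^ m) z \<in> cochains M (Suc n')" by (rule delta_pow_cochains[OF g M_carrier cocyclesD(1)[OF z]])
      then have "cobd (average c) = (delta g ^^ m) z" using c by (simp add: cobd_average average_id)
      then show ?thesis unfolding coboundaries_Suc using average_M[OF c(1)] by (metis imageI)
    qed
    then show ?thesis using Suc by blast
  qed
qed

lemma coboundaries_restrict:
  assumes "z \<in> cocycles M n" "z \<in> coboundaries L n"
  shows "z \<in> coboundaries M n"
proof (cases n)
  case 0
  then show ?thesis using assms by (simp add: coboundaries_0)
next
  case (Suc m)
  then obtain c where c: "c \<in> cochains L m" "z = cobd c" using assms by (auto simp: coboundaries_Suc)
  have "cobd (average c) = z" using c average_id[OF cocyclesD(1)[OF assms(1)]] by (simp add: cobd_average)
  then show ?thesis unfolding Suc coboundaries_Suc using average_M[OF c(1)] by (metis imageI)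
qed

text \<open>An operator that is unipotent and of finite order is the identity.\<close>

lemma acts_trivially:
  assumes unip: "unipotent_on L t" and z: "z \<in> cocycles L n"
  shows "delta t z \<in> coboundaries L n"
proof -
  have step: "delta t w \<in> coboundaries L n" if w: "w \<in> cocycles L n" and dd: "delta t (delta t w) \<in> coboundaries L n" for w
  proof -
    \<comment> \<open>\<open>t\<^sup>i w = w + i u\<close> in cohomology, and for \<open>i = N\<close> the left-hand side is \<open>w\<close>\<close>
    define u where "u = delta t w"
    have *: "shift (t [^] i) w - w - fscale (rat_of_nat i) u \<in> coboundaries L n" for i :: nat
    proof (induction i)
      case 0
      have "shift (t [^] (0::nat)) w - w - fscale (rat_of_nat 0) u = 0"
        using shift_one[OF cocyclesD(1)[OF w]] by (simp add: fscale_def fun_eq_iff)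
      then show ?case using fn.subspace_0[OF subspace_coboundaries] by (simp only:)
    next
      case (Suc i)
      define b where "b = shift (t [^] i) w - w - fscale (rat_of_nat i) u"
      have "shift (t [^] i) w = w + fscale (rat_of_nat i) u + b" by (simp add: b_def)
      then have "shift (t [^] Suc i) w = shift t w + fscale (rat_of_nat i) (shift t u) + shift t b"
        by (simp only: shift_pow_Suc[symmetric] sh.add sh.scale)
      moreover have "shift t w = w + u" "shift t u = u + delta t u" by (simp_all add: u_def delta_def)
      ultimately have "shift (t [^] Suc i) w - w - fscale (rat_of_nat (Suc i)) u = fscale (rat_of_nat i) (delta t u) + shift t b"
        by (simp add: fn.scale_right_distrib fn.scale_left_distrib algebra_simps)
      moreover have "fscale (rat_of_nat i) (delta t u) + shift t b \<in> coboundaries L n"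
      proof -
        have "b \<in> coboundaries L n" using Suc unfolding b_def .
        then show ?thesis using dd unfolding u_def
          by (intro coboundaries_add coboundaries_scale shift_coboundaries[OF t_normalises L_carrier])
      qed
      ultimately show ?case by (simp only:)
    qed
    have "shift (t [^] N) w = w" using cochains_shift[OF cocyclesD(1)[OF w] pow_in_L] .
    then have "- fscale (rat_of_nat N) u \<in> coboundaries L n" using *[of N] by simp
    then have "fscale (- inverse (rat_of_nat N)) (- fscale (rat_of_nat N) u) \<in> coboundaries L n" by (rule coboundaries_scale)
    then show ?thesis using N_pos by (simp add: u_def)
  qed
  have "(delta t ^^ Suc m) w \<in> coboundaries L n \<Longrightarrow> w \<in> cocycles L n \<Longrightarrow> delta t w \<in> coboundaries L n" for m w
  proof (induction m arbitrary: w)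
    case (Suc m)
    have "(delta t ^^ Suc m) (delta t w) \<in> coboundaries L n" using Suc.prems(1) by (simp only: funpow_Suc_right o_apply)
    then have "delta t (delta t w) \<in> coboundaries L n" using Suc.IH delta_Z[OF Suc.prems(2)] by blast
    then show ?case using step Suc.prems(2) by blast
  qed simp
  moreover obtain m where "(delta t ^^ m) z \<in> coboundaries L n" using unip z unipotent_on_def by blast
  then have "(delta t ^^ Suc m) z \<in> coboundaries L n" using delta_B by simp
  ultimately show ?thesis using z by blast
qed

lemma restriction_onto:
  assumes unip: "unipotent_on L t" and z: "z \<in> cocycles L n"
  shows "average z \<in> cocycles M n" "z - average z \<in> coboundaries L n"
proof -
  show "average z \<in> cocycles M n"
    using average_M[OF cocyclesD(1)[OF z]] cobd_average[of z] cocyclesD(2)[OF z] by (simp add: cocycles_def average_def sh.zero)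
  have "z - shift (t [^] i) z \<in> coboundaries L n" for i :: nat
  proof (induction i)
    case 0
    have "z - shift (t [^] (0::nat)) z = 0" using shift_one[OF cocyclesD(1)[OF z]] by (simp add: fun_eq_iff)
    then show ?case using fn.subspace_0[OF subspace_coboundaries] by (simp only:)
  next
    case (Suc i)
    have "shift t (z - shift (t [^] i) z) - delta t z \<in> coboundaries L n"
      by (rule coboundaries_diff[OF shift_coboundaries[OF t_normalises L_carrier Suc] acts_trivially[OF unip z]])
    moreover have "shift t (z - shift (t [^] i) z) - delta t z = z - shift (t [^] Suc i) z"
      by (simp only: sh.diff shift_pow_Suc delta_def) simp
    ultimately show ?case by (simp only:)
  qed
  then have "fscale (1 / rat_of_nat N) (\<Sum>i<N. z - shift (t [^] i) z) \<in> coboundaries L n"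
    by (intro coboundaries_scale fn.subspace_sum[OF subspace_coboundaries])
  moreover have "fscale (1 / rat_of_nat N) (\<Sum>i<N. z - shift (t [^] i) z) = z - average z"
  proof -
    have "(\<Sum>i<N. z) = fscale (rat_of_nat N) z" by (rule sum_constant_fscale)
    then show ?thesis using N_pos by (simp add: sum_subtractf average_def fn.scale_right_diff_distrib)
  qed
  ultimately show "z - average z \<in> coboundaries L n" by simp
qed

end

section \<open>Poincare duality\<close>

context group_cochains
begin

definition nondegenerate :: "'a set \<Rightarrow> nat \<Rightarrow> bool"
  where "nondegenerate K h \<longleftrightarrow> (\<forall>p q. p + q = h \<longrightarrow> (\<forall>a\<in>cocycles K (Suc p).
    (\<forall>b\<in>cocycles K (Suc q). cup (Suc p) a b \<in> coboundaries K (Suc h)) \<longrightarrow> a \<in> coboundaries K (Suc p)))"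

lemma nondegenerateD:
  assumes "nondegenerate K h" "p + q = h" "a \<in> cocycles K (Suc p)"
    "\<And>b. b \<in> cocycles K (Suc q) \<Longrightarrow> cup (Suc p) a b \<in> coboundaries K (Suc h)"
  shows "a \<in> coboundaries K (Suc p)"
  using assms unfolding nondegenerate_def by blast

text \<open>Reversal maps the statement to the one about left annihilators.\<close>

lemma nondegenerate_right:
  assumes nd: "nondegenerate K h" and K: "K \<subseteq> carrier G" and pq: "p + q = h" and b: "b \<in> cocycles K (Suc q)"
    and 0: "\<And>a. a \<in> cocycles K (Suc p) \<Longrightarrow> cup (Suc p) a b \<in> coboundaries K (Suc h)"
  shows "b \<in> coboundaries K (Suc q)"
proof -
  have "reversal b \<in> coboundaries K (Suc q)"
  proof (rule nondegenerateD[OF nd])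
    show "q + p = h" using pq by simp
    show "reversal b \<in> cocycles K (Suc q)" by (rule reversal_cocycles[OF b K])
    fix a assume a: "a \<in> cocycles K (Suc p)"
    have "reversal (cup (Suc p) (reversal a) b) = cup (Suc q) (reversal b) (reversal (reversal a))"
      by (rule reversal_cup[OF cocyclesD(1)[OF reversal_cocycles[OF a K]] cocyclesD(1)[OF b] K])
    moreover have "reversal (cup (Suc p) (reversal a) b) \<in> coboundaries K (Suc h)"
      by (rule reversal_coboundaries[OF 0[OF reversal_cocycles[OF a K]] K])
    ultimately show "cup (Suc q) (reversal b) a \<in> coboundaries K (Suc h)" by simp
  qed
  then show ?thesis using reversal_coboundaries[OF _ K] by fastforce
qed

text \<open>Rational Poincare duality in dimension \<open>h\<close>; the index \<open>Suc n\<close> belongs to degree \<open>n\<close>.  The nonvanishing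
  and the parity of the middle dimension are carried along because the fifth infinite step uses both.\<close>

definition duality :: "'a set \<Rightarrow> nat \<Rightarrow> bool"
  where "duality K h \<longleftrightarrow>
    (\<forall>n. H_finite K n) \<and>
    (\<forall>n>h. cocycles K (Suc n) \<subseteq> coboundaries K (Suc n)) \<and>
    (\<forall>n\<le>h. \<not> cocycles K (Suc n) \<subseteq> coboundaries K (Suc n)) \<and>
    H_dim K (Suc h) = 1 \<and>
    nondegenerate K h \<and>
    (\<forall>k>0. h = 2 * k \<longrightarrow> even (H_dim K (Suc k)))"

lemma
  assumes "duality K h"
  shows duality_finite: "H_finite K n"
    and duality_vanish: "n > h \<Longrightarrow> cocycles K (Suc n) \<subseteq> coboundaries K (Suc n)"
    and duality_nonzero: "n \<le> h \<Longrightarrow> \<not> cocycles K (Suc n) \<subseteq> coboundaries K (Suc n)"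
    and duality_top: "H_dim K (Suc h) = 1"
    and duality_nondegenerate: "nondegenerate K h"
    and duality_even: "k > 0 \<Longrightarrow> h = 2 * k \<Longrightarrow> even (H_dim K (Suc k))"
  using assms unfolding duality_def by blast+

lemma top_functional:
  assumes "duality K h" "K \<subseteq> carrier G"
  obtains \<omega> where "Vector_Spaces.linear fscale (*) \<omega>"
    "\<forall>z\<in>cocycles K (Suc h). \<omega> z = 0 \<longleftrightarrow> z \<in> coboundaries K (Suc h)"
  by (rule fn.qdim_1_functional[OF subspace_coboundaries subspace_cocycles coboundaries_subset[OF assms(2)]
      duality_finite[OF assms(1)] duality_top[OF assms(1)]])

lemma bilinear_cup:
  assumes "Vector_Spaces.linear fscale (*) \<omega>"
  shows "fn.bilinear_form (\<lambda>a b. \<omega> (cup p a b))"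
proof -
  interpret w: Vector_Spaces.linear fscale "(*)" \<omega> by fact
  show ?thesis unfolding fn.bilinear_form_def
    by (intro conjI allI linear_functionalI)
       (simp_all add: cup_add_left cup_add_right cup_scale_left cup_scale_right w.add w.scale)
qed

lemma duality_trivial_group: "duality {\<one>} 0"
proof -
  have K: "{\<one>} \<subseteq> carrier G" by simp
  have "nondegenerate {\<one>} 0"
    unfolding nondegenerate_def
  proof (intro allI impI ballI)
    fix p q a assume pq: "p + q = 0" and a: "a \<in> cocycles {\<one>} (Suc p)"
      and 0: "\<forall>b\<in>cocycles {\<one>} (Suc q). cup (Suc p) a b \<in> coboundaries {\<one>} (Suc 0)"
    have [simp]: "p = 0" "q = 0" using pq by auto
    have a1: "a \<in> cocycles {\<one>} 1" using a by simp
    have "cup 1 a unit_cocycle = 0" using 0 unit_cocycle[OF K] by (simp add: coboundaries_1)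
    then have "cup 1 a unit_cocycle [\<one>] = 0" by simp
    then have "a [\<one>] = 0" by (simp add: cup_def unit_cocycle_def)
    then have "a = 0" using cocycles_1_eq[OF a1] by simp
    then show "a \<in> coboundaries {\<one>} (Suc p)" by (simp add: coboundaries_1)
  qed
  moreover have fin: "H_finite {\<one>} n" for n
  proof (cases n)
    case 0
    then show ?thesis by (simp add: coboundaries_0 cocycles_0 fn.qfin_self)
  next
    case (Suc m)
    then show ?thesis
      using qdim_degree_0(1)[OF K] cocycles_trivial_group[of m] by (cases "m = 0") (auto simp: fn.qfin_self)
  qed
  moreover have "\<not> cocycles {\<one>} (Suc 0) \<subseteq> coboundaries {\<one>} (Suc 0)"
    using fn.qdim_eq_0_iff[OF subspace_coboundaries qdim_degree_0(1)[OF K]] qdim_degree_0(2)[OF K] by simp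
  ultimately show ?thesis
    using cocycles_trivial_group qdim_degree_0(2)[OF K] by (simp add: duality_def)
qed

end

context infinite_cyclic_extension
begin

definition delta_image :: "nat \<Rightarrow> ('a list \<Rightarrow> rat) set"
  where "delta_image n = {delta t x + b | x b. x \<in> cocycles L n \<and> b \<in> coboundaries L n}"

definition delta_kernel :: "nat \<Rightarrow> ('a list \<Rightarrow> rat) set"
  where "delta_kernel n = {z \<in> cocycles L n. delta t z \<in> coboundaries L n}"

lemma subspace_delta_image: "fn.subspace (delta_image n)"
  unfolding delta_image_def
  using fn.subspace_sums[OF dl.subspace_image[OF subspace_cocycles] subspace_coboundaries, of t L n L n]
  by (rule back_subst[of fn.subspace]) blast

lemma coboundaries_delta_image: "coboundaries L n \<subseteq> delta_image n"
  unfolding delta_image_def using fn.subspace_0[OF subspace_cocycles, of L n] dl.zero[of t] by force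

lemma delta_image_subset: "delta_image n \<subseteq> cocycles L n"
  unfolding delta_image_def using delta_Z sub_L cocycles_add by blast

lemma delta_in_delta_image: "x \<in> cocycles L n \<Longrightarrow> delta t x \<in> delta_image n"
  unfolding delta_image_def using fn.subspace_0[OF subspace_coboundaries, of L n]
  by (metis (mono_tags, lifting) add.right_neutral mem_Collect_eq)

text \<open>The cocycles \<open>I\<close> of \<open>M\<close> that bound on \<open>L\<close> form the kernel of restriction.  Restriction maps onto the
  classes of \<open>L\<close> fixed by \<open>t\<close>, since \<open>t - 1\<close> is onto on coboundaries.  The cochains \<open>P\<close> link the kernel with
  degree \<open>n - 1\<close>: \<open>cobd\<close> maps them onto \<open>I\<close> and \<open>t - 1\<close> maps them onto the cocycles of \<open>L\<close>, with the same
  subspace \<open>R\<close> becoming trivial on both sides.\<close>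

lemma wang:
  assumes fin: "\<And>n. H_finite L n"
  shows "H_finite M (Suc n)"
    and "H_dim M (Suc n) =
      fn.qdim (coboundaries L (Suc n)) (delta_kernel (Suc n)) + fn.qdim (delta_image n) (cocycles L n)"
proof -
  define I where "I = cocycles M (Suc n) \<inter> coboundaries L (Suc n)"
  define P where "P = {c \<in> cochains L n. delta t c \<in> cocycles L n}"
  define R where "R = {x + y | x y. x \<in> cocycles L n \<and> y \<in> cochains M n}"
  have I: "fn.subspace I" unfolding I_def by (rule fn.subspace_inter[OF subspace_cocycles subspace_coboundaries])
  have P: "fn.subspace P" using subspace_cochains[of L n] subspace_cocycles[of L n]
    by (auto simp: P_def fn.subspace_def dl.add dl.scale dl.zero)
  have R: "fn.subspace R" unfolding R_def by (rule fn.subspace_sums[OF subspace_cocycles subspace_cochains])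
  have BI: "coboundaries M (Suc n) \<subseteq> I" unfolding I_def using sub_M coboundaries_M_L by blast
  have BK: "coboundaries L (Suc n) \<subseteq> delta_kernel (Suc n)"
    unfolding delta_kernel_def using sub_L delta_B by blast
  have IZ: "I \<subseteq> cocycles M (Suc n)" unfolding I_def by blast
  have finK: "fn.qfin (coboundaries L (Suc n)) (delta_kernel (Suc n))"
    by (rule fn.qfin_subset[OF fin]) (auto simp: delta_kernel_def)
  have 1: "fn.qfin I (cocycles M (Suc n)) \<and>
    fn.qdim I (cocycles M (Suc n)) = fn.qdim (coboundaries L (Suc n)) (delta_kernel (Suc n))"
  proof -
    have onto: "\<exists>z\<in>cocycles M (Suc n). y - id z \<in> coboundaries L (Suc n)" if y: "y \<in> delta_kernel (Suc n)" for y
    proof -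
      obtain e where e: "e \<in> coboundaries L (Suc n)" "delta t e = delta t y"
        using y coboundary_delta_onto unfolding delta_kernel_def by blast
      have "y - e \<in> cocycles M (Suc n)"
        using y e sub_L[OF e(1)] by (simp add: cocycles_M_iff_delta delta_kernel_def cocycles_diff dl.diff)
      then show ?thesis using e by (intro bexI[of _ "y - e"]) auto
    qed
    have into: "id z \<in> delta_kernel (Suc n)" if "z \<in> cocycles M (Suc n)" for z
      using that fn.subspace_0[OF subspace_coboundaries] by (simp add: delta_kernel_def cocycles_M_iff_delta)
    have ker: "id z \<in> coboundaries L (Suc n) \<longleftrightarrow> z \<in> I" if "z \<in> cocycles M (Suc n)" for z
      using that by (simp add: I_def)
    note iso = fn.quotient_iso[OF I subspace_cocycles subspace_coboundaries IZ fn.linear_id into onto ker]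
    show ?thesis using iso finK by blast
  qed
  have cobdP: "cobd c \<in> I" if "c \<in> P" for c
    using that cobd_cochains[OF _ L_carrier, of c n] cobd_delta[OF t_carrier, of c]
    by (auto simp: I_def P_def cochains_M_iff_delta cocycles_def cobd_cobd coboundaries_Suc)
  have RP: "R \<subseteq> P"
    unfolding R_def P_def using cochains_add cocyclesD(1) cochains_M_L delta_Z delta_M by (auto simp: dl.add)
  have 2: "fn.qfin R P \<and> fn.qdim R P = fn.qdim (delta_image n) (cocycles L n)"
  proof -
    have into: "delta t c \<in> cocycles L n" if "c \<in> P" for c using that by (simp add: P_def)
    have onto: "\<exists>z\<in>P. y - delta t z \<in> delta_image n" if y: "y \<in> cocycles L n" for y
    proof -
      obtain c where "c \<in> cochains L n" "delta t c = y" using delta_onto[OF cocyclesD(1)[OF y]] by blast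
      then show ?thesis using y fn.subspace_0[OF subspace_delta_image] by (intro bexI[of _ c]) (auto simp: P_def)
    qed
    have ker: "delta t c \<in> delta_image n \<longleftrightarrow> c \<in> R" if c: "c \<in> P" for c
    proof
      assume "delta t c \<in> delta_image n"
      then obtain x b where xb: "delta t c = delta t x + b" "x \<in> cocycles L n" "b \<in> coboundaries L n"
        unfolding delta_image_def by blast
      then obtain e where e: "e \<in> coboundaries L n" "delta t e = b" using coboundary_delta_onto by blast
      have "c - (x + e) \<in> cochains M n" using c xb e sub_L[OF e(1)]
        by (auto simp: cochains_M_iff_delta P_def dl.diff dl.add intro!: cochains_diff cochains_add dest: cocyclesD(1))
      moreover have "x + e \<in> cocycles L n" using xb sub_L[OF e(1)] by (intro cocycles_add)
      moreover have "c = (x + e) + (c - (x + e))" by simp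
      ultimately show "c \<in> R" unfolding R_def by blast
    next
      assume "c \<in> R"
      then obtain x y where "c = x + y" "x \<in> cocycles L n" "y \<in> cochains M n" unfolding R_def by blast
      then have "delta t c = delta t x + 0" by (simp add: dl.add delta_M)
      then show "delta t c \<in> delta_image n"
        unfolding delta_image_def using \<open>x \<in> cocycles L n\<close> fn.subspace_0[OF subspace_coboundaries] by blast
    qed
    note iso = fn.quotient_iso[OF R P subspace_delta_image RP linear_delta[of t] into onto ker]
    show ?thesis using iso fn.qfin_mono_denominator[OF fin coboundaries_delta_image] by blast
  qed
  have 3: "fn.qfin (coboundaries M (Suc n)) I \<and> fn.qdim R P = fn.qdim (coboundaries M (Suc n)) I"
  proof -
    have onto: "\<exists>z\<in>P. y - cobd z \<in> coboundaries M (Suc n)" if y: "y \<in> I" for y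
    proof -
      obtain c where c: "c \<in> cochains L n" "y = cobd c" using y by (auto simp: I_def coboundaries_Suc)
      then have "cobd (delta t c) = 0" using y cobd_delta[OF t_carrier, of c] by (simp add: I_def cocycles_M_iff_delta)
      then have "c \<in> P" using c delta_C by (simp add: P_def cocycles_def)
      then show ?thesis using c fn.subspace_0[OF subspace_coboundaries] by (intro bexI[of _ c]) auto
    qed
    have ker: "cobd c \<in> coboundaries M (Suc n) \<longleftrightarrow> c \<in> R" if c: "c \<in> P" for c
    proof
      assume "cobd c \<in> coboundaries M (Suc n)"
      then obtain v where v: "v \<in> cochains M n" "cobd c = cobd v" by (auto simp: coboundaries_Suc)
      have "c - v \<in> cocycles L n" using c v cochains_M_L[OF v(1)] by (auto simp: cocycles_def cb.diff P_def intro!: cochains_diff)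
      moreover have "c = (c - v) + v" by simp
      ultimately show "c \<in> R" unfolding R_def using v by blast
    next
      assume "c \<in> R"
      then obtain x y where "c = x + y" "x \<in> cocycles L n" "y \<in> cochains M n" unfolding R_def by blast
      then show "cobd c \<in> coboundaries M (Suc n)" by (simp add: cb.add cocyclesD(2) coboundaries_Suc)
    qed
    note iso = fn.quotient_iso[OF R P subspace_coboundaries RP linear_cobd cobdP onto ker]
    show ?thesis using iso 2 by blast
  qed
  show fin': "H_finite M (Suc n)"
    using fn.qfin_trans[of _ I] 1 3 by blast
  show "H_dim M (Suc n) =
      fn.qdim (coboundaries L (Suc n)) (delta_kernel (Suc n)) + fn.qdim (delta_image n) (cocycles L n)"
    using fn.qdim_add[OF subspace_coboundaries I subspace_cocycles BI IZ fin'] 1 2 3 by simp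
qed

lemma delta_nilpotent_onto:
  assumes unip: "unipotent_on L t" and onto: "cocycles L n \<subseteq> delta_image n"
  shows "cocycles L n \<subseteq> coboundaries L n"
proof -
  obtain m where m: "\<forall>z\<in>cocycles L n. (delta t ^^ m) z \<in> coboundaries L n" using unip unipotent_on_def by blast
  show ?thesis
  proof (rule fn.nilpotent_onto[OF linear_delta[of t] subspace_coboundaries delta_Z delta_B])
    show "(delta t ^^ m) z \<in> coboundaries L n" if "z \<in> cocycles L n" for z using m that by blast
    show "\<exists>u\<in>cocycles L n. z - delta t u \<in> coboundaries L n" if z: "z \<in> cocycles L n" for z
    proof -
      obtain x b where "z = delta t x + b" "x \<in> cocycles L n" "b \<in> coboundaries L n"
        using z onto unfolding delta_image_def by blast
      then show ?thesis by (intro bexI[of _ x]) auto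
    qed
  qed
qed

text \<open>A unipotent operator on a line is the identity: otherwise \<open>t - 1\<close> would be onto.\<close>

lemma top_trivial:
  assumes D: "duality L h" and unip: "unipotent_on L t" and z: "z \<in> cocycles L (Suc h)"
  shows "delta t z \<in> coboundaries L (Suc h)"
proof (rule ccontr)
  assume nz: "delta t z \<notin> coboundaries L (Suc h)"
  obtain \<omega> where w: "Vector_Spaces.linear fscale (*) \<omega>"
    "\<forall>z\<in>cocycles L (Suc h). \<omega> z = 0 \<longleftrightarrow> z \<in> coboundaries L (Suc h)"
    by (rule top_functional[OF D L_carrier])
  interpret w: Vector_Spaces.linear fscale "(*)" \<omega> by fact
  have "cocycles L (Suc h) \<subseteq> delta_image (Suc h)"
  proof
    fix y assume y: "y \<in> cocycles L (Suc h)"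
    let ?x = "fscale (\<omega> y / \<omega> (delta t z)) z"
    have nz': "\<omega> (delta t z) \<noteq> 0" using nz w(2) delta_Z[OF z] by blast
    have x: "?x \<in> cocycles L (Suc h)" by (rule cocycles_scale[OF z])
    have "y - delta t ?x \<in> cocycles L (Suc h)" by (intro cocycles_diff y delta_Z x)
    moreover have "\<omega> (y - delta t ?x) = 0" using nz' by (simp add: w.diff dl.scale w.scale)
    ultimately have "y - delta t ?x \<in> coboundaries L (Suc h)" using w(2) by blast
    moreover have "y = delta t ?x + (y - delta t ?x)" by simp
    ultimately show "y \<in> delta_image (Suc h)" unfolding delta_image_def using x by blast
  qed
  then have "cocycles L (Suc h) \<subseteq> coboundaries L (Suc h)" by (rule delta_nilpotent_onto[OF unip])
  then show False using duality_nonzero[OF D order_refl] by blast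
qed

text \<open>The classes of \<open>M\<close> vanishing on \<open>L\<close> are the images of classes \<open>w\<close> of \<open>L\<close> under the connecting map, and the
  product of \<open>a\<close> with such an image is, up to sign, the image of \<open>cup (Suc p) a w\<close>.  The connecting map is
  injective in top degree because \<open>t\<close> acts trivially there; so \<open>a\<close> annihilates the cohomology of \<open>L\<close>, and duality for \<open>L\<close> applies.\<close>

lemma annihilator_restricts_to_zero:
  assumes D: "duality L h" and unip: "unipotent_on L t" and pq: "p + q = Suc h" and a: "a \<in> cocycles M (Suc p)"
    and ann: "\<And>b. b \<in> cocycles M (Suc q) \<Longrightarrow> b \<in> coboundaries L (Suc q) \<Longrightarrow> cup (Suc p) a b \<in> coboundaries M (Suc (Suc h))"
  shows "a \<in> coboundaries L (Suc p)"
proof (cases q)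
  case 0
  then show ?thesis using duality_vanish[OF D, of p] pq cocycles_M_L[OF a] by auto
next
  case (Suc q')
  note aL = cocycles_M_L[OF a]
  show ?thesis
  proof (rule nondegenerateD[OF duality_nondegenerate[OF D] _ aL])
    show "p + q' = h" using pq Suc by simp
    fix w assume w: "w \<in> cocycles L (Suc q')"
    obtain y where y: "y \<in> cochains L (Suc q')" "delta t y = w" using delta_onto[OF cocyclesD(1)[OF w]] by blast
    have "cobd y \<in> cocycles M (Suc q)"
      using y cobd_cochains[OF y(1) L_carrier] cobd_delta[OF t_carrier, of y] cocyclesD(2)[OF w] Suc
      by (simp add: cocycles_def cochains_M_iff_delta cobd_cobd)
    moreover have "cobd y \<in> coboundaries L (Suc q)" using y Suc by (simp add: coboundaries_Suc)
    ultimately obtain v where v: "v \<in> cochains M (Suc h)" "cup (Suc p) a (cobd y) = cobd v"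
      using ann by (auto simp: coboundaries_Suc)
    let ?s = "(-1 :: rat) ^ p"
    let ?u = "fscale ?s (cup (Suc p) a y) - v"
    have C: "cup (Suc p) a y \<in> cochains L (Suc h)"
      using cup_cochains[OF cocyclesD(1)[OF aL] y(1) L_carrier] pq Suc by simp
    have "cobd (cup (Suc p) a y) = fscale ?s (cup (Suc p) a (cobd y))"
      using cobd_cup[OF cocyclesD(1)[OF aL] y(1)] cocyclesD(2)[OF aL] by simp
    then have "cobd ?u = fscale (?s * ?s) (cup (Suc p) a (cobd y)) - cobd v" by (simp add: cb.diff cb.scale)
    also have "\<dots> = 0" using v minus_one_power_cases[of p] by auto
    finally have "?u \<in> cocycles L (Suc h)"
      using cochains_diff[OF cochains_scale[OF C] cochains_M_L[OF v(1)]] by (simp add: cocycles_def)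
    then have "delta t ?u \<in> coboundaries L (Suc h)" by (rule top_trivial[OF D unip])
    moreover have "delta t ?u = fscale ?s (cup (Suc p) a w)"
      using delta_cup_right[OF t_carrier, of a "Suc p" y] a y delta_M[OF v(1)]
      by (simp add: dl.diff dl.scale cocycles_def cochains_M_iff)
    ultimately have "fscale ?s (fscale ?s (cup (Suc p) a w)) \<in> coboundaries L (Suc h)" by (metis coboundaries_scale)
    then show "cup (Suc p) a w \<in> coboundaries L (Suc h)" using minus_one_power_cases[of p] by auto
  qed
qed

text \<open>By the previous lemma an annihilating class \<open>a\<close> vanishes on \<open>L\<close>, so it is the image of a class \<open>w0\<close> of \<open>L\<close>
  under the connecting map, and \<open>w0\<close> annihilates all classes of \<open>L\<close> fixed by \<open>t\<close>.  As \<open>t\<close> preserves the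
  pairing, the annihilator of these is the image of \<open>t - 1\<close>, and the connecting map kills that image.\<close>

lemma nondegenerate_M:
  assumes D: "duality L h" and unip: "unipotent_on L t"
  shows "nondegenerate M (Suc h)"
  unfolding nondegenerate_def
proof (intro allI impI ballI)
  fix p q a assume pq: "p + q = Suc h" and a: "a \<in> cocycles M (Suc p)"
    and ann: "\<forall>b\<in>cocycles M (Suc q). cup (Suc p) a b \<in> coboundaries M (Suc (Suc h))"
  have "a \<in> coboundaries L (Suc p)" by (rule annihilator_restricts_to_zero[OF D unip pq a]) (use ann in blast)
  then obtain c where c: "c \<in> cochains L p" "a = cobd c" by (auto simp: coboundaries_Suc)
  show "a \<in> coboundaries M (Suc p)"
  proof (cases p)
    case 0
    then have "a = 0" using c by (simp add: cochains_0 cb.zero)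
    then show ?thesis using fn.subspace_0[OF subspace_coboundaries] by simp
  next
    case (Suc p')
    have p'q: "p' + q = h" using pq Suc by simp
    define w0 where "w0 = delta t c"
    have "cobd w0 = 0" using cobd_delta[OF t_carrier, of c] c a by (simp add: w0_def cocycles_M_iff_delta)
    then have w0: "w0 \<in> cocycles L (Suc p')" using delta_C[OF c(1)] Suc by (simp add: cocycles_def w0_def)
    have orth: "cup (Suc p') w0 b \<in> coboundaries L (Suc h)"
      if b: "b \<in> cocycles L (Suc q)" and db: "delta t b \<in> coboundaries L (Suc q)" for b
    proof -
      obtain e where e: "e \<in> coboundaries L (Suc q)" "delta t e = delta t b" using coboundary_delta_onto[OF db] by blast
      define b' where "b' = b - e"
      have b': "b' \<in> cocycles M (Suc q)" using b sub_L[OF e(1)] e(2)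
        by (simp add: b'_def cocycles_M_iff_delta cocycles_diff dl.diff)
      note b'L = cocycles_M_L[OF b']
      have 1: "cup (Suc p') w0 e \<in> coboundaries L (Suc h)"
        using cup_coboundary_right[OF w0 e(1) L_carrier] p'q by simp
      obtain v where v: "v \<in> cochains M (Suc h)" "cup (Suc p) a b' = cobd v"
        using ann b' by (auto simp: coboundaries_Suc)
      have C: "cup (Suc p') c b' \<in> cochains L (Suc h)"
        using cup_cochains[OF _ cocyclesD(1)[OF b'L] L_carrier, of c "Suc p'"] c Suc p'q by simp
      have "cobd (cup (Suc p') c b') = cup (Suc p) a b'"
        using cobd_cup[of c L p' b' q] c Suc cocyclesD[OF b'L] by simp
      then have "cup (Suc p') c b' - v \<in> cocycles L (Suc h)"
        using v cochains_M_L[OF v(1)] C by (simp add: cocycles_def cochains_diff cb.diff)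
      then have "delta t (cup (Suc p') c b' - v) \<in> coboundaries L (Suc h)" by (rule top_trivial[OF D unip])
      moreover have "delta t (cup (Suc p') c b' - v) = cup (Suc p') w0 b'"
        using delta_cup_left[OF t_carrier, of b' "Suc p'" c] b' delta_M[OF v(1)]
        by (simp add: dl.diff w0_def cocycles_def cochains_M_iff)
      ultimately have "cup (Suc p') w0 b' + cup (Suc p') w0 e \<in> coboundaries L (Suc h)"
        using 1 by (metis coboundaries_add)
      then show ?thesis by (simp add: b'_def flip: cup_add_right)
    qed
    \<comment> \<open>a functional that vanishes on the image of \<open>t - 1\<close> is pairing with a fixed class \<open>y\<close>\<close>
    have "w0 \<in> delta_image (Suc p')"
    proof (rule ccontr)
      assume "w0 \<notin> delta_image (Suc p')"
      then obtain \<theta> where lam: "Vector_Spaces.linear fscale (*) \<theta>" "\<forall>b\<in>delta_image (Suc p'). \<theta> b = 0" "\<theta> w0 = 1"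
        by (rule fn.exists_functional_separating[OF subspace_delta_image])
      obtain \<omega> where w: "Vector_Spaces.linear fscale (*) \<omega>"
        "\<forall>z\<in>cocycles L (Suc h). \<omega> z = 0 \<longleftrightarrow> z \<in> coboundaries L (Suc h)"
        by (rule top_functional[OF D L_carrier])
      interpret w: Vector_Spaces.linear fscale "(*)" \<omega> by fact
      interpret \<beta>: pairing fscale fscale "\<lambda>a b. \<omega> (cup (Suc p') a b)"
        by (rule fn.bilinear_form_pairing[OF bilinear_cup[OF w(1)]])
      have cupZ: "cup (Suc p') x y \<in> cocycles L (Suc h)" if "x \<in> cocycles L (Suc p')" "y \<in> cocycles L (Suc q)" for x y
        using cup_cocycles[OF that L_carrier] p'q by simp
      obtain y where y: "y \<in> cocycles L (Suc q)" "\<forall>x\<in>cocycles L (Suc p'). \<theta> x = \<omega> (cup (Suc p') x y)"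
      proof (rule \<beta>.represent_functional[OF subspace_cocycles subspace_cocycles subspace_coboundaries coboundaries_subset[OF L_carrier] _ _ duality_finite[OF D] lam(1)])
        fix b y assume "b \<in> coboundaries L (Suc p')" "y \<in> cocycles L (Suc q)"
        then show "\<omega> (cup (Suc p') b y) = 0"
          using w(2) cup_coboundary_left[OF _ _ L_carrier] cupZ sub_L p'q by metis
      next
        fix x assume x: "x \<in> cocycles L (Suc p')" and 0: "\<And>y. y \<in> cocycles L (Suc q) \<Longrightarrow> \<omega> (cup (Suc p') x y) = 0"
        show "x \<in> coboundaries L (Suc p')"
          by (rule nondegenerateD[OF duality_nondegenerate[OF D] p'q x]) (use w(2) cupZ[OF x] 0 in blast)
      next
        show "\<theta> b = 0" if "b \<in> coboundaries L (Suc p')" for b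
          using lam(2) coboundaries_delta_image that by blast
      qed
      have "delta t y \<in> coboundaries L (Suc q)"
      proof (rule nondegenerate_right[OF duality_nondegenerate[OF D] L_carrier p'q delta_Z[OF y(1)]])
        fix x' assume x': "x' \<in> cocycles L (Suc p')"
        define x where "x = shift (inv t) x'"
        have x: "x \<in> cocycles L (Suc p')"
          unfolding x_def by (rule shift_cocycles[OF normalises_inv[OF t_normalises] L_carrier x'])
        have tx: "shift t x = x'"
          using t_carrier shift_one[OF cocyclesD(1)[OF x']] by (simp add: x_def shift_shift)
        have "delta t x \<in> delta_image (Suc p')" by (rule delta_in_delta_image[OF x])
        then have "\<omega> (cup (Suc p') (delta t x) y) = 0" using lam(2) y(2) delta_Z[OF x] by metis
        then have 1: "\<omega> (cup (Suc p') x' y) = \<omega> (cup (Suc p') x y)" by (simp add: delta_def cup_diff_left w.diff tx)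
        have "\<omega> (delta t (cup (Suc p') x y)) = 0"
          using w(2) top_trivial[OF D unip cupZ[OF x y(1)]] delta_Z[OF cupZ[OF x y(1)]] by blast
        then have "\<omega> (cup (Suc p') x' (shift t y)) = \<omega> (cup (Suc p') x y)"
          by (simp add: delta_def shift_cup[OF t_carrier] tx w.diff)
        with 1 have "\<omega> (cup (Suc p') x' (delta t y)) = 0" by (simp add: delta_def cup_diff_right w.diff)
        then show "cup (Suc p') x' (delta t y) \<in> coboundaries L (Suc h)" using w(2) cupZ[OF x' delta_Z[OF y(1)]] by blast
      qed
      then have "\<omega> (cup (Suc p') w0 y) = 0" using orth[OF y(1)] w(2) cupZ[OF w0 y(1)] by blast
      then show False using y(2) w0 lam(3) by simp
    qed
    then obtain x e0 where xe: "w0 = delta t x + e0" "x \<in> cocycles L (Suc p')" "e0 \<in> coboundaries L (Suc p')"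
      unfolding delta_image_def by blast
    obtain e where e: "e \<in> coboundaries L (Suc p')" "delta t e = e0" using coboundary_delta_onto[OF xe(3)] by blast
    note eZ = sub_L[OF e(1)]
    have "c - x - e \<in> cochains M p"
      using c xe e cocyclesD(1)[OF eZ] cocyclesD(1)[OF xe(2)] Suc
      by (simp add: cochains_M_iff_delta dl.diff w0_def cochains_diff)
    moreover have "cobd (c - x - e) = a" using c cocyclesD(2)[OF eZ] cocyclesD(2)[OF xe(2)] by (simp add: cb.diff)
    ultimately show ?thesis unfolding coboundaries_Suc by blast
  qed
qed

text \<open>If \<open>b\<close> is the image of \<open>delta t c\<close> under the connecting map, the product is the image of
  \<open>delta t c\<close> times the restriction of \<open>y\<close>, which vanishes.\<close>

lemma restriction_kernel_isotropic:
  assumes b: "b \<in> cocycles M (Suc p)" "b \<in> coboundaries L (Suc p)" and y: "y \<in> cocycles M (Suc q)" "y \<in> coboundaries L (Suc q)"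
  shows "cup (Suc p) b y \<in> coboundaries M (Suc (p + q))"
proof -
  obtain c where c: "c \<in> cochains L p" "b = cobd c" using b by (auto simp: coboundaries_Suc)
  show ?thesis
  proof (cases p)
    case 0
    then have "b = 0" using c by (simp add: cochains_0 cb.zero)
    then show ?thesis using fn.subspace_0[OF subspace_coboundaries] by simp
  next
    case (Suc p')
    note yL = cocycles_M_L[OF y(1)]
    have "cobd (delta t c) = 0" using cobd_delta[OF t_carrier, of c] c b by (simp add: cocycles_M_iff_delta)
    then have "delta t c \<in> cocycles L (Suc p')" using delta_C[OF c(1)] Suc by (simp add: cocycles_def)
    then have "cup (Suc p') (delta t c) y \<in> coboundaries L (Suc (p' + q))"
      by (rule cup_coboundary_right[OF _ y(2) L_carrier])
    then obtain e where e: "e \<in> coboundaries L (Suc (p' + q))" "delta t e = cup (Suc p') (delta t c) y"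
      by (rule coboundary_delta_onto)
    note eZ = sub_L[OF e(1)]
    have "delta t (cup (Suc p') c y) = cup (Suc p') (delta t c) y"
      using delta_cup_left[OF t_carrier, of y "Suc p'" c] y by (simp add: cocycles_def cochains_M_iff)
    then have "cup (Suc p') c y - e \<in> cochains M (p + q)"
      using cup_cochains[OF _ cocyclesD(1)[OF yL] L_carrier, of c "Suc p'"] c cocyclesD(1)[OF eZ] e Suc
      by (simp add: cochains_M_iff_delta dl.diff cochains_diff)
    moreover have "cobd (cup (Suc p') c y - e) = cup (Suc p) b y"
      using cobd_cup[of c L p' y q] c Suc cocyclesD[OF yL] cocyclesD(2)[OF eZ] by (simp add: cb.diff)
    ultimately show ?thesis unfolding coboundaries_Suc by (metis imageI)
  qed
qed

lemma qdim_delta_image_top: 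
  assumes D: "duality L h" and unip: "unipotent_on L t"
  shows "fn.qdim (delta_image (Suc h)) (cocycles L (Suc h)) = 1"
proof -
  have "delta_image (Suc h) = coboundaries L (Suc h)"
    using coboundaries_delta_image top_trivial[OF D unip] coboundaries_add unfolding delta_image_def by blast
  then show ?thesis using duality_top[OF D] by simp
qed

lemma duality_M:
  assumes D: "duality L h" and unip: "unipotent_on L t"
  shows "duality M (Suc h)"
proof -
  note W = wang[OF duality_finite[OF D]]
  have K0: "fn.qdim (coboundaries L (Suc n)) (delta_kernel (Suc n)) = 0" if "n > h" for n
  proof -
    have "delta_kernel (Suc n) \<subseteq> coboundaries L (Suc n)"
      using duality_vanish[OF D that] by (auto simp: delta_kernel_def)
    then show ?thesis using fn.qdim_eq_0_iff[OF subspace_coboundaries fn.qfin_self] by blast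
  qed
  have finU: "fn.qfin (delta_image n) (cocycles L n)" for n
    by (rule fn.qfin_mono_denominator[OF duality_finite[OF D] coboundaries_delta_image])
  have fin: "H_finite M n" for n
    using W(1) by (cases n) (auto simp: cocycles_0 coboundaries_0 fn.qfin_self)
  have vanish: "cocycles M (Suc n) \<subseteq> coboundaries M (Suc n)" if n: "n > Suc h" for n
  proof -
    obtain n' where n': "n = Suc n'" "n' > h" using n by (cases n) auto
    have "cocycles L n \<subseteq> delta_image n" using duality_vanish[OF D n'(2)] coboundaries_delta_image n' by blast
    then have "fn.qdim (delta_image n) (cocycles L n) = 0" using fn.qdim_eq_0_iff[OF subspace_delta_image finU] by blast
    then have "H_dim M (Suc n) = 0" using W(2) K0[of n] n by simp
    then show ?thesis using fn.qdim_eq_0_iff[OF subspace_coboundaries fin] by blast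
  qed
  have nonzero: "\<not> cocycles M (Suc n) \<subseteq> coboundaries M (Suc n)" if n: "n \<le> Suc h" for n
  proof
    assume "cocycles M (Suc n) \<subseteq> coboundaries M (Suc n)"
    then have 0: "H_dim M (Suc n) = 0"
      using fn.qdim_eq_0_iff[OF subspace_coboundaries fin] by blast
    show False
    proof (cases n)
      case 0
      then show ?thesis using \<open>fn.qdim _ _ = 0\<close> qdim_degree_0(2)[OF M_carrier] by simp
    next
      case (Suc n')
      have "fn.qdim (delta_image n) (cocycles L n) = 0" using 0 W(2) by simp
      then have "cocycles L n \<subseteq> delta_image n" using fn.qdim_eq_0_iff[OF subspace_delta_image finU] by blast
      then have "cocycles L n \<subseteq> coboundaries L n" by (rule delta_nilpotent_onto[OF unip])
      then show ?thesis using duality_nonzero[OF D, of n'] n Suc by simp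
    qed
  qed
  have top: "H_dim M (Suc (Suc h)) = 1"
    using W(2) K0[of "Suc h"] qdim_delta_image_top[OF D unip] by simp
  note nd = nondegenerate_M[OF D unip]
  \<comment> \<open>the kernel \<open>I\<close> of restriction is its own annihilator, so it has half the dimension\<close>
  have even: "even (H_dim M (Suc k))" if k: "Suc h = 2 * k" for k
  proof -
    have kk: "k + k = Suc h" using k by simp
    define I where "I = cocycles M (Suc k) \<inter> coboundaries L (Suc k)"
    have I: "fn.subspace I" unfolding I_def by (rule fn.subspace_inter[OF subspace_cocycles subspace_coboundaries])
    have BI: "coboundaries M (Suc k) \<subseteq> I" unfolding I_def using sub_M coboundaries_M_L by blast
    have IZ: "I \<subseteq> cocycles M (Suc k)" unfolding I_def by blast
    obtain \<omega> where w: "Vector_Spaces.linear fscale (*) \<omega>"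
      "\<forall>z\<in>cocycles M (Suc (Suc h)). \<omega> z = 0 \<longleftrightarrow> z \<in> coboundaries M (Suc (Suc h))"
      by (rule fn.qdim_1_functional[OF subspace_coboundaries subspace_cocycles coboundaries_subset[OF M_carrier] fin top])
    interpret \<beta>: pairing fscale fscale "\<lambda>a b. \<omega> (cup (Suc k) a b)"
      by (rule fn.bilinear_form_pairing[OF bilinear_cup[OF w(1)]])
    have cupZ: "cup (Suc k) x y \<in> cocycles M (Suc (Suc h))" if "x \<in> cocycles M (Suc k)" "y \<in> cocycles M (Suc k)" for x y
      using cup_cocycles[OF that M_carrier] kk by simp
    have w0: "\<omega> (cup (Suc k) x y) = 0 \<longleftrightarrow> cup (Suc k) x y \<in> coboundaries M (Suc (Suc h))"
      if "x \<in> cocycles M (Suc k)" "y \<in> cocycles M (Suc k)" for x y using w(2) cupZ[OF that] by blast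
    have "fn.qdim (coboundaries M (Suc k)) I = fn.qdim I (cocycles M (Suc k))"
    proof (rule \<beta>.qdim_perfect_pairing[OF subspace_cocycles I I subspace_coboundaries IZ BI])
      show "\<omega> (cup (Suc k) b y) = 0" if "b \<in> I" "y \<in> I" for b y
        using restriction_kernel_isotropic[of b k y k] that w0[of b y] kk by (simp add: I_def)
      show "\<omega> (cup (Suc k) x b) = 0" if "x \<in> cocycles M (Suc k)" "b \<in> coboundaries M (Suc k)" for x b
        using cup_coboundary_right[OF that M_carrier] w0[OF that(1) sub_M[OF that(2)]] kk by simp
      show "x \<in> I" if x: "x \<in> cocycles M (Suc k)" and 0: "\<And>y. y \<in> I \<Longrightarrow> \<omega> (cup (Suc k) x y) = 0" for x
      proof -
        have "x \<in> coboundaries L (Suc k)"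
          by (rule annihilator_restricts_to_zero[OF D unip kk x]) (use w0[OF x] 0 in \<open>simp add: I_def\<close>)
        then show ?thesis using x by (simp add: I_def)
      qed
      show "y \<in> coboundaries M (Suc k)" if y: "y \<in> I" and 0: "\<And>x. x \<in> cocycles M (Suc k) \<Longrightarrow> \<omega> (cup (Suc k) x y) = 0" for y
        by (rule nondegenerate_right[OF nd M_carrier kk]) (use y w0 0 in \<open>auto simp: I_def\<close>)
      show "fn.qfin I (cocycles M (Suc k))" by (rule fn.qfin_mono_denominator[OF fin BI])
    qed
    then show ?thesis using fn.qdim_add[OF subspace_coboundaries I subspace_cocycles BI IZ fin] by simp
  qed
  show ?thesis unfolding duality_def using fin vanish nonzero top nd even by blast
qed

end

section \<open>Finite steps and the fifth infinite step\<close>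

context finite_cyclic_extension
begin

lemma qdim_M:
  assumes unip: "unipotent_on L t" and fin: "H_finite L n"
  shows "H_finite M n"
    and "H_dim M n = H_dim L n"
proof -
  have onto: "\<exists>z\<in>cocycles M n. y - id z \<in> coboundaries L n" if "y \<in> cocycles L n" for y
    using restriction_onto[OF unip that] by (intro bexI[of _ "average y"]) auto
  have into: "id z \<in> cocycles L n" if "z \<in> cocycles M n" for z using cocycles_M_L[OF that] by simp
  have ker: "id z \<in> coboundaries L n \<longleftrightarrow> z \<in> coboundaries M n" if "z \<in> cocycles M n" for z
    using coboundaries_restrict[OF that] coboundaries_M_L by auto
  note iso = fn.quotient_iso[OF subspace_coboundaries subspace_cocycles subspace_coboundaries
      coboundaries_subset[OF M_carrier] fn.linear_id into onto ker]
  show "H_finite M n"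
    "H_dim M n = H_dim L n"
    using iso fin by auto
qed

lemma duality_M:
  assumes D: "duality L h" and unip: "unipotent_on L t"
  shows "duality M h"
proof -
  note Q = qdim_M[OF unip duality_finite[OF D]]
  have sub: "cocycles M n \<subseteq> coboundaries M n \<longleftrightarrow> cocycles L n \<subseteq> coboundaries L n" for n
    using Q(2)[of n] fn.qdim_eq_0_iff[OF subspace_coboundaries Q(1)]
      fn.qdim_eq_0_iff[OF subspace_coboundaries duality_finite[OF D]] by metis
  have "nondegenerate M h"
    unfolding nondegenerate_def
  proof (intro allI impI ballI)
    fix p q a assume pq: "p + q = h" and a: "a \<in> cocycles M (Suc p)"
      and ann: "\<forall>b\<in>cocycles M (Suc q). cup (Suc p) a b \<in> coboundaries M (Suc h)"
    note aL = cocycles_M_L[OF a]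
    have "a \<in> coboundaries L (Suc p)"
    proof (rule nondegenerateD[OF duality_nondegenerate[OF D] pq aL])
      fix b assume b: "b \<in> cocycles L (Suc q)"
      have "cup (Suc p) a (average b) \<in> coboundaries L (Suc h)"
        using ann restriction_onto(1)[OF unip b] coboundaries_M_L by blast
      moreover have "cup (Suc p) a (b - average b) \<in> coboundaries L (Suc h)"
        using cup_coboundary_right[OF aL restriction_onto(2)[OF unip b] L_carrier] pq by simp
      ultimately have "cup (Suc p) a (average b) + cup (Suc p) a (b - average b) \<in> coboundaries L (Suc h)"
        by (rule coboundaries_add)
      then show "cup (Suc p) a b \<in> coboundaries L (Suc h)" by (simp flip: cup_add_right)
    qed
    then show "a \<in> coboundaries M (Suc p)" by (rule coboundaries_restrict[OF a])
  qed
  then show ?thesis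
    using D sub Q unfolding duality_def by simp
qed

end

context infinite_cyclic_extension
begin

text \<open>Degree two of \<open>M\<close> receives the fixed space \<open>?d 3\<close> of \<open>t\<close> on \<open>H\<^sup>2(L)\<close>, of dimension at least two, and the cokernel
  \<open>?c 2\<close> on \<open>H\<^sup>1(L)\<close>; degree one receives the kernel \<open>?d 2\<close> on \<open>H\<^sup>1(L)\<close>, of the same dimension as \<open>?c 2\<close>, and at
  most one more dimension from \<open>H\<^sup>0(L)\<close>.\<close>

lemma second_betti_exceeds_first:
  assumes D: "duality L 4" and unip: "unipotent_on L t"
  shows "H_dim M 2 < H_dim M 3"
proof -
  note fin = duality_finite[OF D]
  note W = wang[OF fin]
  let ?d = "\<lambda>n. fn.qdim (coboundaries L n) (delta_kernel n)"
  let ?c = "\<lambda>n. fn.qdim (delta_image n) (cocycles L n)"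
  have c2: "?c 2 = ?d 2"
    unfolding delta_image_def delta_kernel_def
    by (rule fn.qdim_cokernel_eq_kernel[OF linear_delta[of t] subspace_coboundaries subspace_cocycles
        coboundaries_subset[OF L_carrier] delta_Z delta_B fin])
  have c1: "?c (Suc 0) \<le> 1"
    using fn.qdim_mono_denominator[OF subspace_coboundaries subspace_delta_image subspace_cocycles
        coboundaries_delta_image delta_image_subset fin, of "Suc 0"] qdim_degree_0(2)[OF L_carrier] by simp
  have d3: "?d 3 \<ge> 2"
  proof -
    obtain \<omega> where w: "Vector_Spaces.linear fscale (*) \<omega>"
      "\<forall>z\<in>cocycles L (Suc 4). \<omega> z = 0 \<longleftrightarrow> z \<in> coboundaries L (Suc 4)"
      by (rule top_functional[OF D L_carrier])
    interpret w: Vector_Spaces.linear fscale "(*)" \<omega> by fact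
    have s3: "Suc 2 = 3" "Suc 4 = 5" by simp_all
    have cupZ: "cup 3 x y \<in> cocycles L 5" if "x \<in> cocycles L 3" "y \<in> cocycles L 3" for x y
      using cup_cocycles[of x L 2 y 2, OF _ _ L_carrier] that by simp
    have w0: "\<omega> z = 0 \<longleftrightarrow> z \<in> coboundaries L 5" if "z \<in> cocycles L 5" for z using w(2) that by simp
    obtain m where m: "\<forall>z\<in>cocycles L 3. (delta t ^^ m) z \<in> coboundaries L 3" using unip unipotent_on_def by blast
    have dt: "(\<lambda>x. shift t x - x) = delta t" by (rule ext) (simp add: delta_def)
    have "even (fn.qdim (coboundaries L 3) {z \<in> cocycles L 3. shift t z - z \<in> coboundaries L 3})"
    proof (rule fn.even_fixed_space_of_unipotent_isometry[where c = "\<lambda>a b. \<omega> (cup 3 a b)" and m = m,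
          OF _ linear_shift subspace_coboundaries subspace_cocycles coboundaries_subset[OF L_carrier]
            shift_cocycles[OF t_normalises L_carrier] shift_coboundaries[OF t_normalises L_carrier] fin])
      show "(2 :: rat) \<noteq> 0" by simp
      show "\<exists>u\<in>cocycles L 3. shift t u = z" if "z \<in> cocycles L 3" for z
        using shift_cocycles[OF normalises_inv[OF t_normalises] L_carrier that] t_carrier shift_one[OF cocyclesD(1)[OF that]]
        by (intro bexI[of _ "shift (inv t) z"]) (simp_all add: shift_shift)
      show "((\<lambda>x. shift t x - x) ^^ m) z \<in> coboundaries L 3" if "z \<in> cocycles L 3" for z
        unfolding dt using m that by blast
      show "fn.bilinear_form (\<lambda>a b. \<omega> (cup 3 a b))" by (rule bilinear_cup[OF w(1)])
      show "\<omega> (cup 3 x y) = \<omega> (cup 3 y x)" if "x \<in> cocycles L 3" "y \<in> cocycles L 3" for x y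
      proof -
        have "\<omega> (cup 3 x y - cup 3 y x) = 0"
          using cup_symmetric_degree_2[OF that L_carrier] w0[OF cocycles_diff[OF cupZ[OF that] cupZ[OF that(2,1)]]] by simp
        then show ?thesis by (simp add: w.diff)
      qed
      show "\<omega> (cup 3 (shift t x) (shift t y)) = \<omega> (cup 3 x y)" if "x \<in> cocycles L 3" "y \<in> cocycles L 3" for x y
      proof -
        have "delta t (cup 3 x y) \<in> coboundaries L 5" using top_trivial[OF D unip, of "cup 3 x y"] cupZ[OF that] by simp
        then have "\<omega> (delta t (cup 3 x y)) = 0" using w0[OF delta_Z[OF cupZ[OF that]]] by simp
        then show ?thesis by (simp add: delta_def shift_cup[OF t_carrier] w.diff)
      qed
      show "\<omega> (cup 3 b z) = 0" if "b \<in> coboundaries L 3" "z \<in> cocycles L 3" for b z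
        using cup_coboundary_left[of b L 2 z 2, OF _ _ L_carrier] that w0[OF cupZ[OF sub_L[OF that(1)] that(2)]] by simp
      show "x \<in> coboundaries L 3" if x: "x \<in> cocycles L 3" and 0: "\<And>y. y \<in> cocycles L 3 \<Longrightarrow> \<omega> (cup 3 x y) = 0" for x
      proof -
        have "x \<in> coboundaries L (Suc 2)"
          by (rule nondegenerateD[OF duality_nondegenerate[OF D], of 2 2]) (use x 0 w0 cupZ[OF x] in auto)
        then show ?thesis by simp
      qed
      show "even (H_dim L 3)" using duality_even[OF D, of 2] by simp
    qed
    then have ev: "even (?d 3)" by (simp add: delta_kernel_def delta_def)
    have "\<not> delta_kernel 3 \<subseteq> coboundaries L 3"
    proof
      assume sub: "delta_kernel 3 \<subseteq> coboundaries L 3"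
      have "cocycles L 3 \<subseteq> coboundaries L 3"
        by (rule fn.nilpotent_kernel[where S = "delta t" and m = m]) (use m sub delta_Z in \<open>auto simp: delta_kernel_def\<close>)
      then show False using duality_nonzero[OF D, of 2] by simp
    qed
    moreover have "fn.qfin (coboundaries L 3) (delta_kernel 3)"
      by (rule fn.qfin_subset[OF fin]) (auto simp: delta_kernel_def)
    ultimately have "?d 3 \<noteq> 0" using fn.qdim_eq_0_iff[OF subspace_coboundaries] by blast
    moreover obtain k where "?d 3 = 2 * k" using ev by (rule evenE)
    ultimately show ?thesis by simp
  qed
  have "H_dim M 3 = ?d 3 + ?c 2" using W(2)[of 2] by simp
  moreover have "H_dim M 2 = ?d 2 + ?c (Suc 0)" using W(2)[of "Suc 0"] by (simp add: numeral_2_eq_2)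
  ultimately show ?thesis using c2 c1 d3 by linarith
qed

end

section \<open>Central chains in finitely generated nilpotent groups\<close>

context group
begin

lemma r_coset_eq_iff:
  assumes "subgroup Z G" "a \<in> carrier G" "b \<in> carrier G"
  shows "Z #> a = Z #> b \<longleftrightarrow> (\<exists>z\<in>Z. a = z \<otimes> b)"
proof
  assume "Z #> a = Z #> b"
  then have "a \<in> Z #> b" using rcos_self[OF assms(2,1)] by simp
  then show "\<exists>z\<in>Z. a = z \<otimes> b" by (auto simp: r_coset_def)
next
  assume "\<exists>z\<in>Z. a = z \<otimes> b"
  then have "a \<in> Z #> b" by (auto simp: r_coset_def)
  then show "Z #> a = Z #> b" using repr_independence[OF _ assms(3,1)] by blast
qed

lemma r_coset_int_pow_cong:
  assumes "Z \<lhd> G" "a \<in> carrier G" "b \<in> carrier G" "Z #> a = Z #> b"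
  shows "Z #> a [^] (k::int) = Z #> b [^] k"
  using normal.FactGroup_int_pow[OF assms(1,2), of k] normal.FactGroup_int_pow[OF assms(1,3), of k] assms(4) by simp

text \<open>This is the preimage of a centraliser in the quotient by \<open>Z\<close>, so commuting with \<open>x\<close> modulo \<open>Z\<close> need only be
  checked on generators.\<close>

lemma subgroup_commuting_modulo:
  assumes Z: "Z \<lhd> G" and x: "x \<in> carrier G"
  shows "subgroup {a \<in> carrier G. x \<otimes> a \<otimes> inv x \<otimes> inv a \<in> Z} G"
proof -
  interpret Z: normal Z G by fact
  have conj: "g \<otimes> z \<otimes> inv g \<in> Z" if "g \<in> carrier G" "z \<in> Z" for g z using Z.inv_op_closed2 that by blast
  have mult: "x \<otimes> (a \<otimes> b) \<otimes> inv x \<otimes> inv (a \<otimes> b) \<in> Z"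
    if a: "a \<in> carrier G" "x \<otimes> a \<otimes> inv x \<otimes> inv a \<in> Z" and b: "b \<in> carrier G" "x \<otimes> b \<otimes> inv x \<otimes> inv b \<in> Z" for a b
  proof -
    have "x \<otimes> (a \<otimes> b) \<otimes> inv x \<otimes> inv (a \<otimes> b) =
      (x \<otimes> a \<otimes> inv x \<otimes> inv a) \<otimes> (a \<otimes> (x \<otimes> b \<otimes> inv x \<otimes> inv b) \<otimes> inv a)"
      using a(1) b(1) x by (simp add: m_assoc inv_mult_group inv_mult_cancel_left)
    then show ?thesis using a b conj[OF a(1) b(2)] by simp
  qed
  have inverse: "x \<otimes> inv a \<otimes> inv x \<otimes> inv (inv a) \<in> Z"
    if a: "a \<in> carrier G" "x \<otimes> a \<otimes> inv x \<otimes> inv a \<in> Z" for a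
  proof -
    have "x \<otimes> inv a \<otimes> inv x \<otimes> inv (inv a) = inv a \<otimes> inv (x \<otimes> a \<otimes> inv x \<otimes> inv a) \<otimes> inv (inv a)"
      using a(1) x by (simp add: m_assoc inv_mult_group inv_mult_cancel_left)
    moreover have "inv (x \<otimes> a \<otimes> inv x \<otimes> inv a) \<in> Z" using a(2) by simp
    ultimately show ?thesis using conj[of "inv a"] a(1) by simp
  qed
  show ?thesis
  proof (rule subgroupI)
    have "\<one> \<in> {a \<in> carrier G. x \<otimes> a \<otimes> inv x \<otimes> inv a \<in> Z}" using x by simp
    then show "{a \<in> carrier G. x \<otimes> a \<otimes> inv x \<otimes> inv a \<in> Z} \<noteq> {}" by blast
  qed (use mult inverse in auto)
qed

definition central_modulo :: "'a set \<Rightarrow> 'a \<Rightarrow> bool"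
  where "central_modulo Z t \<longleftrightarrow> t \<in> carrier G \<and> (\<forall>g\<in>carrier G. g \<otimes> t \<otimes> inv g \<otimes> inv t \<in> Z)"

definition adjoin :: "'a set \<Rightarrow> 'a \<Rightarrow> 'a set"
  where "adjoin Z t = {z \<otimes> t [^] i | z (i::int). z \<in> Z}"

lemma adjoin_iff:
  assumes Z: "subgroup Z G" and t: "t \<in> carrier G"
  shows "x \<in> adjoin Z t \<longleftrightarrow> x \<in> carrier G \<and> (\<exists>i::int. Z #> x = Z #> t [^] i)"
proof -
  have "x \<in> adjoin Z t \<longleftrightarrow> (\<exists>i::int. \<exists>z\<in>Z. x = z \<otimes> t [^] i)" by (auto simp: adjoin_def)
  also have "\<dots> \<longleftrightarrow> x \<in> carrier G \<and> (\<exists>i::int. \<exists>z\<in>Z. x = z \<otimes> t [^] i)"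
    using t subgroup.mem_carrier[OF Z] by blast
  also have "\<dots> \<longleftrightarrow> x \<in> carrier G \<and> (\<exists>i::int. Z #> x = Z #> t [^] i)"
    using r_coset_eq_iff[OF Z _ int_pow_closed[OF t]] by blast
  finally show ?thesis .
qed

lemma adjoin_superset: 
  assumes "subgroup Z G" "t \<in> carrier G" shows "Z \<subseteq> adjoin Z t" "t \<in> adjoin Z t"
proof -
  have "z \<in> adjoin Z t" if "z \<in> Z" for z
  proof -
    have "z = z \<otimes> t [^] (0::int)" using subgroup.mem_carrier[OF assms(1) that] by simp
    then show ?thesis unfolding adjoin_def using that by blast
  qed
  then show "Z \<subseteq> adjoin Z t" by blast
  have "t = \<one> \<otimes> t [^] (1::int)" using assms by simp
  then show "t \<in> adjoin Z t" unfolding adjoin_def using subgroup.one_closed[OF assms(1)] by blast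
qed

lemma adjoin_central_modulo:
  assumes Z: "Z \<lhd> G" and t: "central_modulo Z t" and x: "x \<in> adjoin Z t" and g: "g \<in> carrier G"
  shows "g \<otimes> x \<otimes> inv g \<otimes> inv x \<in> Z"
proof -
  interpret Z: normal Z G by fact
  let ?A = "{a \<in> carrier G. g \<otimes> a \<otimes> inv g \<otimes> inv a \<in> Z}"
  have A: "subgroup ?A G" by (rule subgroup_commuting_modulo[OF Z g])
  have "t \<in> ?A" using t g by (simp add: central_modulo_def)
  then have "t [^] i \<in> ?A" for i :: int by (rule subgroup_int_pow_closed[OF A])
  moreover have "z \<in> ?A" if "z \<in> Z" for z
    using that g Z.inv_op_closed2[OF g that] by simp
  ultimately have "adjoin Z t \<subseteq> ?A" unfolding adjoin_def using subgroup.m_closed[OF A] by blast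
  then show ?thesis using x by blast
qed

lemma adjoin_normal:
  assumes Z: "Z \<lhd> G" and t: "central_modulo Z t"
  shows "adjoin Z t \<lhd> G"
proof -
  interpret Z: normal Z G by fact
  have tc: "t \<in> carrier G" using t by (simp add: central_modulo_def)
  note iff = adjoin_iff[OF Z.subgroup_axioms tc]
  have sub: "subgroup (adjoin Z t) G"
  proof (rule subgroupI)
    show "adjoin Z t \<subseteq> carrier G" using iff by blast
    show "adjoin Z t \<noteq> {}" using adjoin_superset[OF Z.subgroup_axioms tc] by blast
    fix x assume "x \<in> adjoin Z t"
    then obtain i :: int where x: "x \<in> carrier G" "Z #> x = Z #> t [^] i" using iff by blast
    have "Z #> inv x = Z #> t [^] (- i)"
      using r_coset_int_pow_cong[OF Z x(1) _ x(2), of "-1"] x(1) tc by (simp add: int_pow_neg)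
    then show "inv x \<in> adjoin Z t" using iff x by blast
    fix y assume "y \<in> adjoin Z t"
    then obtain j :: int where y: "y \<in> carrier G" "Z #> y = Z #> t [^] j" using iff by blast
    have "Z #> (x \<otimes> y) = (Z #> t [^] i) <#> (Z #> t [^] j)"
      using Z.rcos_sum[OF x(1) y(1)] by (simp only: x(2) y(2))
    also have "\<dots> = Z #> t [^] (i + j)" using Z.rcos_sum tc by (simp add: int_pow_mult)
    finally show "x \<otimes> y \<in> adjoin Z t" using iff x y by blast
  qed
  moreover have "g \<otimes> x \<otimes> inv g \<in> adjoin Z t" if g: "g \<in> carrier G" and x: "x \<in> adjoin Z t" for g x
  proof -
    have xc: "x \<in> carrier G" using x iff by blast
    have "g \<otimes> x \<otimes> inv g = (g \<otimes> x \<otimes> inv g \<otimes> inv x) \<otimes> x" using g xc by (simp add: m_assoc)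
    then show ?thesis
      using adjoin_central_modulo[OF Z t x g] adjoin_superset(1)[OF Z.subgroup_axioms tc] subgroup.m_closed[OF sub _ x] by force
  qed
  ultimately show ?thesis by (simp add: normal_inv_iff)
qed

inductive central_chain :: "'a set \<Rightarrow> bool" where
  trivial: "central_chain {\<one>}"
| adjoin: "central_chain Z \<Longrightarrow> central_modulo Z t \<Longrightarrow> central_chain (adjoin Z t)"

lemma central_chain_normal: "central_chain Z \<Longrightarrow> Z \<lhd> G"
  by (induction rule: central_chain.induct) (auto simp: one_is_normal adjoin_normal)

lemma central_chain_finite_extension:
  assumes "finite F" "central_chain Z" "\<And>x. x \<in> F \<Longrightarrow> central_modulo Z x"
  shows "\<exists>Z'. central_chain Z' \<and> Z \<union> F \<subseteq> Z'"
  using assms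
proof (induction F rule: finite_induct)
  case empty
  then show ?case by auto
next
  case (insert x F)
  then obtain Y where Y: "central_chain Y" "Z \<union> F \<subseteq> Y" by auto
  have "central_modulo Y x" using insert.prems(2)[of x] Y by (auto simp: central_modulo_def)
  then have "central_chain (adjoin Y x)" "x \<in> carrier G" using Y central_chain.adjoin by (auto simp: central_modulo_def)
  moreover have "subgroup Y G" using central_chain_normal[OF Y(1)] by (rule normal_imp_subgroup)
  ultimately show ?case using adjoin_superset[of Y x] Y by blast
qed

primrec iterated_commutators :: "'a set \<Rightarrow> nat \<Rightarrow> 'a set"
  where
    "iterated_commutators S 0 = S"
  | "iterated_commutators S (Suc j) = (\<lambda>(x, s). x \<otimes> s \<otimes> inv x \<otimes> inv s) ` (iterated_commutators S j \<times> S)"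

lemma iterated_commutators_carrier: "S \<subseteq> carrier G \<Longrightarrow> iterated_commutators S j \<subseteq> carrier G"
  by (induction j) (auto simp: subset_iff)

lemma finite_iterated_commutators: "finite S \<Longrightarrow> finite (iterated_commutators S j)"
  by (induction j) auto

lemma iterated_commutators_lower_central: "S \<subseteq> carrier G \<Longrightarrow> iterated_commutators S j \<subseteq> lower_central G j"
proof (induction j)
  case (Suc j)
  then show ?case by (auto intro!: generate.incl)
qed simp

text \<open>An iterated commutator \<open>x\<close> commutes with each generator modulo the next layer, hence with everything.
  Adjoining the finitely many elements of one layer after the other, from the trivial last layer up to
  the generators themselves, exhausts the group.\<close>

lemma central_chain_carrier:
  assumes fg: "finitely_generated_group G" and nil: "nilpotent_group G"
  shows "central_chain (carrier G)"
proof -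
  obtain S where S: "finite S" "S \<subseteq> carrier G" "generate G S = carrier G" using fg unfolding finitely_generated_group_def by blast
  obtain c where c: "lower_central G c = {\<one>}" using nil unfolding nilpotent_group_def by blast
  note Xc = iterated_commutators_carrier[OF S(2)]
  \<comment> \<open>each layer of iterated commutators is central modulo the next one\<close>
  have "\<exists>Z. central_chain Z \<and> iterated_commutators S j \<subseteq> Z" if "j \<le> c" for j
    using that
  proof (induction rule: inc_induct)
    case base
    have "iterated_commutators S c \<subseteq> {\<one>}" using iterated_commutators_lower_central[OF S(2), of c] c by simp
    then show ?case using central_chain.trivial by blast
  next
    case (step j)
    then obtain Z where Z: "central_chain Z" "iterated_commutators S (Suc j) \<subseteq> Z" by blast
    note nZ = central_chain_normal[OF Z(1)]
    have "central_modulo Z x" if x: "x \<in> iterated_commutators S j" for x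
    proof -
      have xc: "x \<in> carrier G" using x Xc by blast
      let ?A = "{a \<in> carrier G. x \<otimes> a \<otimes> inv x \<otimes> inv a \<in> Z}"
      have "S \<subseteq> ?A"
      proof
        fix s assume s: "s \<in> S"
        then have "x \<otimes> s \<otimes> inv x \<otimes> inv s \<in> iterated_commutators S (Suc j)" using x by force
        then show "s \<in> ?A" using Z(2) s S(2) by blast
      qed
      then have "generate G S \<subseteq> ?A" by (rule generate_subgroup_incl[OF _ subgroup_commuting_modulo[OF nZ xc]])
      then have *: "x \<otimes> g \<otimes> inv x \<otimes> inv g \<in> Z" if "g \<in> carrier G" for g using that unfolding S(3) by blast
      have "g \<otimes> x \<otimes> inv g \<otimes> inv x = inv (x \<otimes> g \<otimes> inv x \<otimes> inv g)" if "g \<in> carrier G" for g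
        using that xc by (simp add: m_assoc inv_mult_group)
      then show ?thesis
        using xc subgroup.m_inv_closed[OF normal_imp_subgroup[OF nZ] *] unfolding central_modulo_def by simp
    qed
    then show ?case
      using central_chain_finite_extension[OF finite_iterated_commutators[OF S(1)] Z(1)] by (meson le_sup_iff)
  qed
  from this[of 0] obtain Z where Z: "central_chain Z" "S \<subseteq> Z" by auto
  have sZ: "subgroup Z G" by (rule normal_imp_subgroup[OF central_chain_normal[OF Z(1)]])
  then have "carrier G \<subseteq> Z" using generate_subgroup_incl[OF Z(2) sZ] S(3) by simp
  then have "Z = carrier G" using subgroup.subset[OF sZ] by blast
  then show ?thesis using Z(1) by simp
qed

lemma restricted_coset: "r_coset (G\<lparr>carrier := M\<rparr>) L x = L #> x"
  by (simp add: r_coset_def)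

lemma cyclic_series_factor:
  assumes sM: "subgroup M G" and L: "L \<lhd> (G\<lparr>carrier := M\<rparr>)" and t: "t \<in> M"
    and gen: "\<And>g. g \<in> M \<Longrightarrow> \<exists>l\<in>L. \<exists>i::int. g = l \<otimes> t [^] i"
  shows "cyclic_group ((G\<lparr>carrier := M\<rparr>) Mod L)"
proof -
  let ?M = "G\<lparr>carrier := M\<rparr>"
  interpret L: normal L ?M by fact
  interpret F: group "?M Mod L" by (rule L.factorgroup_is_group)
  have Mc: "M \<subseteq> carrier G" by (rule subgroup.subset[OF sM])
  have LM: "L \<subseteq> M" using L.subset by simp
  have pow: "(L #> t) [^]\<^bsub>?M Mod L\<^esub> i = L #> t [^] i" for i :: int
    using L.FactGroup_int_pow[of t i] t by (simp add: restricted_coset int_pow_consistent[OF sM t, symmetric])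
  have sL: "subgroup L G" by (rule incl_subgroup[OF sM L.subgroup_axioms])
  have carr: "carrier (?M Mod L) = (\<lambda>x. L #> x) ` M" by (simp add: carrier_FactGroup restricted_coset)
  have "L #> g \<in> range (\<lambda>i::int. (L #> t) [^]\<^bsub>?M Mod L\<^esub> i)" if "g \<in> M" for g
  proof -
    obtain l i where li: "l \<in> L" "g = l \<otimes> t [^] (i::int)" using gen \<open>g \<in> M\<close> by blast
    have "L #> g = L #> t [^] i" using r_coset_eq_iff[OF sL] li Mc t \<open>g \<in> M\<close> by blast
    then show ?thesis unfolding pow by blast
  qed
  moreover have "(L #> t) [^]\<^bsub>?M Mod L\<^esub> i \<in> carrier (?M Mod L)" for i :: int
    using carr t by (intro F.int_pow_closed) auto
  ultimately have "carrier (?M Mod L) = range (\<lambda>i::int. (L #> t) [^]\<^bsub>?M Mod L\<^esub> i)"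
    unfolding carr by (auto simp: carr)
  then show ?thesis unfolding F.cyclic_group using carr t by blast
qed

lemma cyclic_series_factor_generator:
  assumes sM: "subgroup M G" and L: "L \<lhd> (G\<lparr>carrier := M\<rparr>)" and cyc: "cyclic_group ((G\<lparr>carrier := M\<rparr>) Mod L)"
  obtains t where "t \<in> M" "\<forall>g\<in>M. \<exists>l\<in>L. \<exists>i::int. g = l \<otimes> t [^] i"
    "\<forall>l\<in>L. t \<otimes> l \<otimes> inv t \<in> L \<and> inv t \<otimes> l \<otimes> t \<in> L"
    "finite (carrier ((G\<lparr>carrier := M\<rparr>) Mod L)) \<longleftrightarrow> (\<exists>k::nat. k > 0 \<and> t [^] k \<in> L)"
proof -
  let ?M = "G\<lparr>carrier := M\<rparr>"
  interpret L: normal L ?M by fact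
  interpret F: group "?M Mod L" by (rule L.factorgroup_is_group)
  have Mc: "M \<subseteq> carrier G" by (rule subgroup.subset[OF sM])
  have LM: "L \<subseteq> M" using L.subset by simp
  have sL: "subgroup L G" by (rule incl_subgroup[OF sM L.subgroup_axioms])
  have carr: "carrier (?M Mod L) = (\<lambda>x. L #> x) ` M" by (simp add: carrier_FactGroup restricted_coset)
  obtain X where X: "X \<in> carrier (?M Mod L)" "carrier (?M Mod L) = range (\<lambda>i::int. X [^]\<^bsub>?M Mod L\<^esub> i)"
    using cyc F.cyclic_group by blast
  obtain t where t: "t \<in> M" "X = L #> t" using X(1) carr by blast
  have pow: "(L #> t) [^]\<^bsub>?M Mod L\<^esub> i = L #> t [^] i" for i :: int
    using L.FactGroup_int_pow[of t i] t by (simp add: restricted_coset int_pow_consistent[OF sM t(1), symmetric])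
  have npow: "(L #> t) [^]\<^bsub>?M Mod L\<^esub> k = L #> t [^] k" for k :: nat
    using L.FactGroup_pow[of t k] t by (simp add: restricted_coset nat_pow_consistent[symmetric])
  have tc: "t \<in> carrier G" using t Mc by blast
  show ?thesis
  proof (rule that[OF t(1)])
    show "\<forall>g\<in>M. \<exists>l\<in>L. \<exists>i::int. g = l \<otimes> t [^] i"
    proof
      fix g assume g: "g \<in> M"
      then have "L #> g \<in> range (\<lambda>i::int. L #> t [^] i)" using X(2) carr t(2) pow by auto
      then obtain i :: int where "L #> g = L #> t [^] i" by blast
      then show "\<exists>l\<in>L. \<exists>i::int. g = l \<otimes> t [^] i" using r_coset_eq_iff[OF sL] g Mc tc by blast
    qed
    show "\<forall>l\<in>L. t \<otimes> l \<otimes> inv t \<in> L \<and> inv t \<otimes> l \<otimes> t \<in> L"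
      using L.inv_op_closed1[of t] L.inv_op_closed2[of t] t m_inv_consistent[OF sM t(1)] by simp
    have "L #> a = L \<longleftrightarrow> a \<in> L" if "a \<in> carrier G" for a
      using coset_join1[OF _ that sL] coset_join2[OF that sL] by blast
    then have *: "X [^]\<^bsub>?M Mod L\<^esub> k = \<one>\<^bsub>?M Mod L\<^esub> \<longleftrightarrow> t [^] k \<in> L" for k :: nat
      using t(2) npow tc by simp
    have "carrier (subgroup_generated (?M Mod L) {X}) = carrier (?M Mod L)"
      using F.carrier_subgroup_generated_by_singleton[OF X(1)] X(2) by simp
    then show "finite (carrier (?M Mod L)) \<longleftrightarrow> (\<exists>k::nat. k > 0 \<and> t [^] k \<in> L)"
      using F.finite_cyclic_subgroup[OF X(1)] * by auto
  qed
qed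

lemma central_chain_series:
  assumes "central_chain Z"
  shows "\<exists>Hs. Hs \<noteq> [] \<and> hd Hs = {\<one>} \<and> last Hs = Z \<and> (\<forall>H\<in>set Hs. subgroup H G) \<and>
    (\<forall>i. Suc i < length Hs \<longrightarrow> (Hs ! i) \<lhd> (G\<lparr>carrier := Hs ! Suc i\<rparr>) \<and> cyclic_group (series_factor G Hs i))"
  using assms
proof (induction rule: central_chain.induct)
  case trivial
  then show ?case by (intro exI[of _ "[{\<one>}]"]) (simp add: triv_subgroup)
next
  case (adjoin Z t)
  obtain Hs where Hs: "Hs \<noteq> []" "hd Hs = {\<one>}" "last Hs = Z" "\<forall>H\<in>set Hs. subgroup H G"
    "\<forall>i. Suc i < length Hs \<longrightarrow> (Hs ! i) \<lhd> (G\<lparr>carrier := Hs ! Suc i\<rparr>) \<and> cyclic_group (series_factor G Hs i)"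
    using adjoin.IH by blast
  let ?Z' = "adjoin Z t" and ?Hs = "Hs @ [adjoin Z t]"
  have tc: "t \<in> carrier G" using adjoin.hyps(2) by (simp add: central_modulo_def)
  have nZ: "Z \<lhd> G" by (rule central_chain_normal[OF adjoin.hyps(1)])
  have sZ: "subgroup Z G" by (rule normal_imp_subgroup[OF nZ])
  have sZ': "subgroup ?Z' G" by (rule normal_imp_subgroup[OF adjoin_normal[OF nZ adjoin.hyps(2)]])
  have n: "Z \<lhd> (G\<lparr>carrier := ?Z'\<rparr>)" by (rule normal_restrict_supergroup[OF sZ' nZ adjoin_superset(1)[OF sZ tc]])
  have cyc: "cyclic_group ((G\<lparr>carrier := ?Z'\<rparr>) Mod Z)"
    by (rule cyclic_series_factor[OF sZ' n adjoin_superset(2)[OF sZ tc]]) (auto simp: adjoin_def)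
  have "(?Hs ! i) \<lhd> (G\<lparr>carrier := ?Hs ! Suc i\<rparr>) \<and> cyclic_group (series_factor G ?Hs i)" if i: "Suc i < length ?Hs" for i
  proof (cases "Suc i < length Hs")
    case True
    then show ?thesis using Hs(5) by (simp add: nth_append series_factor_def)
  next
    case False
    then have len: "Suc i = length Hs" using i by simp
    then have "?Hs ! Suc i = ?Z'" by (simp add: nth_append)
    moreover have "length Hs - 1 = i" "i < length Hs" using len by auto
    then have "?Hs ! i = Z" using Hs(1,3) by (simp add: nth_append last_conv_nth)
    ultimately have "?Hs ! Suc i = ?Z'" "?Hs ! i = Z" by simp_all
    then show ?thesis using n cyc by (simp add: series_factor_def)
  qed
  then show ?case using Hs sZ' by (intro exI[of _ ?Hs]) auto
qed

lemma subnormal_cyclic_series_exists: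
  assumes "finitely_generated_group G" "nilpotent_group G"
  shows "\<exists>Hs. subnormal_cyclic_series G Hs"
  using central_chain_series[OF central_chain_carrier[OF assms]] unfolding subnormal_cyclic_series_def by blast

text \<open>The subgroup \<open>K\<close> meets the chain in a chain with cyclic factors: the exponents of \<open>s\<close> occurring
  in \<open>K\<close> form a subgroup of the integers, and \<open>t\<close> realises its generator.\<close>

lemma intersection_with_adjoin:
  assumes Z: "Z \<lhd> G" and s: "s \<in> carrier G" and K: "subgroup K G"
  obtains t where "t \<in> K \<inter> adjoin Z s" "\<forall>x\<in>K \<inter> adjoin Z s. \<exists>l\<in>K \<inter> Z. \<exists>j::int. x = l \<otimes> t [^] j"
proof -
  interpret Z: normal Z G by fact
  interpret K: subgroup K G by fact
  note iff = adjoin_iff[OF Z.subgroup_axioms s]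
  define J where "J = {i::int. \<exists>x\<in>K. Z #> x = Z #> s [^] i}"
  have divide: "\<exists>l\<in>K \<inter> Z. x = l \<otimes> t [^] q" if x: "x \<in> K" "t \<in> K" "Z #> x = Z #> t [^] q" for x t and q :: int
  proof -
    have xc: "x \<in> carrier G" and tc: "t \<in> carrier G" using x by auto
    obtain l where l: "l \<in> Z" "x = l \<otimes> t [^] q" using r_coset_eq_iff[OF Z.subgroup_axioms xc, of "t [^] q"] tc x(3) by auto
    then have "l = x \<otimes> inv (t [^] q)" using tc by (simp add: m_assoc)
    then have "l \<in> K" using x(1) subgroup_int_pow_closed[OF K x(2)] by simp
    then show ?thesis using l by blast
  qed
  show ?thesis
  proof (cases "\<exists>i\<in>J. i > 0")
    case False
    have J0: "i = 0" if iJ: "i \<in> J" for i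
    proof -
      obtain x where x: "x \<in> K" "Z #> x = Z #> s [^] i" using iJ by (auto simp: J_def)
      have "Z #> inv x = Z #> s [^] (- i)"
        using r_coset_int_pow_cong[OF Z _ _ x(2), of "-1"] x(1) s by (simp add: int_pow_neg)
      then have "- i \<in> J" unfolding J_def using x(1) K.m_inv_closed by blast
      then have "\<not> 0 < i" "\<not> 0 < - i" using False iJ by blast+
      then show ?thesis by simp
    qed
    show ?thesis
    proof (rule that)
      show "\<one> \<in> K \<inter> adjoin Z s" using adjoin_superset(1)[OF Z.subgroup_axioms s] by auto
      show "\<forall>x\<in>K \<inter> adjoin Z s. \<exists>l\<in>K \<inter> Z. \<exists>j::int. x = l \<otimes> \<one> [^] j"
      proof
        fix x assume x: "x \<in> K \<inter> adjoin Z s"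
        then obtain i :: int where i: "Z #> x = Z #> s [^] i" using iff by blast
        then have "i \<in> J" unfolding J_def using x by blast
        then have "i = 0" by (rule J0)
        then have "Z #> x = Z #> \<one> [^] (0::int)" using i by (simp only: int_pow_0)
        then show "\<exists>l\<in>K \<inter> Z. \<exists>j::int. x = l \<otimes> \<one> [^] j" using divide[of x \<one> 0] x K.one_closed by blast
      qed
    qed
  next
    case True
    define d where "d = (LEAST n::nat. n > 0 \<and> int n \<in> J)"
    have "\<exists>n::nat. n > 0 \<and> int n \<in> J" using True by (metis zero_less_imp_eq_int)
    then have d: "d > 0" "int d \<in> J" unfolding d_def by (metis (mono_tags, lifting) LeastI_ex)+
    have dmin: "d \<le> n" if "n > 0" "int n \<in> J" for n unfolding d_def using that by (intro Least_le) simp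
    obtain t where t: "t \<in> K" "Z #> t = Z #> s [^] int d" using d by (auto simp: J_def)
    have tc: "t \<in> carrier G" using t by auto
    have tq: "Z #> t [^] q = Z #> s [^] (int d * q)" for q :: int
      using r_coset_int_pow_cong[OF Z tc _ t(2), of q] s by (simp add: int_pow_pow)
    show ?thesis
    proof (rule that)
      show "t \<in> K \<inter> adjoin Z s" using t iff tc by blast
      show "\<forall>x\<in>K \<inter> adjoin Z s. \<exists>l\<in>K \<inter> Z. \<exists>j::int. x = l \<otimes> t [^] j"
      proof
        fix x assume x: "x \<in> K \<inter> adjoin Z s"
        then obtain i :: int where i: "Z #> x = Z #> s [^] i" using iff by blast
        have xc: "x \<in> carrier G" using x by auto
        define q where "q = i div int d"
        define r where "r = i mod int d"
        have "Z #> (x \<otimes> t [^] (- q)) = (Z #> s [^] i) <#> (Z #> s [^] (int d * (- q)))"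
          using Z.rcos_sum[OF xc int_pow_closed[OF tc], of "- q"] by (simp only: i tq)
        also have "\<dots> = Z #> s [^] (i + int d * (- q))"
          using Z.rcos_sum s int_pow_mult[OF s, of i "int d * (- q)"] by (simp only: int_pow_closed)
        also have "i + int d * (- q) = r" unfolding q_def r_def by (simp add: minus_div_mult_eq_mod[symmetric] mult.commute)
        finally have "r \<in> J" unfolding J_def using x subgroup_int_pow_closed[OF K t(1)] by blast
        moreover have "0 \<le> r" "r < int d" using d(1) by (auto simp: r_def)
        ultimately have "r = 0" using dmin[of "nat r"] by (cases "r = 0") auto
        then have "i = int d * q" unfolding q_def r_def by auto
        then have "Z #> x = Z #> t [^] q" using i tq by simp
        then show "\<exists>l\<in>K \<inter> Z. \<exists>j::int. x = l \<otimes> t [^] j" using divide[of x t q] x t(1) by blast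
      qed
    qed
  qed
qed

end

section \<open>Induction along a series\<close>

context group_cochains
begin

lemma unipotent_on_trivial:
  assumes g: "g \<in> carrier G" shows "unipotent_on {\<one>} g"
  unfolding unipotent_on_def
proof
  fix n
  have K: "{\<one>} \<subseteq> carrier G" by simp
  show "\<exists>m. \<forall>z\<in>cocycles {\<one>} n. (delta g ^^ m) z \<in> coboundaries {\<one>} n"
  proof (cases "n = 1")
    case True
    have "delta g z \<in> coboundaries {\<one>} n" if "z \<in> cocycles {\<one>} n" for z
    proof -
      have z: "z = fscale (z [\<one>]) unit_cocycle" using cocycles_1_eq that True by blast
      have "shift g unit_cocycle = unit_cocycle"
        using g by (auto simp: shift_def unit_cocycle_def fun_eq_iff)
      then have "delta g z = 0" using z by (metis delta_def sh.scale cancel_comm_monoid_add_class.diff_cancel)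
      then show ?thesis using fn.subspace_0[OF subspace_coboundaries] by simp
    qed
    then show ?thesis by (intro exI[of _ 1]) simp
  next
    case False
    have "cocycles {\<one>} n \<subseteq> coboundaries {\<one>} n"
    proof (cases n)
      case 0 then show ?thesis by (simp add: cocycles_0 coboundaries_0)
    next
      case (Suc m) then show ?thesis using cocycles_trivial_group[of m] False by simp
    qed
    then show ?thesis by (intro exI[of _ 0]) auto
  qed
qed

lemma cyclic_extension_intro:
  assumes "subgroup L G" "subgroup M G" "L \<subseteq> M" "t \<in> M" "normalises t L"
    "\<forall>g\<in>M. \<exists>l\<in>L. \<exists>k::int. g = l \<otimes> t [^] k"
  shows "cyclic_extension G L M t"
  using assms by (intro cyclic_extension.intro cyclic_extension_axioms.intro group_cochains_axioms) auto

text \<open>Induction along the chain \<open>K \<inter> Z\<close>, whose factors are cyclic and centralised by \<open>g\<close>.\<close>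

lemma unipotent_on_central_chain:
  assumes K: "subgroup K G" and g: "normalises g K" and Z: "central_chain Z"
  shows "unipotent_on (K \<inter> Z) g"
  using Z
proof (induction rule: central_chain.induct)
  case trivial
  have "K \<inter> {\<one>} = {\<one>}" using subgroup.one_closed[OF K] by blast
  then show ?case using unipotent_on_trivial normalises_carrier[OF g] by simp
next
  case (adjoin Z s)
  have gc: "g \<in> carrier G" using g by (rule normalises_carrier)
  have sc: "s \<in> carrier G" using adjoin.hyps(2) by (simp add: central_modulo_def)
  have nZ: "Z \<lhd> G" by (rule central_chain_normal[OF adjoin.hyps(1)])
  have nZ': "adjoin Z s \<lhd> G" by (rule adjoin_normal[OF nZ adjoin.hyps(2)])
  note sZ = normal_imp_subgroup[OF nZ] and sZ' = normal_imp_subgroup[OF nZ']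
  have inter_norm: "normalises x (K \<inter> N)" if "normalises x K" "N \<lhd> G" for x N
    using that normal.inv_op_closed1[OF that(2), of x] normal.inv_op_closed2[OF that(2), of x] by (auto simp: normalises_def)
  obtain t where t: "t \<in> K \<inter> adjoin Z s" "\<forall>x\<in>K \<inter> adjoin Z s. \<exists>l\<in>K \<inter> Z. \<exists>j::int. x = l \<otimes> t [^] j"
    by (rule intersection_with_adjoin[OF nZ sc K])
  have tc: "t \<in> carrier G" using t(1) subgroup.mem_carrier[OF K] by blast
  have tK: "normalises t K" using t(1) tc K by (auto simp: normalises_def intro!: subgroup.m_closed subgroup.m_inv_closed)
  interpret cyclic_extension G "K \<inter> Z" "K \<inter> adjoin Z s" t
  proof (rule cyclic_extension_intro[OF _ _ _ t(1) _ t(2)])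
    show "subgroup (K \<inter> Z) G" "subgroup (K \<inter> adjoin Z s) G" using K sZ sZ' by (auto intro: subgroups_Inter_pair)
    show "K \<inter> Z \<subseteq> K \<inter> adjoin Z s" using adjoin_superset(1)[OF sZ sc] by blast
    show "normalises t (K \<inter> Z)" by (rule inter_norm[OF tK nZ])
  qed
  have g1: "normalises g (K \<inter> Z)" by (rule inter_norm[OF g nZ])
  have g2: "normalises g (K \<inter> adjoin Z s)" by (rule inter_norm[OF g nZ'])
  have comm: "g \<otimes> t \<otimes> inv g \<otimes> inv t \<in> K \<inter> Z"
  proof
    show "g \<otimes> t \<otimes> inv g \<otimes> inv t \<in> Z" using adjoin_central_modulo[OF nZ adjoin.hyps(2) _ gc] t(1) by blast
    have "g \<otimes> t \<otimes> inv g \<in> K" using g t(1) by (auto simp: normalises_def)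
    moreover have "inv t \<in> K" using t(1) subgroup.m_inv_closed[OF K] by blast
    ultimately show "g \<otimes> t \<otimes> inv g \<otimes> inv t \<in> K" by (rule subgroup.m_closed[OF K])
  qed
  show ?case
  proof (cases "\<exists>k::nat. k > 0 \<and> t [^] k \<in> K \<inter> Z")
    case True
    then obtain k :: nat where k: "k > 0" "t [^] k \<in> K \<inter> Z" by blast
    interpret finite_cyclic_extension G "K \<inter> Z" "K \<inter> adjoin Z s" t k by unfold_locales (fact k)+
    show ?thesis by (rule unipotent_on_M[OF g2 adjoin.IH])
  next
    case False
    interpret infinite_cyclic_extension G "K \<inter> Z" "K \<inter> adjoin Z s" t by unfold_locales (use False in blast)
    show ?thesis by (rule unipotent_on_M[OF g1 g2 comm adjoin.IH])
  qed
qed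

text \<open>The inequality arises at the infinite step that raises the count from four to five, and finite steps
  preserve it.\<close>

lemma duality_along_series:
  assumes Z: "central_chain (carrier G)" and Hs: "subnormal_cyclic_series G Hs" and i: "i < length Hs"
  defines "h \<equiv> card {j. j < i \<and> infinite (carrier (series_factor G Hs j))}"
  shows "duality (Hs ! i) h \<and> (h = 5 \<longrightarrow> H_dim (Hs ! i) 2 < H_dim (Hs ! i) 3)"
  using i unfolding h_def
proof (induction i)
  case 0
  have "Hs ! 0 = {\<one>}" using Hs hd_conv_nth[of Hs] by (simp add: subnormal_cyclic_series_def)
  then show ?case using duality_trivial_group by simp
next
  case (Suc i)
  define c where "c i = card {j. j < i \<and> infinite (carrier (series_factor G Hs j))}" for i
  let ?L = "Hs ! i" and ?M = "Hs ! Suc i"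
  have IH: "duality ?L (c i)" "c i = 5 \<Longrightarrow> H_dim ?L 2 < H_dim ?L 3"
    using Suc by (auto simp: c_def)
  have sL: "subgroup ?L G" and sM: "subgroup ?M G" and n: "?L \<lhd> (G\<lparr>carrier := ?M\<rparr>)"
    and cyc: "cyclic_group (series_factor G Hs i)"
    using Hs Suc.prems by (auto simp: subnormal_cyclic_series_def)
  obtain t where t: "t \<in> ?M" "\<forall>g\<in>?M. \<exists>l\<in>?L. \<exists>i::int. g = l \<otimes> t [^] i"
    "\<forall>l\<in>?L. t \<otimes> l \<otimes> inv t \<in> ?L \<and> inv t \<otimes> l \<otimes> t \<in> ?L"
    "finite (carrier ((G\<lparr>carrier := ?M\<rparr>) Mod ?L)) \<longleftrightarrow> (\<exists>k::nat. k > 0 \<and> t [^] k \<in> ?L)"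
    by (rule cyclic_series_factor_generator[OF sM n cyc[unfolded series_factor_def]])
  have LM: "?L \<subseteq> ?M" using subgroup.subset[OF normal_imp_subgroup[OF n]] by simp
  have tc: "t \<in> carrier G" using t(1) subgroup.mem_carrier[OF sM] by blast
  have nt: "normalises t ?L" using t(3) tc by (auto simp: normalises_def)
  interpret cyclic_extension G ?L ?M t by (rule cyclic_extension_intro[OF sL sM LM t(1) nt t(2)])
  have "unipotent_on (?L \<inter> carrier G) t" by (rule unipotent_on_central_chain[OF sL nt Z])
  then have unip: "unipotent_on ?L t" using L_carrier by (simp add: Int_absorb2)
  have fin: "finite {j. j < i \<and> infinite (carrier (series_factor G Hs j))}" by simp
  show ?case
  proof (cases "\<exists>k::nat. k > 0 \<and> t [^] k \<in> ?L")
    case True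
    then obtain k :: nat where k: "k > 0" "t [^] k \<in> ?L" by blast
    interpret finite_cyclic_extension G ?L ?M t k by unfold_locales (fact k)+
    have "finite (carrier (series_factor G Hs i))" using t(4) True by (simp add: series_factor_def)
    then have "{j. j < Suc i \<and> infinite (carrier (series_factor G Hs j))} = {j. j < i \<and> infinite (carrier (series_factor G Hs j))}"
      by (auto simp: less_Suc_eq)
    then have "c (Suc i) = c i" by (simp add: c_def)
    then show ?thesis
      using duality_M[OF IH(1) unip] IH(2) qdim_M(2)[OF unip duality_finite[OF IH(1)]] by (simp add: c_def[symmetric])
  next
    case False
    interpret infinite_cyclic_extension G ?L ?M t by unfold_locales (use False in blast)
    have "infinite (carrier (series_factor G Hs i))" using t(4) False by (simp add: series_factor_def)
    then have "{j. j < Suc i \<and> infinite (carrier (series_factor G Hs j))} = insert i {j. j < i \<and> infinite (carrier (series_factor G Hs j))}"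
      by (auto simp: less_Suc_eq)
    then have "c (Suc i) = Suc (c i)" using fin by (simp add: c_def)
    then show ?thesis
      using duality_M[OF IH(1) unip] second_betti_exceeds_first[OF _ unip] IH(1) by (auto simp: c_def[symmetric])
  qed
qed

lemma second_betti_exceeds_first_cohomology:
  assumes fg: "finitely_generated_group G" and nil: "nilpotent_group G" and h: "hirsch_length G = 5"
  shows "duality (carrier G) 5" "H_dim (carrier G) 2 < H_dim (carrier G) 3"
proof -
  define Hs where "Hs = (SOME Hs. subnormal_cyclic_series G Hs)"
  have Hs: "subnormal_cyclic_series G Hs" unfolding Hs_def by (rule someI_ex[OF subnormal_cyclic_series_exists[OF fg nil]])
  have ne: "Hs \<noteq> []" and last: "Hs ! (length Hs - 1) = carrier G"
    using Hs by (auto simp: subnormal_cyclic_series_def last_conv_nth)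
  have "{j. j < length Hs - 1 \<and> infinite (carrier (series_factor G Hs j))} = {j. Suc j < length Hs \<and> infinite (carrier (series_factor G Hs j))}"
    by auto
  then have "card {j. j < length Hs - 1 \<and> infinite (carrier (series_factor G Hs j))} = 5"
    using h by (simp add: hirsch_length_def num_infinite_factors_def Hs_def)
  then show "duality (carrier G) 5" "H_dim (carrier G) 2 < H_dim (carrier G) 3"
    using duality_along_series[OF central_chain_carrier[OF fg nil] Hs, of "length Hs - 1"] ne last by simp_all
qed

end

section \<open>Cochains compute the Betti numbers\<close>

interpretation pm: subquotients "scale_chain :: rat \<Rightarrow> ('x \<Rightarrow>\<^sub>0 rat) \<Rightarrow> ('x \<Rightarrow>\<^sub>0 rat)"
  by unfold_locales (auto intro!: poly_mapping_eqI simp: lookup_add algebra_simps)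

lemma linear_bar_boundary: "Vector_Spaces.linear scale_chain scale_chain (bar_boundary G)"
  by (simp add: Vector_Spaces.linear_iff pm.vector_space_axioms bar_boundary_add bar_boundary_scale)

lemma subspace_bar_chains: "pm.subspace (bar_chains G n)"
  by (auto simp: pm.subspace_def bar_chains_0 bar_chains_add bar_chains_scale)

lemma subspace_bar_cycles: "pm.subspace (bar_cycles G n)"
  by (auto simp: pm.subspace_def bar_cycles_def bar_chains_0 bar_chains_add bar_chains_scale bar_boundary_add bar_boundary_scale)

lemma subspace_bar_boundaries: "pm.subspace (bar_boundaries G n)"
proof -
  interpret d: Vector_Spaces.linear scale_chain scale_chain "bar_boundary G" by (rule linear_bar_boundary)
  show ?thesis unfolding bar_boundaries_def by (rule d.subspace_image[OF subspace_bar_chains])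
qed

text \<open>The elements of \<open>group_homology\<close>, written without the record of the chain space.\<close>

definition bar_coset :: "('a, 'b) monoid_scheme \<Rightarrow> nat \<Rightarrow> ('a list \<Rightarrow>\<^sub>0 rat) \<Rightarrow> ('a list \<Rightarrow>\<^sub>0 rat) set"
  where "bar_coset G n c = (\<lambda>b. b + c) ` bar_boundaries G n"

lemma bar_coset_eq_iff: "bar_coset G n c = bar_coset G n c' \<longleftrightarrow> c - c' \<in> bar_boundaries G n"
proof
  assume eq: "bar_coset G n c = bar_coset G n c'"
  have "0 + c \<in> bar_coset G n c" unfolding bar_coset_def using pm.subspace_0[OF subspace_bar_boundaries] by blast
  then obtain b where "b \<in> bar_boundaries G n" "0 + c = b + c'" unfolding eq by (auto simp: bar_coset_def)
  then show "c - c' \<in> bar_boundaries G n" by simp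
next
  assume d: "c - c' \<in> bar_boundaries G n"
  have "bar_coset G n x \<subseteq> bar_coset G n y" if "x - y \<in> bar_boundaries G n" for x y
  proof
    fix z assume "z \<in> bar_coset G n x"
    then obtain b where b: "b \<in> bar_boundaries G n" "z = b + x" by (auto simp: bar_coset_def)
    then have "z = (b + (x - y)) + y" by simp
    moreover have "b + (x - y) \<in> bar_boundaries G n" by (rule pm.subspace_add[OF subspace_bar_boundaries b(1) that])
    ultimately show "z \<in> bar_coset G n y" unfolding bar_coset_def by blast
  qed
  moreover have "c' - c \<in> bar_boundaries G n" using pm.subspace_neg[OF subspace_bar_boundaries d] by simp
  ultimately show "bar_coset G n c = bar_coset G n c'" using d by blast
qed

lemma group_homology_r_coset: "bar_boundaries G n +>\<^bsub>chain_space\<lparr>carrier := Z\<rparr>\<^esub> c = bar_coset G n c"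
  by (auto simp: a_r_coset_def' bar_coset_def chain_space_def)

lemma group_homology_carrier: "carrier (group_homology G n) = bar_coset G n ` bar_cycles G n"
proof -
  have "carrier (group_homology G n) = (\<Union>c\<in>bar_cycles G n. {bar_coset G n c})"
    by (simp add: group_homology_def quotient_module_def A_RCOSETS_def' group_homology_r_coset)
  then show ?thesis by blast
qed

lemma group_homology_add: "bar_coset G n c \<oplus>\<^bsub>group_homology G n\<^esub> bar_coset G n c' = bar_coset G n (c + c')"
proof -
  let ?B = "bar_boundaries G n"
  have "bar_coset G n c \<oplus>\<^bsub>group_homology G n\<^esub> bar_coset G n c' = {h + k | h k. h \<in> bar_coset G n c \<and> k \<in> bar_coset G n c'}"
    by (auto simp: group_homology_def quotient_module_def set_add_def set_mult_def chain_space_def)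
  also have "\<dots> = bar_coset G n (c + c')"
  proof
    show "{h + k | h k. h \<in> bar_coset G n c \<and> k \<in> bar_coset G n c'} \<subseteq> bar_coset G n (c + c')"
    proof
      fix z assume "z \<in> {h + k | h k. h \<in> bar_coset G n c \<and> k \<in> bar_coset G n c'}"
      then obtain b b' where b: "b \<in> ?B" "b' \<in> ?B" "z = (b + c) + (b' + c')" by (auto simp: bar_coset_def)
      then have "z = (b + b') + (c + c')" "b + b' \<in> ?B" using pm.subspace_add[OF subspace_bar_boundaries] by auto
      then show "z \<in> bar_coset G n (c + c')" unfolding bar_coset_def by blast
    qed
    show "bar_coset G n (c + c') \<subseteq> {h + k | h k. h \<in> bar_coset G n c \<and> k \<in> bar_coset G n c'}"
    proof
      fix z assume "z \<in> bar_coset G n (c + c')"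
      then obtain b where b: "b \<in> ?B" "z = b + (c + c')" by (auto simp: bar_coset_def)
      then have "z = (b + c) + (0 + c')" by (simp add: add.assoc)
      moreover have "b + c \<in> bar_coset G n c" using b by (auto simp: bar_coset_def)
      moreover have "0 + c' \<in> bar_coset G n c'" unfolding bar_coset_def using pm.subspace_0[OF subspace_bar_boundaries] by blast
      ultimately show "z \<in> {h + k | h k. h \<in> bar_coset G n c \<and> k \<in> bar_coset G n c'}" by blast
    qed
  qed
  finally show ?thesis .
qed

lemma group_homology_smult: "k \<odot>\<^bsub>group_homology G n\<^esub> bar_coset G n c = bar_coset G n (scale_chain k c)"
proof -
  have "k \<odot>\<^bsub>group_homology G n\<^esub> bar_coset G n c = (\<Union>x\<in>bar_coset G n c. bar_coset G n (scale_chain k x))"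
    by (simp add: group_homology_def quotient_module_def group_homology_r_coset chain_space_def[of] del: UN_simps)
       (simp add: group_homology_r_coset[unfolded chain_space_def, simplified])
  also have "\<dots> = (\<Union>x\<in>bar_coset G n c. bar_coset G n (scale_chain k c))"
  proof (rule SUP_cong[OF refl])
    fix x assume "x \<in> bar_coset G n c"
    then obtain b where b: "b \<in> bar_boundaries G n" "x = b + c" by (auto simp: bar_coset_def)
    have "scale_chain k x - scale_chain k c = scale_chain k b" using b by (simp add: pm.scale_right_distrib)
    moreover have "scale_chain k b \<in> bar_boundaries G n" by (rule pm.subspace_scale[OF subspace_bar_boundaries b(1)])
    ultimately show "bar_coset G n (scale_chain k x) = bar_coset G n (scale_chain k c)" by (simp add: bar_coset_eq_iff)
  qed
  also have "bar_coset G n c \<noteq> {}" unfolding bar_coset_def using pm.subspace_0[OF subspace_bar_boundaries] by blast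
  then have "(\<Union>x\<in>bar_coset G n c. bar_coset G n (scale_chain k c)) = bar_coset G n (scale_chain k c)" by simp
  finally show ?thesis .
qed

text \<open>The coordinates \<open>\<phi> i\<close> identify the homology with \<open>\<rat>\<^sup>d\<close>.\<close>

lemma betti_eqI:
  fixes d :: nat and G :: "('a, 'b) monoid_scheme"
  assumes G: "group G"
    and f: "\<And>i. i < d \<Longrightarrow> f i \<in> bar_cycles G n"
    and lin: "\<And>i. i < d \<Longrightarrow> Vector_Spaces.linear scale_chain (*) (\<phi> i)"
    and kill: "\<And>i b. i < d \<Longrightarrow> b \<in> bar_boundaries G n \<Longrightarrow> \<phi> i b = 0"
    and dual: "\<And>i j. i < d \<Longrightarrow> j < d \<Longrightarrow> \<phi> i (f j) = (if i = j then 1 else 0)"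
    and gen: "\<And>y. y \<in> bar_cycles G n \<Longrightarrow> y - (\<Sum>i<d. scale_chain (\<phi> i y) (f i)) \<in> bar_boundaries G n"
  shows "betti G n = d"
proof -
  let ?H = "group_homology G n"
  define s where "s v = (\<Sum>i<d. scale_chain (v $ i) (f i))" for v :: "rat vec"
  define T where "T v = bar_coset G n (s v)" for v :: "rat vec"
  have sZ: "s v \<in> bar_cycles G n" for v
    unfolding s_def using f by (intro pm.subspace_sum[OF subspace_bar_cycles] pm.subspace_scale[OF subspace_bar_cycles]) auto
  have phis: "\<phi> i (s v) = v $ i" if i: "i < d" for i v
  proof -
    interpret l: Vector_Spaces.linear scale_chain "(*)" "\<phi> i" by (rule lin[OF i])
    have "\<phi> i (s v) = (\<Sum>j<d. v $ j * \<phi> i (f j))" by (simp add: s_def l.sum l.scale)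
    also have "\<dots> = (\<Sum>j<d. if j = i then v $ i else 0)" by (rule sum.cong) (auto simp: dual i)
    finally show ?thesis using i by simp
  qed
  have s_add: "s (v + w) = s v + s w" if "v \<in> carrier_vec d" "w \<in> carrier_vec d" for v w
    using that by (simp add: s_def pm.scale_left_distrib sum.distrib[symmetric])
  have s_smult: "s (k \<cdot>\<^sub>v v) = scale_chain k (s v)" if "v \<in> carrier_vec d" for k v
  proof -
    have "s (k \<cdot>\<^sub>v v) = (\<Sum>i<d. scale_chain (k * v $ i) (f i))" unfolding s_def by (rule sum.cong) (use that in auto)
    also have "\<dots> = scale_chain k (s v)" by (simp add: s_def pm.scale_sum_right)
    finally show ?thesis .
  qed
  interpret vs: vec_space "TYPE(rat)" d .
  have lm: "linear_map class_ring (module_vec TYPE(rat) d) ?H T"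
  proof (rule linear_map.intro)
    show "vectorspace class_ring (module_vec TYPE(rat) d)" by (rule vs.vectorspace_axioms)
    show vH: "vectorspace class_ring ?H" by (rule group_homology_vectorspace[OF G])
    have "T \<in> LinearCombinations.module_hom class_ring (module_vec TYPE(rat) d) ?H"
      unfolding LinearCombinations.module_hom_def
      using sZ by (auto simp: T_def group_homology_carrier module_vec_def s_add s_smult group_homology_add group_homology_smult)
    then show "mod_hom class_ring (module_vec TYPE(rat) d) ?H T"
      by (intro mod_hom.intro mod_hom_axioms.intro vs.module_axioms vectorspace.axioms(1)[OF vH])
  qed
  have inj: "inj_on T (carrier (module_vec TYPE(rat) d))"
  proof (rule inj_onI)
    fix v w assume v: "v \<in> carrier (module_vec TYPE(rat) d)" and w: "w \<in> carrier (module_vec TYPE(rat) d)" and eq: "T v = T w"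
    have d: "s v - s w \<in> bar_boundaries G n" using eq by (simp add: T_def bar_coset_eq_iff)
    have "v $ i = w $ i" if i: "i < d" for i
    proof -
      interpret l: Vector_Spaces.linear scale_chain "(*)" "\<phi> i" by (rule lin[OF i])
      have "\<phi> i (s v) - \<phi> i (s w) = 0" using kill[OF i d] by (simp add: l.diff)
      then show ?thesis using phis[OF i] by simp
    qed
    then show "v = w" using v w by (intro eq_vecI) (auto simp: module_vec_def)
  qed
  have surj: "T ` carrier (module_vec TYPE(rat) d) = carrier ?H"
  proof
    show "T ` carrier (module_vec TYPE(rat) d) \<subseteq> carrier ?H" using sZ by (auto simp: T_def group_homology_carrier)
    show "carrier ?H \<subseteq> T ` carrier (module_vec TYPE(rat) d)"
    proof
      fix X assume "X \<in> carrier ?H"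
      then obtain y where y: "y \<in> bar_cycles G n" "X = bar_coset G n y" by (auto simp: group_homology_carrier)
      have "s (vec d (\<lambda>i. \<phi> i y)) = (\<Sum>i<d. scale_chain (\<phi> i y) (f i))" by (simp add: s_def)
      then have "X = T (vec d (\<lambda>i. \<phi> i y))" using gen[OF y(1)] y(2) by (simp add: T_def bar_coset_eq_iff)
      then show "X \<in> T ` carrier (module_vec TYPE(rat) d)" by (auto simp: module_vec_def)
    qed
  qed
  have "vectorspace.dim class_ring (module_vec TYPE(rat) d) = vectorspace.dim class_ring ?H"
    by (rule linear_map.dim_eq[OF lm vs.fin_dim inj surj])
  then show ?thesis using vs.dim_is_n by (simp add: betti_def)
qed

context group_cochains
begin

primrec partial_products :: "'a \<Rightarrow> 'a list \<Rightarrow> 'a list"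
  where
    "partial_products x [] = [x]"
  | "partial_products x (g # gs) = x # partial_products (x \<otimes> g) gs"

fun quotients :: "'a list \<Rightarrow> 'a list"
  where
    "quotients (x # y # ys) = (inv x \<otimes> y) # quotients (y # ys)"
  | "quotients xs = []"

lemma length_partial_products [simp]: "length (partial_products x gs) = Suc (length gs)"
  by (induction gs arbitrary: x) auto

lemma partial_products_carrier: "x \<in> carrier G \<Longrightarrow> set gs \<subseteq> carrier G \<Longrightarrow> set (partial_products x gs) \<subseteq> carrier G"
  by (induction gs arbitrary: x) auto

lemma partial_products_mult:
  "h \<in> carrier G \<Longrightarrow> x \<in> carrier G \<Longrightarrow> set gs \<subseteq> carrier G \<Longrightarrow>
    partial_products (h \<otimes> x) gs = map ((\<otimes>) h) (partial_products x gs)"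
  by (induction gs arbitrary: x) (auto simp: m_assoc)

lemma hd_partial_products: "\<exists>ys. partial_products x gs = x # ys"
  by (cases gs) auto

lemma partial_products_bar_face:
  assumes "x \<in> carrier G" "set gs \<subseteq> carrier G" "i < length gs"
  shows "partial_products x (bar_face G (Suc i) gs) = skip (Suc i) (partial_products x gs)"
  using assms
proof (induction gs arbitrary: x i)
  case (Cons g gs)
  show ?case
  proof (cases gs)
    case Nil
    then show ?thesis using Cons.prems by (simp add: bar_face_Suc_single skip_def)
  next
    case (Cons h ys)
    show ?thesis
    proof (cases i)
      case 0
      then show ?thesis using Cons Cons.prems by (simp add: bar_face_1 skip_def m_assoc)
    next
      case (Suc j)
      have "partial_products (x \<otimes> g) (bar_face G (Suc j) gs) = skip (Suc j) (partial_products (x \<otimes> g) gs)"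
        using Cons.IH[of "x \<otimes> g" j] Cons.prems Suc by simp
      then show ?thesis using Cons Suc Cons.prems by (simp add: bar_face_SS skip_def)
    qed
  qed
qed simp

lemma quotients_partial_products:
  "x \<in> carrier G \<Longrightarrow> set gs \<subseteq> carrier G \<Longrightarrow> quotients (partial_products x gs) = gs"
proof (induction gs arbitrary: x)
  case (Cons g gs)
  obtain ys where ys: "partial_products (x \<otimes> g) gs = (x \<otimes> g) # ys" using hd_partial_products by blast
  have "quotients ((x \<otimes> g) # ys) = gs" using Cons.IH[of "x \<otimes> g"] Cons.prems ys by simp
  then show ?case using Cons.prems by (simp add: ys inv_mult_cancel_left)
qed simp

lemma length_quotients: "length (quotients xs) = length xs - 1"
  by (induction xs rule: quotients.induct) auto

lemma quotients_carrier: "set xs \<subseteq> carrier G \<Longrightarrow> set (quotients xs) \<subseteq> carrier G"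
  by (induction xs rule: quotients.induct) auto

lemma quotients_mult: "h \<in> carrier G \<Longrightarrow> set xs \<subseteq> carrier G \<Longrightarrow> quotients (map ((\<otimes>) h) xs) = quotients xs"
  by (induction xs rule: quotients.induct) (auto simp: inv_mult_group m_assoc inv_mult_cancel_left)

lemma partial_products_quotients:
  "set (x # xs) \<subseteq> carrier G \<Longrightarrow> partial_products x (quotients (x # xs)) = x # xs"
proof (induction xs arbitrary: x)
  case (Cons y ys)
  then show ?case using Cons.IH[of y] by (simp add: mult_inv_cancel_left)
qed simp

text \<open>The symbol \<open>[g\<^sub>1|\<dots>|g\<^sub>n]\<close> stands for the orbit of the tuple \<open>(1, g\<^sub>1, g\<^sub>1 g\<^sub>2, \<dots>)\<close>.\<close>

definition evaluate :: "('a list \<Rightarrow> rat) \<Rightarrow> ('a list \<Rightarrow>\<^sub>0 rat) \<Rightarrow> rat"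
  where "evaluate f c = (\<Sum>gs\<in>Poly_Mapping.keys c. Poly_Mapping.lookup c gs * f (partial_products \<one> gs))"

lemma evaluate_superset:
  assumes "finite S" "Poly_Mapping.keys c \<subseteq> S"
  shows "evaluate f c = (\<Sum>gs\<in>S. Poly_Mapping.lookup c gs * f (partial_products \<one> gs))"
  unfolding evaluate_def by (rule sum.mono_neutral_left) (use assms in \<open>auto simp: in_keys_iff\<close>)

lemma evaluate_add: "evaluate f (c + d) = evaluate f c + evaluate f d"
proof -
  let ?S = "Poly_Mapping.keys c \<union> Poly_Mapping.keys d"
  have S: "finite ?S" by simp
  show ?thesis
    using evaluate_superset[OF S, of "c + d"] evaluate_superset[OF S, of c] evaluate_superset[OF S, of d] Poly_Mapping.keys_add[of c d]
    by (simp add: lookup_add sum.distrib algebra_simps)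
qed

lemma evaluate_scale: "evaluate f (scale_chain q c) = q * evaluate f c"
  using evaluate_superset[OF finite_keys[of c], of "scale_chain q c" f] keys_scale_chain[of q c]
  by (simp add: evaluate_def sum_distrib_left mult.assoc)

lemma evaluate_pairing: "pairing fscale (scale_chain :: rat \<Rightarrow> ('a list \<Rightarrow>\<^sub>0 rat) \<Rightarrow> _) evaluate"
proof (intro pairing.intro pairing_axioms.intro fn.subquotients_axioms pm.subquotients_axioms)
  show "Vector_Spaces.linear fscale (*) (\<lambda>f. evaluate f y)" for y
    by (rule linear_functionalI) (auto simp: evaluate_def fscale_def algebra_simps sum.distrib sum_distrib_left)
  show "Vector_Spaces.linear scale_chain (*) (evaluate x)" for x
    by (simp add: Vector_Spaces.linear_iff pm.vector_space_axioms vector_space_field evaluate_add evaluate_scale)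
qed

sublocale ev: pairing fscale "scale_chain :: rat \<Rightarrow> ('a list \<Rightarrow>\<^sub>0 rat) \<Rightarrow> _" evaluate
  by (rule evaluate_pairing)

lemma evaluate_single: "evaluate f (Poly_Mapping.single gs q) = q * f (partial_products \<one> gs)"
  by (cases "q = 0") (auto simp: evaluate_def)

text \<open>Deleting an entry \<open>i > 0\<close> of the tuple of partial products merges or drops bar entries as the \<open>i\<close>-th face
  does.  Deleting the entry \<open>0\<close> leaves the tuple of the \<open>0\<close>-th face translated by \<open>g\<^sub>1\<close>, which an invariant
  cochain does not notice.\<close>

lemma evaluate_boundary_symbol:
  assumes f: "f \<in> cochains (carrier G) n" and gs: "length gs = n" "set gs \<subseteq> carrier G" and n: "n > 0"
  shows "evaluate f (bar_boundary_symbol G gs) = cobd f (partial_products \<one> gs)"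
proof -
  have ne: "gs \<noteq> []" using gs n by auto
  have 0: "f (partial_products \<one> (bar_face G 0 gs)) = f (skip 0 (partial_products \<one> gs))"
  proof -
    obtain g hs where ghs: "gs = g # hs" using ne by (cases gs) auto
    then have car: "g \<in> carrier G" "set hs \<subseteq> carrier G" using gs by auto
    have "skip 0 (partial_products \<one> gs) = map ((\<otimes>) g) (partial_products \<one> hs)"
      using partial_products_mult[of g \<one> hs] car by (simp add: ghs skip_def)
    then show ?thesis
      using cochains_invariant[OF f car(1) partial_products_carrier[OF one_closed car(2)]] by (simp add: ghs)
  qed
  have "evaluate f (bar_boundary_symbol G gs) = (\<Sum>i\<le>length gs. (-1) ^ i * f (partial_products \<one> (bar_face G i gs)))"
    using ne by (simp add: bar_boundary_symbol_def ev.sum_right evaluate_single)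
  also have "\<dots> = (\<Sum>i\<le>length gs. (-1) ^ i * f (skip i (partial_products \<one> gs)))"
  proof (rule sum.cong[OF refl])
    fix i assume i: "i \<in> {..length gs}"
    show "(-1) ^ i * f (partial_products \<one> (bar_face G i gs)) = (-1) ^ i * f (skip i (partial_products \<one> gs))"
    proof (cases i)
      case 0
      then show ?thesis using \<open>f (partial_products \<one> (bar_face G 0 gs)) = _\<close> by simp
    next
      case (Suc j)
      then show ?thesis using partial_products_bar_face[OF one_closed gs(2), of j] i by simp
    qed
  qed
  also have "\<dots> = cobd f (partial_products \<one> gs)"
    using partial_products_carrier[OF one_closed gs(2)] by (simp add: cobd_def lessThan_Suc_atMost)
  finally show ?thesis .
qed

lemma evaluate_boundary:
  assumes f: "f \<in> cochains (carrier G) n" and c: "c \<in> bar_chains G n" and n: "n > 0"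
  shows "evaluate f (bar_boundary G c) = evaluate (cobd f) c"
proof -
  have "evaluate f (bar_boundary G c) = (\<Sum>gs\<in>Poly_Mapping.keys c. Poly_Mapping.lookup c gs * evaluate f (bar_boundary_symbol G gs))"
    unfolding bar_boundary_def by (simp add: ev.sum_right ev.scale_right)
  also have "\<dots> = evaluate (cobd f) c"
    unfolding evaluate_def[of "cobd f"]
    by (rule sum.cong[OF refl]) (use c evaluate_boundary_symbol[OF f _ _ n] in \<open>auto simp: bar_chains_def\<close>)
  finally show ?thesis .
qed

lemma cochain_eqI:
  assumes f: "f \<in> cochains (carrier G) (Suc n)" and f': "f' \<in> cochains (carrier G) (Suc n)"
    and eq: "\<And>c. c \<in> bar_chains G n \<Longrightarrow> evaluate f c = evaluate f' c"
  shows "f = f'"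
proof
  fix xs
  show "f xs = f' xs"
  proof (cases "length xs = Suc n \<and> set xs \<subseteq> carrier G")
    case True
    then obtain x ys where xs: "xs = x # ys" by (cases xs) auto
    have xc: "x \<in> carrier G" using True xs by simp
    let ?gs = "quotients xs"
    have gs: "set ?gs \<subseteq> carrier G" "length ?gs = n" using True quotients_carrier length_quotients[of xs] by auto
    have "xs = map ((\<otimes>) x) (partial_products \<one> ?gs)"
      using partial_products_quotients[of x ys] partial_products_mult[OF xc one_closed gs(1)] True xs xc by simp
    then have *: "u xs = u (partial_products \<one> ?gs)" if "u \<in> cochains (carrier G) (Suc n)" for u
      using cochains_invariant[OF that xc partial_products_carrier[OF one_closed gs(1)]] by metis
    have "Poly_Mapping.single ?gs 1 \<in> bar_chains G n" using gs by (simp add: bar_chains_def)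
    then show ?thesis using eq[of "Poly_Mapping.single ?gs 1"] *[OF f] *[OF f'] by (simp add: evaluate_single)
  next
    case False
    then show ?thesis using cochains_support[OF f, of xs] cochains_support[OF f', of xs] by auto
  qed
qed

lemma represent_functional_by_cochain:
  assumes lin: "Vector_Spaces.linear scale_chain (*) \<phi>"
  obtains f where "f \<in> cochains (carrier G) (Suc n)" "\<forall>c\<in>bar_chains G n. evaluate f c = \<phi> c"
proof -
  interpret l: Vector_Spaces.linear scale_chain "(*)" \<phi> by fact
  define f where "f xs = (if length xs = Suc n \<and> set xs \<subseteq> carrier G then \<phi> (Poly_Mapping.single (quotients xs) 1) else 0)" for xs
  show ?thesis
  proof (rule that)
    show "f \<in> cochains (carrier G) (Suc n)"
    proof (rule cochainsI)
      fix xs assume "f xs \<noteq> 0"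
      then show "xs \<noteq> [] \<and> length xs = Suc n \<and> set xs \<subseteq> carrier G" by (auto simp: f_def split: if_splits)
    next
      fix k assume k: "k \<in> carrier G"
      show "shift k f = f"
      proof
        fix xs
        show "shift k f xs = f xs"
          using mem_carrier_of_mult[OF k, of xs] quotients_mult[OF k, of xs] by (auto simp: shift_def f_def)
      qed
    qed
    show "\<forall>c\<in>bar_chains G n. evaluate f c = \<phi> c"
    proof
      fix c assume c: "c \<in> bar_chains G n"
      have "evaluate f c = (\<Sum>gs\<in>Poly_Mapping.keys c. Poly_Mapping.lookup c gs * \<phi> (Poly_Mapping.single gs 1))"
        unfolding evaluate_def
      proof (rule sum.cong[OF refl])
        fix gs assume "gs \<in> Poly_Mapping.keys c"
        then have gs: "length gs = n" "set gs \<subseteq> carrier G" using c by (auto simp: bar_chains_def)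
        then have "f (partial_products \<one> gs) = \<phi> (Poly_Mapping.single gs 1)"
          using quotients_partial_products[OF one_closed gs(2)] partial_products_carrier[OF one_closed gs(2)] by (simp add: f_def)
        then show "Poly_Mapping.lookup c gs * f (partial_products \<one> gs) = Poly_Mapping.lookup c gs * \<phi> (Poly_Mapping.single gs 1)" by simp
      qed
      also have "\<dots> = \<phi> (\<Sum>gs\<in>Poly_Mapping.keys c. scale_chain (Poly_Mapping.lookup c gs) (Poly_Mapping.single gs 1))"
        by (simp only: l.sum l.scale)
      also have "(\<Sum>gs\<in>Poly_Mapping.keys c. scale_chain (Poly_Mapping.lookup c gs) (Poly_Mapping.single gs 1)) = c"
      proof (rule poly_mapping_eqI)
        fix xs
        have "(\<Sum>gs\<in>Poly_Mapping.keys c. Poly_Mapping.lookup c gs * (1 when gs = xs)) =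
          (\<Sum>gs\<in>Poly_Mapping.keys c. if gs = xs then Poly_Mapping.lookup c xs else 0)"
          by (rule sum.cong) (auto simp: when_def)
        then show "Poly_Mapping.lookup (\<Sum>gs\<in>Poly_Mapping.keys c. scale_chain (Poly_Mapping.lookup c gs) (Poly_Mapping.single gs 1)) xs
            = Poly_Mapping.lookup c xs"
          by (simp only: lookup_sum lookup_scale_chain lookup_single) (simp add: in_keys_iff)
      qed
      finally show "evaluate f c = \<phi> c" .
    qed
  qed
qed

lemma bar_cyclesD: "c \<in> bar_cycles G n \<Longrightarrow> c \<in> bar_chains G n" "c \<in> bar_cycles G n \<Longrightarrow> bar_boundary G c = 0"
  by (auto simp: bar_cycles_def)

text \<open>Evaluation is a perfect pairing between cohomology and homology.  A cocycle vanishing on all cycles is a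
  functional of the boundary, and a cycle that does not bound is detected by a functional vanishing on
  boundaries, which is evaluation of a cocycle.\<close>

theorem betti_eq_qdim:
  assumes n: "n > 0" and fin: "H_finite (carrier G) (Suc n)"
  shows "betti G n = H_dim (carrier G) (Suc n)"
proof -
  let ?Z = "cocycles (carrier G) (Suc n)" and ?B = "coboundaries (carrier G) (Suc n)"
  have grp: "group G" by (rule group_axioms)
  have kill: "evaluate b c = 0" if b: "b \<in> ?B" and c: "c \<in> bar_cycles G n" for b c
  proof -
    obtain g where g: "g \<in> cochains (carrier G) n" "b = cobd g" using b by (auto simp: coboundaries_Suc)
    have "evaluate b c = evaluate g (bar_boundary G c)"
      unfolding g(2) by (rule evaluate_boundary[OF g(1) bar_cyclesD(1)[OF c] n, symmetric])
    then show ?thesis using bar_cyclesD(2)[OF c] by (simp add: ev.zero_right)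
  qed
  have kill': "evaluate f b = 0" if f: "f \<in> ?Z" and b: "b \<in> bar_boundaries G n" for f b
  proof -
    obtain c where c: "c \<in> bar_chains G (Suc n)" "b = bar_boundary G c" using b by (auto simp: bar_boundaries_def)
    have "evaluate f b = evaluate (cobd f) c"
      unfolding c(2) by (rule evaluate_boundary[OF cocyclesD(1)[OF f] c(1)]) simp
    then show ?thesis using cocyclesD(2)[OF f] by (simp add: ev.zero_left)
  qed
  have nondeg: "f \<in> ?B" if f: "f \<in> ?Z" and 0: "\<And>c. c \<in> bar_cycles G n \<Longrightarrow> evaluate f c = 0" for f
  proof -
    \<comment> \<open>\<open>f\<close> factors through the boundary map, by a functional that extends to all chains\<close>
    have vp: "vector_space_pair (scale_chain :: rat \<Rightarrow> ('a list \<Rightarrow>\<^sub>0 rat) \<Rightarrow> _) (scale_chain :: rat \<Rightarrow> ('a list \<Rightarrow>\<^sub>0 rat) \<Rightarrow> _)"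
      by (intro vector_space_pair.intro pm.vector_space_axioms)
    obtain r where r: "range r \<subseteq> bar_chains G n" "Vector_Spaces.linear scale_chain scale_chain r"
      "\<forall>v\<in>bar_boundary G ` bar_chains G n. bar_boundary G (r v) = v"
      using vector_space_pair.linear_exists_right_inverse_on[OF vp linear_bar_boundary[of G] subspace_bar_chains[of G n]] by metis
    have "Vector_Spaces.linear scale_chain (*) (\<lambda>v. evaluate f (r v))"
      using Vector_Spaces.linear_compose[OF r(2) ev.linear_right[of f]] by (simp add: o_def)
    then obtain g where g: "g \<in> cochains (carrier G) (Suc (n - 1))" "\<forall>c\<in>bar_chains G (n - 1). evaluate g c = evaluate f (r c)"
      by (rule represent_functional_by_cochain)
    have gn: "g \<in> cochains (carrier G) n" using g(1) n by simp
    have "cobd g = f"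
    proof (rule cochain_eqI[OF cobd_cochains[OF gn order_refl] cocyclesD(1)[OF f]])
      fix c assume c: "c \<in> bar_chains G n"
      have d: "bar_boundary G c \<in> bar_chains G (n - 1)" using bar_boundary_closed[OF grp, of c "n - 1"] c n by simp
      have "r (bar_boundary G c) - c \<in> bar_cycles G n"
      proof -
        interpret d: Vector_Spaces.linear scale_chain scale_chain "bar_boundary G" by (rule linear_bar_boundary)
        have "r (bar_boundary G c) \<in> bar_chains G n" using r(1) by blast
        then show ?thesis using r(3) c pm.subspace_diff[OF subspace_bar_chains] by (simp add: bar_cycles_def d.diff)
      qed
      then have "evaluate f (r (bar_boundary G c) - c) = 0" by (rule 0)
      then have "evaluate f (r (bar_boundary G c)) = evaluate f c" by (simp add: ev.diff_right)
      then show "evaluate (cobd g) c = evaluate f c" using evaluate_boundary[OF gn c n] g(2) d by simp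
    qed
    then show ?thesis using gn by (auto simp: coboundaries_Suc)
  qed
  have nondeg': "c \<in> bar_boundaries G n" if c: "c \<in> bar_cycles G n" and 0: "\<And>f. f \<in> ?Z \<Longrightarrow> evaluate f c = 0" for c
  proof (rule ccontr)
    assume "c \<notin> bar_boundaries G n"
    then obtain \<phi> where phi: "Vector_Spaces.linear scale_chain (*) \<phi>" "\<forall>b\<in>bar_boundaries G n. \<phi> b = 0" "\<phi> c = (1::rat)"
      by (rule pm.exists_functional_separating[OF subspace_bar_boundaries])
    obtain f where f: "f \<in> cochains (carrier G) (Suc n)" "\<forall>c\<in>bar_chains G n. evaluate f c = \<phi> c"
      by (rule represent_functional_by_cochain[OF phi(1)])
    have "cobd f = 0"
    proof (rule cochain_eqI[OF cobd_cochains[OF f(1) order_refl] fn.subspace_0[OF subspace_cochains]])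
      fix c' assume c': "c' \<in> bar_chains G (Suc n)"
      have "evaluate (cobd f) c' = evaluate f (bar_boundary G c')" using evaluate_boundary[OF f(1) c'] by simp
      also have "\<dots> = \<phi> (bar_boundary G c')" using f(2) bar_boundary_closed[OF grp c'] by blast
      also have "\<dots> = 0" using phi(2) c' by (auto simp: bar_boundaries_def)
      finally show "evaluate (cobd f) c' = evaluate 0 c'" by (simp add: ev.zero_left)
    qed
    then have "f \<in> ?Z" using f(1) by (simp add: cocycles_def)
    then have "\<phi> c = 0" using 0 f(2) bar_cyclesD(1)[OF c] by metis
    then show False using phi(3) by simp
  qed
  obtain e f where ef: "\<forall>i<fn.qdim ?B ?Z. e i \<in> ?Z" "\<forall>i<fn.qdim ?B ?Z. f i \<in> bar_cycles G n"
    "\<forall>i<fn.qdim ?B ?Z. \<forall>j<fn.qdim ?B ?Z. evaluate (e i) (f j) = (if i = j then 1 else 0)"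
    "\<forall>y\<in>bar_cycles G n. y - (\<Sum>i<fn.qdim ?B ?Z. scale_chain (evaluate (e i) y) (f i)) \<in> bar_boundaries G n"
    by (rule ev.perfect_dual_system[OF subspace_cocycles subspace_bar_cycles subspace_coboundaries
        coboundaries_subset[OF order_refl] kill nondeg nondeg' fin])
  show ?thesis
    by (rule betti_eqI[where f = f and \<phi> = "\<lambda>i. evaluate (e i)", OF grp])
       (use ef kill' ev.linear_right in auto)
qed

end

theorem corollary14:
  fixes N :: "('a, 'b) monoid_scheme"
  assumes "group N"
    and "finitely_generated_group N"
    and "nilpotent_group N"
    and "hirsch_length N = 5"
  shows "betti N 2 > betti N 1"
proof -
  interpret group_cochains N by (intro group_cochains.intro assms(1))
  note main = second_betti_exceeds_first_cohomology[OF assms(2-4)]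
  have "betti N 1 = H_dim (carrier N) 2"
    using betti_eq_qdim[of 1] duality_finite[OF main(1), of 2] by (simp add: numeral_2_eq_2)
  moreover have "betti N 2 = H_dim (carrier N) 3"
    using betti_eq_qdim[of 2] duality_finite[OF main(1), of 3] by simp
  ultimately show ?thesis using main(2) by simp
qed

end
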